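(* There exists an algorithm that, given a metric graph $\Gamma$ and a divisor $D$ on $\Gamma$, computes (in finite time on every input) the rank $r_\Gamma(D)$ of $D$.
   Context: Computational model: since edge lengths and positions of points may be irrational, the algorithm is allowed to perform real arithmetic operations (and comparisons) with infinite precision. The input consists of the underlying finite multigraph, the real edge lengths, and the divisor given as a finite list of points (each described by an edge and a position on it) with integer coefficients. A metric graph $\Gamma$ is a finite connected multigraph (loops and parallel edges allowed) in which each edge is assigned a positive (finite) real length; each edge is identified with a closed interval of that length, with the end points of the interval identified with the end vertices of the edge. The points of $\Gamma$ are all points of these intervals. $\mathrm{Div}(\Gamma)$ is the free abelian group on the set of points of $\Gamma$; a divisor $D=\sum_v D(v)(v)$ is effective ($D\ge0$) if $D(v)\ge 0$ for all $v$, and $\deg(D)=\sum_v D(v)$. A rational function on $\Gamma$ is a continuous function $f:\Gamma\to\mathbb R$ which is piecewise linear with finitely many pieces and integer slopes on every edge. For a point $v$, $\mathrm{ord}_v(f)$ is the sum of the outgoing slopes of $f$ over all segments emanating from $v$, and $\mathrm{div}(f)=\sum_v\mathrm{ord}_v(f)(v)$. Divisors $D,D'$ are equivalent, $D\sim D'$, if $D=D'+\mathrm{div}(f)$ for some rational function $f$. Put $|D|=\{E\in\mathrm{Div}(\Gamma):E\ge0,\ E\sim D\}$. The rank of $D$ is $$r_\Gamma(D)=\min\{\deg(E):E\in\mathrm{Div}(\Gamma),\ E\ge0,\ |D-E|=\emptyset\}-1.$$ *)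

theory Defs
  imports "HOL-Analysis.Analysis" "HOL-Library.Poly_Mapping"
begin

section \<open>Metric graphs\<close>

text \<open>
  A finite multigraph with edge lengths is given by its number of vertices (the vertices are
  the numbers below it) and a list of triples (start, end, length), one for each edge.
  The edges are named by their indices in the list, so that loops and parallel edges are allowed.
  The order of the two ends of an edge has no meaning beyond fixing which end of the interval is
  position 0.
\<close>

record multigraph =
  num_vertices :: nat
  edges :: "(nat \<times> nat \<times> real) list"

abbreviation num_edges :: "multigraph \<Rightarrow> nat" where
  "num_edges G \<equiv> length (edges G)"

definition esrc :: "multigraph \<Rightarrow> nat \<Rightarrow> nat" where
  "esrc G e = fst (edges G ! e)"

definition etgt :: "multigraph \<Rightarrow> nat \<Rightarrow> nat" where
  "etgt G e = fst (snd (edges G ! e))"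

definition elen :: "multigraph \<Rightarrow> nat \<Rightarrow> real" where
  "elen G e = snd (snd (edges G ! e))"

definition adjacency :: "multigraph \<Rightarrow> (nat \<times> nat) set" where
  "adjacency G = {(u, v). \<exists>e<num_edges G. {u, v} = {esrc G e, etgt G e}}"

definition metric_graph :: "multigraph \<Rightarrow> bool" where
  "metric_graph G \<longleftrightarrow>
     num_vertices G > 0 \<and>
     (\<forall>e<num_edges G. esrc G e < num_vertices G \<and> etgt G e < num_vertices G \<and> elen G e > 0) \<and>
     (\<forall>u<num_vertices G. \<forall>v<num_vertices G. (u, v) \<in> (adjacency G)\<^sup>*)"

text \<open>
  A description of a point is a vertex or a position on an edge.  The identification of
  the end points of the edges with the vertices is carried out by choosing the canonical
  description of each point: a vertex, or a position in the interior of an edge.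
\<close>

datatype location = Vertex nat | OnEdge nat real

definition locations :: "multigraph \<Rightarrow> location set" where
  "locations G = {Vertex v | v. v < num_vertices G} \<union>
                 {OnEdge e x | e x. e < num_edges G \<and> 0 \<le> x \<and> x \<le> elen G e}"

fun point_at :: "multigraph \<Rightarrow> location \<Rightarrow> location" where
  "point_at G (Vertex v) = Vertex v"
| "point_at G (OnEdge e x) =
     (if x = 0 then Vertex (esrc G e)
      else if x = elen G e then Vertex (etgt G e)
      else OnEdge e x)"

definition points :: "multigraph \<Rightarrow> location set" where
  "points G = point_at G ` locations G"

text \<open>The quotient topology of the disjoint union of the edge intervals (and the vertices).\<close>

definition graph_topology :: "multigraph \<Rightarrow> location topology" where
  "graph_topology G = topology (\<lambda>U. U \<subseteq> points G \<and>
     (\<forall>e<num_edges G. openin (top_of_set {0..elen G e})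
                             {x \<in> {0..elen G e}. point_at G (OnEdge e x) \<in> U}))"

lemma istopology_graph_topology:
  "istopology (\<lambda>U. U \<subseteq> points G \<and>
     (\<forall>e<num_edges G. openin (top_of_set {0..elen G e})
                             {x \<in> {0..elen G e}. point_at G (OnEdge e x) \<in> U}))"
  unfolding istopology_def
proof (intro conjI allI impI, goal_cases)
  case (1 S T)
  then show ?case by auto
next
  case (2 S T e)
  have "{x \<in> {0..elen G e}. point_at G (OnEdge e x) \<in> S \<inter> T} =
        {x \<in> {0..elen G e}. point_at G (OnEdge e x) \<in> S} \<inter>
        {x \<in> {0..elen G e}. point_at G (OnEdge e x) \<in> T}" by blast
  with 2 show ?case by (metis (no_types, lifting) openin_Int)
next
  case (3 K)
  then show ?case by auto
next
  case (4 K e)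
  have "{x \<in> {0..elen G e}. point_at G (OnEdge e x) \<in> \<Union>K} =
        (\<Union>U\<in>K. {x \<in> {0..elen G e}. point_at G (OnEdge e x) \<in> U})" by blast
  with 4 show ?case by (simp only:) (rule openin_Union, blast)
qed


section \<open>Rational functions, divisors and rank\<close>

definition along_edge :: "multigraph \<Rightarrow> (location \<Rightarrow> real) \<Rightarrow> nat \<Rightarrow> real \<Rightarrow> real" where
  "along_edge G f e x = f (point_at G (OnEdge e x))"

definition piecewise_linear_int :: "real \<Rightarrow> (real \<Rightarrow> real) \<Rightarrow> bool" where
  "piecewise_linear_int l g \<longleftrightarrow>
     (\<exists>(n::nat) t. t 0 = 0 \<and> t n = l \<and> (\<forall>i<n. t i < t (Suc i)) \<and>
        (\<forall>i<n. \<exists>m::int. \<forall>x\<in>{t i..t (Suc i)}. g x = g (t i) + of_int m * (x - t i)))"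

text \<open>Only the values of a function at the points of the graph are relevant.\<close>

definition rational_function :: "multigraph \<Rightarrow> (location \<Rightarrow> real) \<Rightarrow> bool" where
  "rational_function G f \<longleftrightarrow>
     continuous_map (graph_topology G) euclideanreal f \<and>
     (\<forall>e<num_edges G. piecewise_linear_int (elen G e) (along_edge G f e))"

text \<open>The slopes of a function with integer slopes when moving away from a position in the
  direction of larger and of smaller positions, respectively.\<close>

definition slope_up :: "(real \<Rightarrow> real) \<Rightarrow> real \<Rightarrow> int" where
  "slope_up g x = (THE m. \<forall>\<^sub>F y in at_right x. g y = g x + of_int m * (y - x))"

definition slope_down :: "(real \<Rightarrow> real) \<Rightarrow> real \<Rightarrow> int" where
  "slope_down g x = (THE m. \<forall>\<^sub>F y in at_left x. g y = g x + of_int m * (x - y))"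

text \<open>A loop contributes two segments emanating from its vertex.\<close>

fun ord_at :: "multigraph \<Rightarrow> (location \<Rightarrow> real) \<Rightarrow> location \<Rightarrow> int" where
  "ord_at G f (Vertex v) =
     (\<Sum>e | e < num_edges G \<and> esrc G e = v. slope_up (along_edge G f e) 0) +
     (\<Sum>e | e < num_edges G \<and> etgt G e = v. slope_down (along_edge G f e) (elen G e))"
| "ord_at G f (OnEdge e x) = slope_up (along_edge G f e) x + slope_down (along_edge G f e) x"

text \<open>Divisors are the elements of the free abelian group on the points, as formal integer
  combinations with finite support.\<close>

definition Div :: "multigraph \<Rightarrow> (location \<Rightarrow>\<^sub>0 int) set" where
  "Div G = {D. Poly_Mapping.keys D \<subseteq> points G}"

definition deg :: "(location \<Rightarrow>\<^sub>0 int) \<Rightarrow> int" where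
  "deg D = (\<Sum>p\<in>Poly_Mapping.keys D. Poly_Mapping.lookup D p)"

definition effective :: "(location \<Rightarrow>\<^sub>0 int) \<Rightarrow> bool" where
  "effective D \<longleftrightarrow> (\<forall>p. Poly_Mapping.lookup D p \<ge> 0)"

text \<open>For a rational function only finitely many points have non-zero order.\<close>

definition principal_divisor :: "multigraph \<Rightarrow> (location \<Rightarrow> real) \<Rightarrow> (location \<Rightarrow>\<^sub>0 int)" where
  "principal_divisor G f =
     (\<Sum>p | p \<in> points G \<and> ord_at G f p \<noteq> 0. frag_cmul (ord_at G f p) (frag_of p))"

definition equivalent :: "multigraph \<Rightarrow> (location \<Rightarrow>\<^sub>0 int) \<Rightarrow> (location \<Rightarrow>\<^sub>0 int) \<Rightarrow> bool" where
  "equivalent G D D' \<longleftrightarrow> (\<exists>f. rational_function G f \<and> D = D' + principal_divisor G f)"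

definition linear_system :: "multigraph \<Rightarrow> (location \<Rightarrow>\<^sub>0 int) \<Rightarrow> (location \<Rightarrow>\<^sub>0 int) set" where
  "linear_system G D = {E \<in> Div G. effective E \<and> equivalent G E D}"

definition divisor_rank :: "multigraph \<Rightarrow> (location \<Rightarrow>\<^sub>0 int) \<Rightarrow> int" where
  "divisor_rank G D =
     (LEAST d. \<exists>E\<in>Div G. effective E \<and> linear_system G (D - E) = {} \<and> d = deg E) - 1"


section \<open>Algorithms with exact real arithmetic\<close>

text \<open>
  Programs manipulate finite trees whose leaves are real numbers or the atom \<open>Null\<close>.
  They can use field arithmetic on reals and order comparison, both exact.  There is no rounding
  to integers, and the only numerical constants are 0 and 1: with arbitrary real constants,
  a program could carry infinitely much information.
\<close>

datatype data = Null | Num real | Pair data data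

datatype expr =
    Var nat
  | NullConst
  | ZeroConst
  | OneConst
  | MkPair expr expr
  | First expr
  | Second expr
  | Add expr expr
  | Sub expr expr
  | Mul expr expr
  | Divide expr expr

datatype test =
    Less expr expr
  | IsNull expr
  | IsPair expr
  | Not test
  | And test test

datatype program =
    Skip
  | Assign nat expr
  | Seq program program
  | If test program program
  | While test program

type_synonym state = "nat \<Rightarrow> data"

text \<open>Ill-typed operations return \<open>Null\<close>; division by zero returns 0.\<close>

fun arith :: "(real \<Rightarrow> real \<Rightarrow> real) \<Rightarrow> data \<Rightarrow> data \<Rightarrow> data" where
  "arith h (Num x) (Num y) = Num (h x y)"
| "arith h _ _ = Null"

fun first :: "data \<Rightarrow> data" where
  "first (Pair a b) = a"
| "first _ = Null"

fun second :: "data \<Rightarrow> data" where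
  "second (Pair a b) = b"
| "second _ = Null"

fun less_data :: "data \<Rightarrow> data \<Rightarrow> bool" where
  "less_data (Num x) (Num y) \<longleftrightarrow> x < y"
| "less_data _ _ \<longleftrightarrow> False"

fun expr_val :: "expr \<Rightarrow> state \<Rightarrow> data" where
  "expr_val (Var i) s = s i"
| "expr_val NullConst s = Null"
| "expr_val ZeroConst s = Num 0"
| "expr_val OneConst s = Num 1"
| "expr_val (MkPair a b) s = Pair (expr_val a s) (expr_val b s)"
| "expr_val (First a) s = first (expr_val a s)"
| "expr_val (Second a) s = second (expr_val a s)"
| "expr_val (Add a b) s = arith (+) (expr_val a s) (expr_val b s)"
| "expr_val (Sub a b) s = arith (-) (expr_val a s) (expr_val b s)"
| "expr_val (Mul a b) s = arith (*) (expr_val a s) (expr_val b s)"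
| "expr_val (Divide a b) s = arith (/) (expr_val a s) (expr_val b s)"

fun test_val :: "test \<Rightarrow> state \<Rightarrow> bool" where
  "test_val (Less a b) s \<longleftrightarrow> less_data (expr_val a s) (expr_val b s)"
| "test_val (IsNull a) s \<longleftrightarrow> expr_val a s = Null"
| "test_val (IsPair a) s \<longleftrightarrow> (\<exists>u v. expr_val a s = Pair u v)"
| "test_val (Not b) s \<longleftrightarrow> \<not> test_val b s"
| "test_val (And b c) s \<longleftrightarrow> test_val b s \<and> test_val c s"

text \<open>\<open>run c s t\<close>: the program \<open>c\<close> started in state \<open>s\<close> halts after finitely many steps,
  in state \<open>t\<close>.\<close>

inductive run :: "program \<Rightarrow> state \<Rightarrow> state \<Rightarrow> bool" where
  Skip: "run Skip s s"
| Assign: "run (Assign i a) s (s(i := expr_val a s))"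
| Seq: "run c s s' \<Longrightarrow> run d s' t \<Longrightarrow> run (Seq c d) s t"
| IfTrue: "test_val b s \<Longrightarrow> run c s t \<Longrightarrow> run (If b c d) s t"
| IfFalse: "\<not> test_val b s \<Longrightarrow> run d s t \<Longrightarrow> run (If b c d) s t"
| WhileFalse: "\<not> test_val b s \<Longrightarrow> run (While b c) s s"
| WhileTrue: "test_val b s \<Longrightarrow> run c s s' \<Longrightarrow> run (While b c) s' t \<Longrightarrow> run (While b c) s t"

inductive_cases SkipE: "run Skip s t"
inductive_cases AssignE: "run (Assign i a) s t"
inductive_cases SeqE: "run (Seq c d) s t"
inductive_cases IfE: "run (If b c d) s t"
inductive_cases WhileE: "run (While b c) s t"

lemma run_deterministic: "run c s t \<Longrightarrow> run c s u \<Longrightarrow> t = u"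
proof (induction arbitrary: u rule: run.induct)
  case (WhileTrue b s c s' t)
  then show ?case by (blast elim: WhileE)
qed (blast elim: SkipE AssignE SeqE IfE WhileE)+

text \<open>The input is read from variable 0, all other variables being initially \<open>Null\<close>, and the
  output is left in variable 0.\<close>

definition halts_with :: "program \<Rightarrow> data \<Rightarrow> data \<Rightarrow> bool" where
  "halts_with c inp outp \<longleftrightarrow> (\<exists>t. run c ((\<lambda>_. Null)(0 := inp)) t \<and> t 0 = outp)"


section \<open>Input of the rank algorithm\<close>

text \<open>A divisor is presented by a list of locations with coefficients; different entries may
  describe the same point, and their coefficients are then added.\<close>

definition valid_presentation :: "multigraph \<Rightarrow> (location \<times> int) list \<Rightarrow> bool" where
  "valid_presentation G ds \<longleftrightarrow> fst ` set ds \<subseteq> locations G"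

definition presented_divisor :: "multigraph \<Rightarrow> (location \<times> int) list \<Rightarrow> (location \<Rightarrow>\<^sub>0 int)" where
  "presented_divisor G ds = (\<Sum>(p, c)\<leftarrow>ds. frag_cmul c (frag_of (point_at G p)))"

fun encode_list :: "('a \<Rightarrow> data) \<Rightarrow> 'a list \<Rightarrow> data" where
  "encode_list enc [] = Null"
| "encode_list enc (x # xs) = Pair (enc x) (encode_list enc xs)"

definition encode_nat :: "nat \<Rightarrow> data" where
  "encode_nat n = Num (real n)"

definition encode_int :: "int \<Rightarrow> data" where
  "encode_int k = Num (real_of_int k)"

fun encode_edge :: "nat \<times> nat \<times> real \<Rightarrow> data" where
  "encode_edge (u, v, l) = Pair (encode_nat u) (Pair (encode_nat v) (Num l))"

definition encode_graph :: "multigraph \<Rightarrow> data" where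
  "encode_graph G = Pair (encode_nat (num_vertices G)) (encode_list encode_edge (edges G))"

fun encode_location :: "location \<Rightarrow> data" where
  "encode_location (Vertex v) = encode_nat v"
| "encode_location (OnEdge e x) = Pair (encode_nat e) (Num x)"

fun encode_entry :: "location \<times> int \<Rightarrow> data" where
  "encode_entry (p, c) = Pair (encode_location p) (encode_int c)"

definition encode_input :: "multigraph \<Rightarrow> (location \<times> int) list \<Rightarrow> data" where
  "encode_input G ds = Pair (encode_graph G) (encode_list encode_entry ds)"

end

theory Submission
  imports Defs
begin

text \<open>
  Subdivide the edges at the support of \<open>D\<close>.  Replacing a rational function between neighbouring
  vertices by a convex one with the same values at the vertices shows that \<open>|D|\<close> is non-empty
  iff there is a function \<open>f\<close> on the vertices with
  \<open>D(w) + \<Sum> \<lfloor>(f(w') - f(w)) / l\<rfloor> \<ge> 0\<close> for all vertices \<open>w\<close>, the sum being over the segments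
  from \<open>w\<close> to a neighbour \<open>w'\<close>, of length \<open>l\<close>.  The rounded slopes are bounded by the
  coefficients of \<open>D\<close>, and shifting \<open>f\<close> until enough of the
  inequalities are tight, one may take the values of \<open>f\<close> among finitely many explicit integral
  combinations of the lengths.  So it is decidable whether \<open>|D|\<close> is empty.

  Moreover, if \<open>|D - (a)|\<close> and \<open>|D - (b)|\<close> are non-empty for two different points \<open>a\<close>, \<open>b\<close> of an
  edge, then so is \<open>|D - (c)|\<close> for every \<open>c\<close> between them: maxima of functions
  witnessing the former move a chip either to \<open>c\<close>, or to both sides of \<open>c\<close>, from where two chips
  can approach \<open>c\<close> at equal speed.  Hence in the definition of the rank only divisors \<open>E\<close> supported
  on the vertices and the midpoints of the edges matter, and the rank is found by an
  unbounded search on the degree of \<open>E\<close>.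
\<close>

section \<open>Functions computable by programs\<close>

text \<open>The theorem asks for one program in a language without procedures or rounding. The
  search is therefore written as a function on HOL data, assembled from few combinators, and
  \<open>computable_on\<close> is shown to be closed under these; no program text for the algorithm
  is verified by hand. Its parts are total, so inputs that present nothing need no separate
  treatment, and only the last unbounded search carries a domain on which it ends.

  The obstacle on the mathematical side is that solutions have real values. Once the rounded slopes
  are fixed, the conditions are lower bounds on differences \<open>f(w') - f(w)\<close>, as in
  shortest path problems, and a solution with enough tight conditions has path sums as values. The
  bound on the slopes depends on the divisor alone, so it survives every change of \<open>f\<close>
  on the way to such a solution.

  The statement about points of an edge holds for every divisor. This is what allows
  \<open>E\<close> to be moved into the finite set one point at a time, all other points of
  \<open>E\<close> being absorbed into the divisor.\<close>

class encodable =
  fixes enc :: "'a \<Rightarrow> data"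

instantiation nat :: encodable begin
definition "enc = encode_nat"
instance ..
end

instantiation int :: encodable begin
definition "enc = encode_int"
instance ..
end

instantiation real :: encodable begin
definition "enc = Num"
instance ..
end

text \<open>With \<open>False\<close> as \<open>Null\<close>, a stored truth value can be read by
  the test \<open>IsNull\<close>.\<close>

instantiation bool :: encodable begin
definition "enc b = (if b then Num 1 else Null)"
instance ..
end

instantiation unit :: encodable begin
definition "enc (x :: unit) = Null"
instance ..
end

instantiation location :: encodable begin
definition "enc = encode_location"
instance ..
end

instantiation prod :: (encodable, encodable) encodable begin
definition "enc p = Pair (enc (fst p)) (enc (snd p))"
instance ..
end

instantiation list :: (encodable) encodable begin
definition "enc = encode_list enc"
instance ..
end

lemmas enc_simps = enc_nat_def enc_int_def enc_real_def enc_bool_def enc_location_def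
  enc_prod_def enc_list_def enc_unit_def encode_nat_def encode_int_def

text \<open>The number \<open>n\<close> bounds the variables that may be changed, so a surrounding
  program can keep its data from \<open>n\<close> upwards. The state is arbitrary apart from
  variable 0: programs can run one after another without clearing their variables.\<close>

definition computes :: "program \<Rightarrow> nat \<Rightarrow> 'a set \<Rightarrow> ('a::encodable \<Rightarrow> 'b::encodable) \<Rightarrow> bool" where
  "computes c n A f \<longleftrightarrow> (\<forall>s. \<forall>x\<in>A. s 0 = enc x \<longrightarrow>
     (\<exists>t. run c s t \<and> t 0 = enc (f x) \<and> (\<forall>i\<ge>n. t i = s i)))"

definition computable_on :: "'a set \<Rightarrow> ('a::encodable \<Rightarrow> 'b::encodable) \<Rightarrow> bool" where
  "computable_on A f \<longleftrightarrow> (\<exists>c n. computes c n A f)"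

abbreviation computable :: "('a::encodable \<Rightarrow> 'b::encodable) \<Rightarrow> bool" where
  "computable \<equiv> computable_on UNIV"

lemma computes_mono: "computes c n A f \<Longrightarrow> n \<le> m \<Longrightarrow> computes c m A f"
  unfolding computes_def by (meson le_trans)

lemma computesD:
  assumes "computes c n A f" "x \<in> A" "s 0 = enc x"
  obtains t where "run c s t" "t 0 = enc (f x)" "\<And>i. i \<ge> n \<Longrightarrow> t i = s i"
  using assms unfolding computes_def by blast

lemma computable_subset: "computable_on B f \<Longrightarrow> A \<subseteq> B \<Longrightarrow> computable_on A f"
  unfolding computable_on_def computes_def by (meson subsetD)

lemma computable_expr:
  assumes "\<And>s x. x \<in> A \<Longrightarrow> s 0 = enc x \<Longrightarrow> expr_val a s = enc (f x)"
  shows "computable_on A f"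
proof -
  have "computes (Assign 0 a) 1 A f"
    unfolding computes_def
  proof (intro allI ballI impI)
    fix s :: state and x assume "x \<in> A" "s 0 = enc x"
    then show "\<exists>t. run (Assign 0 a) s t \<and> t 0 = enc (f x) \<and> (\<forall>i\<ge>1. t i = s i)"
      using assms[of x s] run.Assign[of 0 a s] by (intro exI[of _ "s(0 := expr_val a s)"]) simp
  qed
  then show ?thesis by (auto simp: computable_on_def)
qed

lemma computable_comp:
  assumes "computable_on B g" "computable_on A f" "\<And>x. x \<in> A \<Longrightarrow> f x \<in> B"
  shows "computable_on A (\<lambda>x. g (f x))"
proof -
  obtain c m d n where c: "computes c m A f" and d: "computes d n B g"
    using assms by (auto simp: computable_on_def)
  have "computes (Seq c d) (max m n) A (\<lambda>x. g (f x))"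
    unfolding computes_def
  proof (intro allI ballI impI)
    fix s :: state and x assume x: "x \<in> A" "s 0 = enc x"
    obtain t where t: "run c s t" "t 0 = enc (f x)" "\<And>i. i \<ge> m \<Longrightarrow> t i = s i"
      using computesD[of c m A f x s, OF c x] by blast
    obtain u where u: "run d t u" "u 0 = enc (g (f x))" "\<And>i. i \<ge> n \<Longrightarrow> u i = t i"
      using computesD[of d n B g "f x" t, OF d assms(3)[OF x(1)] t(2)] by blast
    show "\<exists>t. run (Seq c d) s t \<and> t 0 = enc (g (f x)) \<and> (\<forall>i\<ge>max m n. t i = s i)"
      using t u by (intro exI[of _ u]) (auto intro: run.Seq)
  qed
  then show ?thesis by (auto simp: computable_on_def)
qed

lemma computable_Pair:
  assumes "computable_on A f" "computable_on A g"
  shows "computable_on A (\<lambda>x. (f x, g x))"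
proof -
  obtain c m d n where "computes c m A f" "computes d n A g"
    using assms by (auto simp: computable_on_def)
  then obtain N where c: "computes c N A f" and d: "computes d N A g" and "N > 0"
    using computes_mono[of _ _ A _ "Suc (max m n)"] by (metis le_SucI max.cobounded1 max.cobounded2 zero_less_Suc)
  \<comment> \<open>Variable \<open>N\<close> keeps the argument while \<open>c\<close> runs, and
    \<open>Suc N\<close> keeps the first result while \<open>d\<close> runs; neither program touches
    them.\<close>
  let ?p = "Seq (Assign N (Var 0)) (Seq c (Seq (Assign (Suc N) (Var 0)) (Seq (Assign 0 (Var N))
    (Seq d (Assign 0 (MkPair (Var (Suc N)) (Var 0)))))))"
  have "computes ?p (N + 2) A (\<lambda>x. (f x, g x))"
    unfolding computes_def
  proof (intro allI ballI impI)
    fix s :: state and x assume x: "x \<in> A" "s 0 = enc x"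
    let ?s1 = "s(N := s 0)"
    obtain t where t: "run c ?s1 t" "t 0 = enc (f x)" "\<And>i. i \<ge> N \<Longrightarrow> t i = ?s1 i"
      using computesD[OF c x(1), of ?s1] x \<open>N > 0\<close> by auto
    let ?t2 = "t(Suc N := t 0, 0 := t N)"
    obtain u where u: "run d ?t2 u" "u 0 = enc (g x)" "\<And>i. i \<ge> N \<Longrightarrow> u i = ?t2 i"
      using computesD[OF d x(1), of ?t2] x t \<open>N > 0\<close> by auto
    let ?v = "u(0 := Pair (u (Suc N)) (u 0))"
    have "run ?p s ?v"
      using t(1) u(1)
      by (auto intro!: run.Seq[OF run.Assign[of N "Var 0" s]] run.Seq[OF t(1)]
            run.Seq[OF run.Assign[of "Suc N" "Var 0" t]]
            run.Seq[OF run.Assign[of 0 "Var N" "t(Suc N := t 0)"]]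
            run.Seq[OF u(1)] simp: run.Assign[of 0 "MkPair (Var (Suc N)) (Var 0)" u, simplified])
    moreover have "?v 0 = enc (f x, g x)"
      using u t \<open>N > 0\<close> by (simp add: enc_prod_def)
    moreover have "\<forall>i\<ge>N+2. ?v i = s i"
      using u t \<open>N > 0\<close> by auto
    ultimately show "\<exists>t. run ?p s t \<and> t 0 = enc (f x, g x) \<and> (\<forall>i\<ge>N+2. t i = s i)"
      by blast
  qed
  then show ?thesis by (auto simp: computable_on_def)
qed

text \<open>Encodings of different types overlap, so that a branch may read the value in variable 0 at a
  type of its own.\<close>

lemma computable_branch:
  fixes f :: "'a::encodable \<Rightarrow> 'd::encodable"
    and g :: "'b::encodable \<Rightarrow> 'd" and h :: "'c::encodable \<Rightarrow> 'd"
  assumes "computable_on B g" "computable_on C h"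
    and "\<And>s x. x \<in> A \<Longrightarrow> s 0 = enc x \<Longrightarrow>
      if test_val b s then \<exists>y\<in>B. enc y = enc x \<and> g y = f x else \<exists>y\<in>C. enc y = enc x \<and> h y = f x"
  shows "computable_on A f"
proof -
  obtain c m d n where c: "computes c m B g" and d: "computes d n C h"
    using assms by (auto simp: computable_on_def)
  have "computes (If b c d) (max m n) A f"
    unfolding computes_def
  proof (intro allI ballI impI)
    fix s :: state and x assume x: "x \<in> A" "s 0 = enc x"
    show "\<exists>t. run (If b c d) s t \<and> t 0 = enc (f x) \<and> (\<forall>i\<ge>max m n. t i = s i)"
    proof (cases "test_val b s")
      case True
      then obtain y where "y \<in> B" "enc y = enc x" "g y = f x" using assms(3)[of x s, OF x] by auto
      then show ?thesis using computesD[OF c, of y s] x True by (metis max.boundedE run.IfTrue)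
    next
      case False
      then obtain y where "y \<in> C" "enc y = enc x" "h y = f x" using assms(3)[of x s, OF x] by auto
      then show ?thesis using computesD[OF d, of y s] x False by (metis max.boundedE run.IfFalse)
    qed
  qed
  then show ?thesis by (auto simp: computable_on_def)
qed

text \<open>A test of the language only inspects expressions, so a condition that needs computation
  of its own must be evaluated in advance and carried along as a flag.\<close>

lemma computable_while_flag:
  fixes F :: "bool \<times> 'a::encodable \<Rightarrow> bool \<times> 'a"
  assumes "computable F"
  shows "computable_on {y. \<exists>k. \<not> fst ((F ^^ k) y)} (\<lambda>y. (F ^^ (LEAST k. \<not> fst ((F ^^ k) y))) y)"
    (is "computable_on ?A ?f")
proof -
  obtain c n where c: "computes c n UNIV F"
    using assms by (auto simp: computable_on_def)
  define b where "b = Not (IsNull (First (Var 0)))"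
  have b: "test_val b s \<longleftrightarrow> fst y" if "s 0 = enc y" for s :: state and y :: "bool \<times> 'a"
    using that by (simp add: b_def enc_prod_def enc_bool_def)
  have loop: "\<exists>t. run (While b c) s t \<and> t 0 = enc ((F ^^ k) y) \<and> (\<forall>i\<ge>n. t i = s i)"
    if "s 0 = enc y" "\<not> fst ((F ^^ k) y)" "\<forall>j<k. fst ((F ^^ j) y)" for s :: state and y k
    using that
  proof (induction k arbitrary: s y)
    case 0
    then show ?case using b[of s y] by (auto intro: run.WhileFalse)
  next
    case (Suc k)
    have "fst y" using Suc.prems(3)[rule_format, of 0] by simp
    obtain u where u: "run c s u" "u 0 = enc (F y)" "\<And>i. i \<ge> n \<Longrightarrow> u i = s i"
      using computesD[of c n UNIV F y s, OF c UNIV_I Suc.prems(1)] by blast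
    have "\<forall>j<k. fst ((F ^^ j) (F y))"
      using Suc.prems(3)[rule_format, of "Suc _"] by (simp add: funpow_Suc_right del: funpow.simps(2))
    moreover have "\<not> fst ((F ^^ k) (F y))"
      using Suc.prems(2) by (simp add: funpow_Suc_right del: funpow.simps(2))
    ultimately obtain t where "run (While b c) u t" "t 0 = enc ((F ^^ k) (F y))" "\<forall>i\<ge>n. t i = u i"
      using Suc.IH[of u "F y", OF u(2)] by blast
    then show ?case
      using u b[of s y, OF Suc.prems(1)] \<open>fst y\<close> by (intro exI[of _ t]) (auto intro: run.WhileTrue simp: funpow_Suc_right simp del: funpow.simps(2))
  qed
  have "computes (While b c) n ?A ?f"
    unfolding computes_def
  proof (intro allI ballI impI)
    fix s :: state and y assume *: "y \<in> ?A" "s 0 = enc y"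
    show "\<exists>t. run (While b c) s t \<and> t 0 = enc (?f y) \<and> (\<forall>i\<ge>n. t i = s i)"
      by (rule loop[of s y, OF *(2)]) (use * LeastI_ex[of "\<lambda>k. \<not> fst ((F ^^ k) y)"] not_less_Least[of _ "\<lambda>k. \<not> fst ((F ^^ k) y)"] in auto)
  qed
  then show ?thesis by (auto simp: computable_on_def)
qed

section \<open>Elementary operations and case distinctions\<close>

lemma computable_id: "computable_on A (\<lambda>x. x)"
  by (rule computable_expr[of _ "Var 0"]) simp

lemma computable_fst:
  "computable_on A f \<Longrightarrow> computable_on A (\<lambda>x. fst (f x))"
  by (rule computable_comp[of UNIV fst], rule computable_expr[of _ "First (Var 0)"]) (auto simp: enc_prod_def)

lemma computable_snd:
  "computable_on A f \<Longrightarrow> computable_on A (\<lambda>x. snd (f x))"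
  by (rule computable_comp[of UNIV snd], rule computable_expr[of _ "Second (Var 0)"]) (auto simp: enc_prod_def)

lemma computable_comp2:
  assumes "computable (\<lambda>p. h (fst p) (snd p))" "computable_on A f" "computable_on A g"
  shows "computable_on A (\<lambda>x. h (f x) (g x))"
  using computable_comp[OF assms(1) computable_Pair[OF assms(2,3)]] by simp

lemma computable_comp1:
  assumes "computable h" "computable_on A f"
  shows "computable_on A (\<lambda>x. h (f x))"
  using computable_comp[OF assms] by simp

lemma computable_arith_real:
  fixes f g :: "'a::encodable \<Rightarrow> real"
  assumes "computable_on A f" "computable_on A g"
  shows "computable_on A (\<lambda>x. f x + g x)" "computable_on A (\<lambda>x. f x - g x)"
    "computable_on A (\<lambda>x. f x * g x)" "computable_on A (\<lambda>x. f x / g x)"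
  by (rule computable_comp2[rotated, OF assms],
      rule computable_expr[of _ "Add (First (Var 0)) (Second (Var 0))"]
        computable_expr[of _ "Sub (First (Var 0)) (Second (Var 0))"]
        computable_expr[of _ "Mul (First (Var 0)) (Second (Var 0))"]
        computable_expr[of _ "Divide (First (Var 0)) (Second (Var 0))"], simp add: enc_simps; fail)+

lemma computable_arith_int:
  fixes f g :: "'a::encodable \<Rightarrow> int"
  assumes "computable_on A f" "computable_on A g"
  shows "computable_on A (\<lambda>x. f x + g x)" "computable_on A (\<lambda>x. f x - g x)"
  by (rule computable_comp2[rotated, OF assms],
      rule computable_expr[of _ "Add (First (Var 0)) (Second (Var 0))"]
        computable_expr[of _ "Sub (First (Var 0)) (Second (Var 0))"], simp add: enc_simps; fail)+

lemma computable_add_nat: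
  "computable_on A f \<Longrightarrow> computable_on A g \<Longrightarrow> computable_on A (\<lambda>x. f x + g x :: nat)"
  by (erule (1) computable_comp2[rotated], rule computable_expr[of _ "Add (First (Var 0)) (Second (Var 0))"]) (simp add: enc_simps)

lemma computable_zero_one:
  "computable_on A (\<lambda>x. 0 :: real)" "computable_on A (\<lambda>x. 0 :: nat)" "computable_on A (\<lambda>x. 0 :: int)"
  "computable_on A (\<lambda>x. 1 :: real)" "computable_on A (\<lambda>x. 1 :: nat)" "computable_on A (\<lambda>x. 1 :: int)"
  by (rule computable_expr[of _ ZeroConst], simp add: enc_simps; fail |
      rule computable_expr[of _ OneConst], simp add: enc_simps; fail)+

lemma computable_const_bool: "computable_on A (\<lambda>x. b :: bool)"
  by (rule computable_expr[of _ "if b then OneConst else NullConst"]) (simp add: enc_simps)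

text \<open>All number types are encoded by \<open>Num\<close>, so a coercion is the identity on
  encodings. The same happens below for \<open>Cons\<close>, \<open>Vertex\<close> and
  \<open>OnEdge\<close>, whose encodings are those of their arguments.\<close>

lemma computable_coerce:
  "computable_on A f \<Longrightarrow> computable_on A (\<lambda>x. real (f x))"
  "computable_on A f \<Longrightarrow> computable_on A (\<lambda>x. int (f x))"
  "computable_on A g \<Longrightarrow> computable_on A (\<lambda>x. real_of_int (g x))"
  by (rule computable_comp1[rotated], assumption, rule computable_expr[of _ "Var 0"], simp add: enc_simps)+

lemma computable_Nil: "computable_on A (\<lambda>x. [])"
  by (rule computable_expr[of _ NullConst]) (simp add: enc_simps)

lemma computable_Cons:
  "computable_on A f \<Longrightarrow> computable_on A g \<Longrightarrow> computable_on A (\<lambda>x. f x # g x)"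
  by (erule (1) computable_comp2[rotated], rule computable_expr[of _ "Var 0"]) (simp add: enc_simps)

lemma computable_Vertex:
  "computable_on A f \<Longrightarrow> computable_on A (\<lambda>x. Vertex (f x))"
  by (rule computable_comp1[rotated], assumption, rule computable_expr[of _ "Var 0"], simp add: enc_simps)

lemma computable_OnEdge:
  "computable_on A f \<Longrightarrow> computable_on A g \<Longrightarrow> computable_on A (\<lambda>x. OnEdge (f x) (g x))"
  by (erule (1) computable_comp2[rotated], rule computable_expr[of _ "Var 0"]) (simp add: enc_simps)

lemma computable_If:
  assumes "computable_on A b" "computable_on A f" "computable_on A g"
  shows "computable_on A (\<lambda>x. if b x then f x else g x)"
proof -
  \<comment> \<open>The truth value is computed first and paired with the argument, so that a test
    on a component selects the branch.\<close>
  have "computable_on {y. fst y = b (snd y) \<and> snd y \<in> A} (\<lambda>y. if fst y then f (snd y) else g (snd y))"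
  proof (rule computable_branch[where b = "Not (IsNull (First (Var 0)))"])
    show "computable_on {y :: bool \<times> 'a. snd y \<in> A} (\<lambda>y. f (snd y))"
      by (rule computable_comp[OF assms(2)]) (auto intro!: computable_snd computable_id)
    show "computable_on {y :: bool \<times> 'a. snd y \<in> A} (\<lambda>y. g (snd y))"
      by (rule computable_comp[OF assms(3)]) (auto intro!: computable_snd computable_id)
  qed (auto simp: enc_prod_def enc_bool_def)
  from computable_comp[OF this computable_Pair[OF assms(1) computable_id]] show ?thesis
    by (simp cong: if_cong)
qed

text \<open>Since all numbers are encoded by \<open>Num\<close>, one comparison program covers
  reals, naturals and integers.\<close>

lemma computable_less_branch:
  assumes "computable_on A f" "computable_on A g"
    and "\<And>x. x \<in> A \<Longrightarrow> \<exists>a b. enc (f x) = Num a \<and> enc (g x) = Num b \<and> (P x \<longleftrightarrow> a < b)"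
  shows "computable_on A P"
proof -
  have *: "P x \<longleftrightarrow> less_data (enc (f x)) (enc (g x))" if "x \<in> A" for x
    using assms(3)[OF that] by auto
  have "computable (\<lambda>p :: 'b \<times> 'c. less_data (enc (fst p)) (enc (snd p)))"
  proof (rule computable_branch[where b = "Less (First (Var 0)) (Second (Var 0))"])
    show "computable (\<lambda>p :: 'b \<times> 'c. True)" "computable (\<lambda>p :: 'b \<times> 'c. False)"
      by (rule computable_const_bool)+
  qed (auto simp: enc_prod_def)
  from computable_comp2[OF this assms(1,2)] have "computable_on A (\<lambda>x. less_data (enc (f x)) (enc (g x)))" .
  then show ?thesis unfolding computable_on_def computes_def using * by auto
qed

lemma computable_less:
  "computable_on A f \<Longrightarrow> computable_on A g \<Longrightarrow> computable_on A (\<lambda>x. f x < (g x :: real))"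
  "computable_on A f' \<Longrightarrow> computable_on A g' \<Longrightarrow> computable_on A (\<lambda>x. f' x < (g' x :: nat))"
  "computable_on A f'' \<Longrightarrow> computable_on A g'' \<Longrightarrow> computable_on A (\<lambda>x. f'' x < (g'' x :: int))"
  by (erule (1) computable_less_branch, simp add: enc_simps)+

lemma computable_not: "computable_on A P \<Longrightarrow> computable_on A (\<lambda>x. \<not> P x)"
  using computable_If[of A P "\<lambda>_. False" "\<lambda>_. True"] by (simp add: computable_const_bool if_bool_eq_conj)

lemma computable_conj:
  "computable_on A P \<Longrightarrow> computable_on A Q \<Longrightarrow> computable_on A (\<lambda>x. P x \<and> Q x)"
  using computable_If[of A P Q "\<lambda>_. False"] by (simp add: computable_const_bool if_bool_eq_disj)

lemma computable_disj:
  "computable_on A P \<Longrightarrow> computable_on A Q \<Longrightarrow> computable_on A (\<lambda>x. P x \<or> Q x)"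
  using computable_not[OF computable_conj[OF computable_not[of A P] computable_not[of A Q]]] by simp

lemma computable_le:
  "computable_on A f \<Longrightarrow> computable_on A g \<Longrightarrow> computable_on A (\<lambda>x. f x \<le> (g x :: real))"
  "computable_on A f' \<Longrightarrow> computable_on A g' \<Longrightarrow> computable_on A (\<lambda>x. f' x \<le> (g' x :: nat))"
  "computable_on A f'' \<Longrightarrow> computable_on A g'' \<Longrightarrow> computable_on A (\<lambda>x. f'' x \<le> (g'' x :: int))"
  unfolding not_less[symmetric] by (intro computable_not computable_less; assumption)+

lemma computable_eq:
  "computable_on A f \<Longrightarrow> computable_on A g \<Longrightarrow> computable_on A (\<lambda>x. f x = (g x :: real))"
  "computable_on A f' \<Longrightarrow> computable_on A g' \<Longrightarrow> computable_on A (\<lambda>x. f' x = (g' x :: nat))"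
  unfolding order.eq_iff by (intro computable_conj computable_le; assumption)+

lemma computable_case_list:
  fixes l :: "'a::encodable \<Rightarrow> 'b::encodable list"
  assumes "computable_on A l" "computable_on A f" "computable (\<lambda>z. g (fst z) (fst (snd z)) (snd (snd z)))"
  shows "computable_on A (\<lambda>x. case l x of [] \<Rightarrow> f x | y # ys \<Rightarrow> g x y ys)"
proof -
  have "computable_on {y. fst y \<in> A} (\<lambda>y. case snd y of [] \<Rightarrow> f (fst y) | z # zs \<Rightarrow> g (fst y) z zs)"
  proof (rule computable_branch[where b = "IsPair (Second (Var 0))"])
    show "computable (\<lambda>z. g (fst z) (fst (snd z)) (snd (snd z)))" by fact
    \<comment> \<open>The empty list is encoded like the element of \<open>unit\<close>, hence the
      branch for \<open>[]\<close> can read its argument at the type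
      \<open>'a \<times> unit\<close>; a non-empty list is encoded like the pair of its head and
      tail.\<close>
    show "computable_on {y :: 'a \<times> unit. fst y \<in> A} (\<lambda>y. f (fst y))"
      by (rule computable_comp[OF assms(2)]) (auto intro!: computable_fst computable_id)
  next
    fix s :: state and x :: "'a \<times> 'b list" assume "x \<in> {y. fst y \<in> A}" "s 0 = enc x"
    then show "if test_val (IsPair (Second (Var 0))) s
      then \<exists>y\<in>UNIV. enc y = enc x \<and> g (fst y) (fst (snd y)) (snd (snd y)) = (case snd x of [] \<Rightarrow> f (fst x) | z # zs \<Rightarrow> g (fst x) z zs)
      else \<exists>y\<in>{y :: 'a \<times> unit. fst y \<in> A}. enc y = enc x \<and> f (fst y) = (case snd x of [] \<Rightarrow> f (fst x) | z # zs \<Rightarrow> g (fst x) z zs)"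
      by (cases "snd x"; cases x rule: prod.exhaust) (force simp: enc_prod_def enc_list_def enc_unit_def)+
  qed
  from computable_comp[OF this computable_Pair[OF computable_id assms(1)]] show ?thesis
    by (simp only: fst_conv snd_conv UNIV_I mem_Collect_eq simp_thms cong: list.case_cong location.case_cong)
qed

lemma computable_case_location:
  fixes l :: "'a::encodable \<Rightarrow> location"
  assumes "computable_on A l" "computable (\<lambda>z. f (fst z) (snd z))"
    "computable (\<lambda>z. g (fst z) (fst (snd z)) (snd (snd z)))"
  shows "computable_on A (\<lambda>x. case l x of Vertex v \<Rightarrow> f x v | OnEdge e y \<Rightarrow> g x e y)"
proof -
  have "computable (\<lambda>y. case snd y of Vertex v \<Rightarrow> f (fst y) v | OnEdge e z \<Rightarrow> g (fst y) e z)"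
  proof (rule computable_branch[where b = "IsPair (Second (Var 0))"])
    show "computable (\<lambda>z. g (fst z) (fst (snd z)) (snd (snd z)))" "computable (\<lambda>z. f (fst z) (snd z))"
      by fact+
  next
    fix s :: state and x :: "'a \<times> location" assume "x \<in> UNIV" "s 0 = enc x"
    then show "if test_val (IsPair (Second (Var 0))) s
      then \<exists>y\<in>UNIV. enc y = enc x \<and> g (fst y) (fst (snd y)) (snd (snd y)) = (case snd x of Vertex v \<Rightarrow> f (fst x) v | OnEdge e z \<Rightarrow> g (fst x) e z)
      else \<exists>y\<in>UNIV. enc y = enc x \<and> f (fst y) (snd y) = (case snd x of Vertex v \<Rightarrow> f (fst x) v | OnEdge e z \<Rightarrow> g (fst x) e z)"
      by (cases "snd x"; cases x rule: prod.exhaust) (force simp: enc_simps)+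
  qed
  from computable_comp1[OF this, OF computable_Pair[OF computable_id assms(1)]] show ?thesis
    by (simp only: fst_conv snd_conv UNIV_I mem_Collect_eq simp_thms cong: list.case_cong location.case_cong)
qed

section \<open>Loops, unbounded search and iteration\<close>

lemma computable_while:
  fixes F :: "'a::encodable \<Rightarrow> 'a"
  assumes "computable F" "computable P"
  shows "computable_on {y. \<exists>k. \<not> P ((F ^^ k) y)} (\<lambda>y. (F ^^ (LEAST k. \<not> P ((F ^^ k) y))) y)"
proof -
  \<comment> \<open>Each round computes the flag of the new state together with the state.\<close>
  define G where "G = (\<lambda>y :: bool \<times> 'a. (P (F (snd y)), F (snd y)))"
  have G: "(G ^^ k) (P y, y) = (P ((F ^^ k) y), (F ^^ k) y)" for k y
    by (induction k) (auto simp: G_def)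
  have "computable G"
    unfolding G_def
    by (intro computable_Pair computable_comp1[OF assms(1)] computable_comp1[OF assms(2)] computable_snd computable_id)
  have start: "computable_on {y. \<exists>k. \<not> P ((F ^^ k) y)} (\<lambda>y. (P y, y))"
    by (intro computable_Pair computable_id computable_comp1[OF assms(2)])
  have "computable_on {y. \<exists>k. \<not> P ((F ^^ k) y)} (\<lambda>y. (G ^^ (LEAST k. \<not> fst ((G ^^ k) (P y, y)))) (P y, y))"
    by (rule computable_comp[OF computable_while_flag[OF \<open>computable G\<close>] start]) (auto simp: G)
  from computable_snd[OF this] show ?thesis by (simp add: G)
qed

text \<open>Unbounded search by a counter; the domain consists of the arguments for which it
  succeeds.\<close>

lemma computable_Least_on:
  assumes "computable (\<lambda>z. P (fst z) (snd z))"
  shows "computable_on {x. \<exists>n::nat. P x n} (\<lambda>x. LEAST n. P x n)"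
proof -
  define F where "F = (\<lambda>z :: 'a \<times> nat. (fst z, snd z + 1))"
  have F: "(F ^^ k) (x, n) = (x, n + k)" for k x n
    by (induction k) (auto simp: F_def)
  have "computable F" unfolding F_def
    by (intro computable_Pair computable_fst computable_add_nat computable_snd computable_id computable_zero_one)
  have start: "computable_on {x. \<exists>n. P x n} (\<lambda>x. (x, 0 :: nat))"
    by (intro computable_Pair computable_id computable_zero_one)
  have "computable_on {x. \<exists>n. P x n} (\<lambda>x. (F ^^ (LEAST k. \<not> \<not> P (fst ((F ^^ k) (x, 0))) (snd ((F ^^ k) (x, 0))))) (x, 0))"
    by (rule computable_comp[OF computable_while[OF \<open>computable F\<close> computable_not[OF assms]] start]) (auto simp: F)
  from computable_snd[OF this] show ?thesis by (simp add: F)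
qed

lemma computable_Least:
  assumes "computable (\<lambda>z. P (fst z) (snd z))" "\<And>x. \<exists>n::nat. P x n"
  shows "computable_on A (\<lambda>x. LEAST n. P x n)"
  by (rule computable_subset[OF computable_Least_on[OF assms(1)]]) (use assms(2) in auto)

lemma computable_funpow:
  fixes h :: "'a::encodable \<Rightarrow> 'b::encodable \<Rightarrow> 'b"
  assumes "computable_on A N" "computable_on A i" "computable (\<lambda>z. h (fst z) (snd z))"
  shows "computable_on A (\<lambda>x. (h x ^^ N x) (i x))"
proof -
  define F where "F = (\<lambda>z :: ('a \<times> nat) \<times> (nat \<times> 'b). (fst z, (fst (snd z) + 1, h (fst (fst z)) (snd (snd z)))))"
  have F: "(F ^^ k) ((x, m), (n, y)) = ((x, m), (n + k, (h x ^^ k) y))" for k m n x y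
    by (induction k) (auto simp: F_def)
  have "computable F" unfolding F_def
    by (intro computable_Pair computable_fst computable_add_nat computable_snd computable_id computable_zero_one
        computable_comp2[OF assms(3)])
  moreover have "computable (\<lambda>z :: ('a \<times> nat) \<times> (nat \<times> 'b). fst (snd z) < snd (fst z))"
    by (intro computable_fst computable_snd computable_id computable_less)
  ultimately have "computable_on {y. \<exists>k. \<not> fst (snd ((F ^^ k) y)) < snd (fst ((F ^^ k) y))}
    (\<lambda>y. (F ^^ (LEAST k. \<not> fst (snd ((F ^^ k) y)) < snd (fst ((F ^^ k) y)))) y)"
    by (rule computable_while)
  from computable_comp[OF this computable_Pair[OF computable_Pair[OF computable_id assms(1)] computable_Pair[OF computable_zero_one(2) assms(2)]]]
  have "computable_on A (\<lambda>x. (F ^^ (LEAST k. \<not> k < N x)) ((x, N x), (0, i x)))"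
    by (auto simp: F)
  moreover have "(LEAST k. \<not> k < m) = m" for m :: nat
    by (rule Least_equality) auto
  ultimately have "computable_on A (\<lambda>x. ((x, N x), (N x, (h x ^^ N x) (i x))))"
    by (simp add: F)
  from computable_snd[OF computable_snd[OF this]] show ?thesis by simp
qed

text \<open>Left folds are the only recursion on lists that gets a loop of its own: the list
  operations and bounded quantifiers below are rewritten as folds.\<close>

lemma computable_foldl:
  fixes h :: "'a::encodable \<Rightarrow> 'b::encodable \<Rightarrow> 'c::encodable \<Rightarrow> 'b"
  assumes "computable_on A l" "computable_on A i" "computable (\<lambda>z. h (fst z) (fst (snd z)) (snd (snd z)))"
  shows "computable_on A (\<lambda>x. foldl (h x) (i x) (l x))"
proof -
  define F where "F = (\<lambda>z :: 'a \<times> ('c list \<times> 'b). case fst (snd z) of [] \<Rightarrow> z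
    | y # ys \<Rightarrow> (fst z, (ys, h (fst z) (snd (snd z)) y)))"
  have F: "(F ^^ length ys) (x, ys, b) = (x, [], foldl (h x) b ys)" for x ys b
    by (induction ys arbitrary: b) (auto simp: F_def funpow_Suc_right simp del: funpow.simps(2))
  have F2: "fst (snd ((F ^^ k) (x, ys, b))) = drop k ys" for k x ys b
  proof (induction k)
    case (Suc k)
    have "fst (snd (F z)) = drop 1 (fst (snd z))" for z
      by (auto simp: F_def split: list.splits)
    then show ?case using Suc by simp
  qed auto
  have "computable (\<lambda>z :: ('a \<times> 'c list \<times> 'b) \<times> 'c \<times> 'c list. (fst (fst z), snd (snd (fst z)), fst (snd z)))"
    by (intro computable_Pair computable_fst computable_snd computable_id)
  from computable_comp1[OF assms(3) this]
  have "computable (\<lambda>z :: ('a \<times> 'c list \<times> 'b) \<times> 'c \<times> 'c list. h (fst (fst z)) (snd (snd (fst z))) (fst (snd z)))"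
    by simp
  then have "computable F" unfolding F_def
    by (intro computable_case_list computable_Pair computable_fst computable_snd computable_id)
  moreover have "computable (\<lambda>z :: 'a \<times> ('c list \<times> 'b). case fst (snd z) of [] \<Rightarrow> False | y # ys \<Rightarrow> True)"
    by (intro computable_case_list computable_fst computable_snd computable_id computable_const_bool)
  ultimately have W: "computable_on {y. \<exists>k. \<not> (case fst (snd ((F ^^ k) y)) of [] \<Rightarrow> False | y # ys \<Rightarrow> True)}
    (\<lambda>y. (F ^^ (LEAST k. \<not> (case fst (snd ((F ^^ k) y)) of [] \<Rightarrow> False | y # ys \<Rightarrow> True))) y)"
    by (rule computable_while)
  have "\<exists>k. \<not> (case drop k ys of [] \<Rightarrow> False | y # ys \<Rightarrow> True)" for ys :: "'c list"
    by (rule exI[of _ "length ys"]) simp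
  then have "computable_on A (\<lambda>x. (F ^^ (LEAST k. \<not> (case fst (snd ((F ^^ k) (x, l x, i x))) of [] \<Rightarrow> False | y # ys \<Rightarrow> True))) (x, l x, i x))"
    by (intro computable_comp[OF W computable_Pair[OF computable_id computable_Pair[OF assms(1,2)]]]) (simp add: F2)
  then have "computable_on A (\<lambda>x. (F ^^ (LEAST k. \<not> (case drop k (l x) of [] \<Rightarrow> False | y # ys \<Rightarrow> True))) (x, l x, i x))"
    by (simp add: F2)
  moreover have "(LEAST k. \<not> (case drop k ys of [] \<Rightarrow> False | y # ys \<Rightarrow> True)) = length ys" for ys :: "'c list"
    by (rule Least_equality) (auto split: list.splits)
  ultimately have "computable_on A (\<lambda>x. (x, [] :: 'c list, foldl (h x) (i x) (l x)))"
    by (simp add: F)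
  then show ?thesis by (auto dest!: computable_snd)
qed

lemmas computable_intros = computable_id computable_fst computable_snd computable_Pair
  computable_arith_real computable_arith_int computable_add_nat computable_zero_one computable_const_bool
  computable_coerce computable_Nil computable_Cons computable_Vertex computable_OnEdge computable_If
  computable_less computable_not computable_conj computable_disj computable_le computable_eq
  computable_case_location computable_funpow computable_foldl

section \<open>List functions and rounding\<close>

lemma computable_rev: "computable_on A l \<Longrightarrow> computable_on A (\<lambda>x. rev (l x))"
proof -
  assume l: "computable_on A l"
  have "computable_on A (\<lambda>x. foldl (\<lambda>a y. y # a) [] (l x))"
    by (intro l computable_intros)
  moreover have "foldl (\<lambda>a y. y # a) ys xs = rev xs @ ys" for xs ys :: "'b list"
    by (induction xs arbitrary: ys) auto
  ultimately show ?thesis by simp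
qed

lemma computable_append:
  "computable_on A f \<Longrightarrow> computable_on A g \<Longrightarrow> computable_on A (\<lambda>x. f x @ g x)"
proof -
  assume fg: "computable_on A f" "computable_on A g"
  have "computable_on A (\<lambda>x. foldl (\<lambda>a y. y # a) (g x) (rev (f x)))"
    by (intro computable_rev fg computable_intros)
  moreover have "foldl (\<lambda>a y. y # a) ys xs = rev xs @ ys" for xs ys :: "'b list"
    by (induction xs arbitrary: ys) auto
  ultimately show ?thesis by simp
qed

lemma computable_map:
  assumes "computable_on A l" "computable (\<lambda>z. h (fst z) (snd z))"
  shows "computable_on A (\<lambda>x. map (h x) (l x))"
proof -
  have "computable_on A (\<lambda>x. rev (foldl (\<lambda>a y. h x y # a) [] (l x)))"
    by (intro computable_comp2[OF assms(2)] computable_rev assms computable_intros)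
  moreover have "foldl (\<lambda>a y. h x y # a) ys xs = rev (map (h x) xs) @ ys" for x xs ys
    by (induction xs arbitrary: ys) auto
  ultimately show ?thesis by simp
qed

lemma computable_filter:
  assumes "computable_on A l" "computable (\<lambda>z. P (fst z) (snd z))"
  shows "computable_on A (\<lambda>x. filter (P x) (l x))"
proof -
  have "computable_on A (\<lambda>x. rev (foldl (\<lambda>a y. if P x y then y # a else a) [] (l x)))"
    by (intro computable_comp2[OF assms(2)] computable_rev assms computable_intros)
  moreover have "foldl (\<lambda>a y. if P x y then y # a else a) ys xs = rev (filter (P x) xs) @ ys" for x xs ys
    by (induction xs arbitrary: ys) auto
  ultimately show ?thesis by simp
qed

lemma computable_concat:
  assumes "computable_on A l"
  shows "computable_on A (\<lambda>x. concat (l x))"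
proof -
  have "computable_on A (\<lambda>x. foldl (\<lambda>a y. a @ y) [] (l x))"
    by (intro assms computable_append computable_intros)
  moreover have "foldl (\<lambda>a y. a @ y) ys xs = ys @ concat xs" for xs and ys :: "'b list"
    by (induction xs arbitrary: ys) auto
  ultimately show ?thesis by simp
qed

lemma computable_Bex_set:
  assumes "computable_on A l" "computable (\<lambda>z. P (fst z) (snd z))"
  shows "computable_on A (\<lambda>x. \<exists>y\<in>set (l x). P x y)"
proof -
  have "computable_on A (\<lambda>x. foldl (\<lambda>a y. a \<or> P x y) False (l x))"
    by (intro computable_comp2[OF assms(2)] assms computable_intros)
  moreover have "foldl (\<lambda>a y. a \<or> P x y) b xs \<longleftrightarrow> b \<or> (\<exists>y\<in>set xs. P x y)" for b x xs
    by (induction xs arbitrary: b) auto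
  ultimately show ?thesis by simp
qed

lemma computable_Ball_set:
  assumes "computable_on A l" "computable (\<lambda>z. P (fst z) (snd z))"
  shows "computable_on A (\<lambda>x. \<forall>y\<in>set (l x). P x y)"
  using computable_not[OF computable_Bex_set[OF assms(1) computable_not[OF assms(2)]]] by simp

lemma computable_sum_list_int:
  assumes "computable_on A l"
  shows "computable_on A (\<lambda>x. sum_list (l x) :: int)"
proof -
  have "computable_on A (\<lambda>x. foldl (\<lambda>a y. a + y) 0 (l x))"
    by (intro assms computable_intros)
  moreover have "foldl (\<lambda>a y. a + y) b xs = b + sum_list xs" for xs and b :: int
    by (induction xs arbitrary: b) auto
  ultimately show ?thesis by simp
qed

lemma computable_length:
  assumes "computable_on A l"
  shows "computable_on A (\<lambda>x. length (l x))"
proof -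
  have "computable_on A (\<lambda>x. foldl (\<lambda>a y. a + 1 :: nat) 0 (l x))"
    by (intro assms computable_intros)
  moreover have "foldl (\<lambda>a y. a + 1) b xs = b + length xs" for xs :: "'b list" and b
    by (induction xs arbitrary: b) auto
  ultimately show ?thesis by simp
qed

lemma computable_upt:
  assumes "computable_on A n"
  shows "computable_on A (\<lambda>x. [0..<n x])"
proof -
  have "computable_on A (\<lambda>x. ((\<lambda>a. a @ [length a]) ^^ n x) [])"
    by (intro assms computable_append computable_length computable_intros)
  moreover have "((\<lambda>a. a @ [length a]) ^^ m) [] = [0..<m]" for m
    by (induction m) auto
  ultimately show ?thesis by simp
qed

lemma computable_n_lists:
  assumes "computable_on A n" "computable l"
  shows "computable_on A (\<lambda>x. List.n_lists (n x) (l x))"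
proof -
  have "computable_on A (\<lambda>x. ((\<lambda>ls. concat (map (\<lambda>ys. map (\<lambda>y. y # ys) (l x)) ls)) ^^ n x) [[]])"
    by (intro computable_comp1[OF assms(2)] assms computable_concat computable_map computable_intros)
  moreover have "((\<lambda>ls. concat (map (\<lambda>ys. map (\<lambda>y. y # ys) xs) ls)) ^^ m) [[]] = List.n_lists m xs"
    for m and xs :: "'b list"
    by (induction m) auto
  ultimately show ?thesis by simp
qed

text \<open>The language has no rounding, but the real numbers are Archimedean: the floor is found
  by counting upwards, with the sign deciding between two searches that both end.\<close>

lemma computable_floor:
  assumes "computable_on A f"
  shows "computable_on A (\<lambda>x. \<lfloor>f x :: real\<rfloor>)"
proof -
  have eq: "\<lfloor>y\<rfloor> = (if y < 0 then 0 - int (LEAST n. 0 \<le> y + real n) else int (LEAST n. y < real n + 1))" for y :: real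
  proof (cases "y < 0")
    case True
    then have "(LEAST n. 0 \<le> y + real n) = nat (- \<lfloor>y\<rfloor>)"
      by (intro Least_equality) linarith+
    then show ?thesis using True by simp
  next
    case False
    then have "(LEAST n. y < real n + 1) = nat \<lfloor>y\<rfloor>"
      by (intro Least_equality) linarith+
    then show ?thesis using False by simp
  qed
  have "computable (\<lambda>y. if y < 0 then 0 - int (LEAST n. 0 \<le> y + real n) else int (LEAST n. y < real n + 1))"
  proof (intro computable_Least computable_intros)
    show "\<exists>n. 0 \<le> y + real n" for y
    proof -
      obtain n where "- y \<le> real n" using real_arch_simple by blast
      then have "0 \<le> y + real n" by linarith
      then show ?thesis ..
    qed
    show "\<exists>n. y < real n + 1" for y
      using reals_Archimedean2[of y] less_add_one order.strict_trans by blast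
  qed
  then have "computable (\<lambda>y :: real. \<lfloor>y\<rfloor>)" by (simp only: eq[symmetric])
  from computable_comp1[OF this assms] show ?thesis .
qed

lemma computable_abs_int:
  assumes "computable_on A f"
  shows "computable_on A (\<lambda>x. \<bar>f x :: int\<bar>)"
  using computable_If[OF computable_less(3)[OF assms computable_zero_one(3)] computable_arith_int(2)[OF computable_zero_one(3) assms] assms]
  by (simp add: abs_if cong: if_cong)

text \<open>The absolute value is non-negative, so as an integer and as a natural number it has the
  same encoding.\<close>

lemma computable_nat_abs:
  assumes "computable_on A f"
  shows "computable_on A (\<lambda>x. nat \<bar>f x :: int\<bar>)"
proof -
  have "computable_on A (\<lambda>x. \<bar>f x\<bar>)" using assms by (rule computable_abs_int)
  then show ?thesis unfolding computable_on_def computes_def by (simp add: enc_simps)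
qed

lemma computable_eq_location:
  assumes "computable_on A f" "computable_on A g"
  shows "computable_on A (\<lambda>x. f x = (g x :: location))"
proof -
  have "computable_on A (\<lambda>x. case f x of Vertex v \<Rightarrow> (case g x of Vertex w \<Rightarrow> v = w | OnEdge e y \<Rightarrow> False)
      | OnEdge e y \<Rightarrow> (case g x of Vertex w \<Rightarrow> False | OnEdge e' y' \<Rightarrow> e = e' \<and> y = y'))"
  proof -
    have "computable (\<lambda>z. case fst z of Vertex v \<Rightarrow> (case snd z of Vertex w \<Rightarrow> v = w | OnEdge e y \<Rightarrow> False)
      | OnEdge e y \<Rightarrow> (case snd z of Vertex w \<Rightarrow> False | OnEdge e' y' \<Rightarrow> e = e' \<and> y = y'))"
      by (intro computable_intros)
    from computable_comp2[OF this assms] show ?thesis .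
  qed
  moreover have "(p = q) = (case p of Vertex v \<Rightarrow> (case q of Vertex w \<Rightarrow> v = w | OnEdge e y \<Rightarrow> False)
      | OnEdge e y \<Rightarrow> (case q of Vertex w \<Rightarrow> False | OnEdge e' y' \<Rightarrow> e = e' \<and> y = y'))" for p q
    by (auto split: location.splits)
  ultimately show ?thesis by simp
qed

section \<open>Discrete solutions on networks\<close>

text \<open>Graphs in the style of Serre: a segment is given by two opposite darts, so loops and
  parallel segments need no special treatment.\<close>

locale network =
  fixes W :: "'v set" and S :: "'d set" and src tgt :: "'d \<Rightarrow> 'v" and rev :: "'d \<Rightarrow> 'd"
    and len :: "'d \<Rightarrow> real"
  assumes finite_W: "finite W" and finite_S: "finite S"
    and src_in: "s \<in> S \<Longrightarrow> src s \<in> W"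
    and rev_in: "s \<in> S \<Longrightarrow> rev s \<in> S" and rev_rev: "s \<in> S \<Longrightarrow> rev (rev s) = s"
    and src_rev: "s \<in> S \<Longrightarrow> src (rev s) = tgt s"
    and len_pos: "s \<in> S \<Longrightarrow> len s > 0" and len_rev: "s \<in> S \<Longrightarrow> len (rev s) = len s"
begin

lemma tgt_rev: "s \<in> S \<Longrightarrow> tgt (rev s) = src s"
  using src_rev[of "rev s"] rev_in rev_rev by simp

lemma tgt_in: "s \<in> S \<Longrightarrow> tgt s \<in> W"
  using src_in[of "rev s"] rev_in src_rev by simp

text \<open>The largest outgoing slope at the source of the dart that a convex function with integer
  slopes can have when its values at both ends are those of \<open>f\<close>.\<close>

definition fl :: "('v \<Rightarrow> real) \<Rightarrow> 'd \<Rightarrow> int" where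
  "fl f s = \<lfloor>(f (tgt s) - f (src s)) / len s\<rfloor>"

definition gain :: "('v \<Rightarrow> real) \<Rightarrow> 'v \<Rightarrow> int" where
  "gain f w = (\<Sum>s | s \<in> S \<and> src s = w. fl f s)"

definition sol :: "('v \<Rightarrow> int) \<Rightarrow> ('v \<Rightarrow> real) \<Rightarrow> bool" where
  "sol D f \<longleftrightarrow> (\<forall>w\<in>W. 0 \<le> D w + gain f w)"

lemma fl_mono:
  "s \<in> S \<Longrightarrow> f (tgt s) - f (src s) \<le> g (tgt s) - g (src s) \<Longrightarrow> fl f s \<le> fl g s"
  unfolding fl_def by (intro floor_mono divide_right_mono) (use len_pos in \<open>auto simp: less_imp_le\<close>)

lemma fl_ge_iff: "s \<in> S \<Longrightarrow> m \<le> fl f s \<longleftrightarrow> of_int m * len s \<le> f (tgt s) - f (src s)"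
  unfolding fl_def by (simp add: le_floor_iff pos_le_divide_eq len_pos)

text \<open>The sum is 0 or -1; the value -1 stands for a chip that stays in the interior of the
  segment.\<close>

lemma fl_plus_fl_rev: "s \<in> S \<Longrightarrow> fl f s + fl f (rev s) \<le> 0"
proof -
  assume s: "s \<in> S"
  have "fl f (rev s) = \<lfloor>- ((f (tgt s) - f (src s)) / len s)\<rfloor>"
    unfolding fl_def by (simp add: src_rev tgt_rev len_rev s minus_divide_left)
  then show ?thesis unfolding fl_def by linarith
qed

lemma sum_gain:
  assumes "U \<subseteq> W"
  shows "(\<Sum>w\<in>U. gain f w) = (\<Sum>s | s \<in> S \<and> src s \<in> U. fl f s)"
proof -
  have "(\<Sum>w\<in>U. \<Sum>s | s \<in> {s \<in> S. src s \<in> U} \<and> src s = w. fl f s) = (\<Sum>s | s \<in> S \<and> src s \<in> U. fl f s)"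
    by (rule sum.group) (use finite_S finite_subset[OF assms finite_W] in auto)
  moreover have "{s. s \<in> {s \<in> S. src s \<in> U} \<and> src s = w} = {s. s \<in> S \<and> src s = w}" if "w \<in> U" for w
    using that by auto
  ultimately show ?thesis unfolding gain_def by (metis (no_types, lifting) sum.cong)
qed

lemma sum_fl_inner: "(\<Sum>s | s \<in> S \<and> src s \<in> U \<and> tgt s \<in> U. fl f s) \<le> 0"
proof -
  let ?I = "{s. s \<in> S \<and> src s \<in> U \<and> tgt s \<in> U}"
  have "(\<Sum>s\<in>?I. fl f s) = (\<Sum>s\<in>?I. fl f (rev s))"
    by (rule sum.reindex_bij_witness[of _ rev rev]) (auto simp: rev_rev rev_in src_rev tgt_rev)
  then have "2 * (\<Sum>s\<in>?I. fl f s) = (\<Sum>s\<in>?I. fl f s + fl f (rev s))"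
    by (simp add: sum.distrib)
  also have "\<dots> \<le> 0" by (rule sum_nonpos) (auto intro: fl_plus_fl_rev)
  finally show ?thesis by simp
qed

lemma sol_sum_nonneg:
  assumes "sol D f"
  shows "0 \<le> (\<Sum>w\<in>W. D w)"
proof -
  have "0 \<le> (\<Sum>w\<in>W. D w + gain f w)"
    using assms unfolding sol_def by (intro sum_nonneg) auto
  also have "\<dots> = (\<Sum>w\<in>W. D w) + (\<Sum>s | s \<in> S \<and> src s \<in> W \<and> tgt s \<in> W. fl f s)"
    using src_in tgt_in by (simp add: sum.distrib sum_gain, intro sum.cong) auto
  also have "\<dots> \<le> (\<Sum>w\<in>W. D w)" using sum_fl_inner[of f W] by simp
  finally show ?thesis .
qed

text \<open>Every slope is bounded because all chips crossing a level set of the solution come from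
  the divisor.\<close>

lemma sol_fl_bound_below:
  assumes "sol D f" "s \<in> S"
  shows "- (\<Sum>w\<in>W. \<bar>D w\<bar>) \<le> fl f s"
proof (cases "0 \<le> f (tgt s) - f (src s)")
  case True
  then have "0 \<le> fl f s" using len_pos[OF assms(2)] by (simp add: fl_def)
  moreover have "0 \<le> (\<Sum>w\<in>W. \<bar>D w\<bar>)" by (rule sum_nonneg) auto
  ultimately show ?thesis by linarith
next
  case False
  define U where "U = {w \<in> W. f (src s) \<le> f w}"
  have U: "U \<subseteq> W" "finite U" using finite_W by (auto simp: U_def)
  let ?I = "{s. s \<in> S \<and> src s \<in> U \<and> tgt s \<in> U}" and ?O = "{s. s \<in> S \<and> src s \<in> U \<and> tgt s \<notin> U}"
  have fin: "finite ?I" "finite ?O" using finite_S by auto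
  have neg: "fl f t \<le> 0" if "t \<in> ?O" for t
  proof -
    have "f (tgt t) < f (src t)" using that tgt_in[of t] by (auto simp: U_def)
    then have "(f (tgt t) - f (src t)) / len t \<le> 0"
      using len_pos[of t] that by (simp add: divide_le_0_iff)
    then show ?thesis unfolding fl_def by linarith
  qed
  have s: "s \<in> ?O" using False assms(2) src_in by (auto simp: U_def)
  have "0 \<le> (\<Sum>w\<in>U. D w + gain f w)"
    using assms U unfolding sol_def by (intro sum_nonneg) auto
  also have "\<dots> = (\<Sum>w\<in>U. D w) + (\<Sum>t | t \<in> S \<and> src t \<in> U. fl f t)"
    using U by (simp add: sum.distrib sum_gain)
  also have "{t. t \<in> S \<and> src t \<in> U} = ?I \<union> ?O" by auto
  also have "(\<Sum>t\<in>?I \<union> ?O. fl f t) = (\<Sum>t\<in>?I. fl f t) + (\<Sum>t\<in>?O. fl f t)"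
    by (rule sum.union_disjoint) (use fin in auto)
  also have "(\<Sum>t\<in>?O. fl f t) = fl f s + (\<Sum>t\<in>?O - {s}. fl f t)"
    by (rule sum.remove) (use s fin in auto)
  also have "(\<Sum>t\<in>?O - {s}. fl f t) \<le> 0" using neg by (intro sum_nonpos) auto
  finally have "0 \<le> (\<Sum>w\<in>U. D w) + fl f s" using sum_fl_inner[of f U] by simp
  moreover have "(\<Sum>w\<in>U. D w) \<le> (\<Sum>w\<in>U. \<bar>D w\<bar>)" by (rule sum_mono) auto
  moreover have "(\<Sum>w\<in>U. \<bar>D w\<bar>) \<le> (\<Sum>w\<in>W. \<bar>D w\<bar>)"
    by (rule sum_mono2) (use finite_W U in auto)
  ultimately show ?thesis by linarith
qed

text \<open>The upper bound is the lower bound for the reversed dart.\<close>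

lemma sol_fl_bound:
  assumes "sol D f" "s \<in> S"
  shows "\<bar>fl f s\<bar> \<le> (\<Sum>w\<in>W. \<bar>D w\<bar>)"
  using sol_fl_bound_below[OF assms] sol_fl_bound_below[OF assms(1) rev_in[OF assms(2)]]
    fl_plus_fl_rev[OF assms(2), of f] by linarith

text \<open>The values reached from 0 along at most \<open>j\<close> darts, with slopes bounded by
  \<open>B\<close>; that the darts form a walk is forgotten.\<close>

fun candidates :: "int \<Rightarrow> nat \<Rightarrow> real set" where
  "candidates B 0 = {0}"
| "candidates B (Suc j) = candidates B j \<union> {a + of_int m * len s | a m s. a \<in> candidates B j \<and> \<bar>m\<bar> \<le> B \<and> s \<in> S}"

lemma candidates_mono: "i \<le> j \<Longrightarrow> candidates B i \<subseteq> candidates B j"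
  by (induction rule: dec_induct) auto

lemma candidates_mono_bound: "B \<le> C \<Longrightarrow> candidates B j \<subseteq> candidates C j"
proof (induction j)
  case (Suc j)
  show ?case
  proof
    fix r assume "r \<in> candidates B (Suc j)"
    then consider "r \<in> candidates B j"
      | a m s where "r = a + of_int m * len s" "a \<in> candidates B j" "\<bar>m\<bar> \<le> B" "s \<in> S" by auto
    then show "r \<in> candidates C (Suc j)"
    proof cases
      case (2 a m s)
      then have "a \<in> candidates C j" "\<bar>m\<bar> \<le> C" using Suc by auto
      then show ?thesis using 2 by auto
    qed (use Suc in auto)
  qed
qed simp

text \<open>Lowering the values outside a set until one of the outgoing constraints becomes tight pins
  the value of one more vertex to an integral combination of lengths.\<close>

lemma sol_extend:
  assumes sol: "sol D f" and T: "T \<subseteq> W" and cross: "\<exists>s\<in>S. src s \<in> T \<and> tgt s \<notin> T"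
  shows "\<exists>g s. sol D g \<and> s \<in> S \<and> tgt s \<notin> T \<and> (\<forall>w\<in>T. g w = f w) \<and>
    src s \<in> T \<and> g (tgt s) = f (src s) + of_int (fl f s) * len s"
proof -
  define X where "X = {s \<in> S. src s \<in> T \<and> tgt s \<notin> T}"
  define slack where "slack s = f (tgt s) - f (src s) - of_int (fl f s) * len s" for s
  have X: "finite X" "X \<noteq> {}" using finite_S cross by (auto simp: X_def)
  obtain s where s: "s \<in> X" "\<And>t. t \<in> X \<Longrightarrow> slack s \<le> slack t"
    using arg_min_if_finite[OF X, of slack] arg_min_least[OF X, of _ slack] by metis
  have slack0: "0 \<le> slack t" if "t \<in> S" for t
    using fl_ge_iff[OF that, of "fl f t" f] by (simp add: slack_def)
  define g where "g w = (if w \<in> T then f w else f w - slack s)" for w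
  \<comment> \<open>Differences along darts within \<open>T\<close> or within its complement are
    unchanged, those into \<open>T\<close> grow, and those out of \<open>T\<close> shrink by the
    least slack, which their floors tolerate.\<close>
  have "fl f t \<le> fl g t" if t: "t \<in> S" for t
  proof (cases "t \<in> X")
    case True
    then show ?thesis using s(2)[OF True] fl_ge_iff[OF t, of "fl f t" g] by (auto simp: g_def X_def slack_def)
  next
    case False
    then show ?thesis using t slack0[of s] s(1) by (intro fl_mono) (auto simp: g_def X_def)
  qed
  then have "gain f w \<le> gain g w" for w unfolding gain_def by (intro sum_mono) auto
  then have "sol D g" using sol unfolding sol_def by (meson add_left_mono order_trans)
  then show ?thesis using s(1) by (intro exI[of _ g] exI[of _ s]) (auto simp: g_def X_def slack_def)
qed

text \<open>One vertex is shifted to the value 0, then \<open>sol_extend\<close> pins one further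
  vertex at a time. Connectedness supplies a dart leaving the pinned set, and
  \<open>sol_fl_bound\<close> bounds its slope for the current solution, by a number that depends on
  \<open>D\<close> only.\<close>

lemma sol_candidates:
  assumes sol: "sol D f"
    and conn: "\<And>v w. v \<in> W \<Longrightarrow> w \<in> W \<Longrightarrow> (v, w) \<in> {(src s, tgt s) | s. s \<in> S}\<^sup>*"
  shows "\<exists>g. sol D g \<and> (\<forall>w\<in>W. g w \<in> candidates (\<Sum>w\<in>W. \<bar>D w\<bar>) (card W))"
proof (cases "W = {}")
  case True
  then show ?thesis using sol by auto
next
  case False
  let ?B = "\<Sum>w\<in>W. \<bar>D w\<bar>"
  have "\<exists>g T. sol D g \<and> T \<subseteq> W \<and> card T = j \<and> (\<forall>w\<in>T. g w \<in> candidates ?B j)"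
    if "1 \<le> j" "j \<le> card W" for j
    using that
  proof (induction j rule: nat_induct_at_least)
    case base
    from False obtain v where v: "v \<in> W" by auto
    have "sol D (\<lambda>w. f w - f v)"
      using sol by (simp add: sol_def gain_def fl_def)
    then show ?case using v by (intro exI[of _ "\<lambda>w. f w - f v"] exI[of _ "{v}"]) auto
  next
    case (Suc j)
    then obtain g T where g: "sol D g" "T \<subseteq> W" "card T = j" "\<forall>w\<in>T. g w \<in> candidates ?B j"
      by auto
    have finT: "finite T" using g(2) finite_W finite_subset by blast
    obtain v where v: "v \<in> T" using g(3) Suc by fastforce
    have "T \<noteq> W" using g(3) Suc.prems by auto
    then obtain w where w: "w \<in> W" "w \<notin> T" using g(2) by blast
    have "\<exists>s\<in>S. src s \<in> T \<and> tgt s \<notin> T"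
    proof (rule ccontr)
      assume no: "\<not> ?thesis"
      have "(v, w) \<in> {(src s, tgt s) | s. s \<in> S}\<^sup>*" using conn v g(2) w by auto
      then have "w \<in> T" by (induction rule: rtrancl_induct) (use v no in auto)
      with w show False by simp
    qed
    from sol_extend[OF g(1,2) this] obtain h s where h: "sol D h" "s \<in> S" "tgt s \<notin> T" "\<forall>w\<in>T. h w = g w"
      "src s \<in> T" "h (tgt s) = g (src s) + of_int (fl g s) * len s" by auto
    have "h (tgt s) \<in> candidates ?B (Suc j)"
      using h sol_fl_bound[OF g(1) h(2)] g(4) by auto
    then show ?case using h g finT tgt_in[OF h(2)]
      by (intro exI[of _ h] exI[of _ "insert (tgt s) T"]) auto
  qed
  from this[of "card W"] False finite_W show ?thesis
    by (metis One_nat_def Suc_leI card_gt_0_iff card_subset_eq order_refl)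
qed

text \<open>At a vertex where \<open>f\<close> is the larger function, the maximum agrees with
  \<open>f\<close> there and is at least \<open>f\<close> at the neighbours, so no rounded slope
  decreases.\<close>

lemma sol_max:
  assumes "sol D f" "sol D g"
  shows "sol D (\<lambda>w. max (f w) (g w))"
  unfolding sol_def
proof
  fix w assume w: "w \<in> W"
  let ?h = "\<lambda>w. max (f w) (g w)"
  show "0 \<le> D w + gain ?h w"
  proof (cases "g w \<le> f w")
    case True
    then have "gain f w \<le> gain ?h w" unfolding gain_def by (intro sum_mono fl_mono) auto
    then show ?thesis using assms(1) w unfolding sol_def by (meson add_left_mono order_trans)
  next
    case False
    then have "gain g w \<le> gain ?h w" unfolding gain_def by (intro sum_mono fl_mono) auto
    then show ?thesis using assms(2) w unfolding sol_def by (meson add_left_mono order_trans)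
  qed
qed

end

section \<open>Piecewise linear functions on an interval\<close>

text \<open>Symmetric in \<open>x\<close> and \<open>y\<close>, because it has to serve for both
  orientations of a segment.\<close>

definition consecutive :: "real set \<Rightarrow> real \<Rightarrow> real \<Rightarrow> bool" where
  "consecutive A x y \<longleftrightarrow> x \<in> A \<and> y \<in> A \<and> x \<noteq> y \<and> (\<forall>z\<in>A. z \<le> min x y \<or> max x y \<le> z)"

definition nxt :: "real set \<Rightarrow> real \<Rightarrow> real" where
  "nxt A x = Min {z \<in> A. x < z}"

definition prv :: "real set \<Rightarrow> real \<Rightarrow> real" where
  "prv A x = Max {z \<in> A. z < x}"

lemma consecutive_sym: "consecutive A x y \<longleftrightarrow> consecutive A y x"
  by (auto simp: consecutive_def min.commute max.commute)

lemma consecutive_nxt: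
  assumes "finite A" "x \<in> A" "y \<in> A" "x < y"
  shows "consecutive A x (nxt A x)" "x < nxt A x" "nxt A x \<le> y"
proof -
  let ?B = "{z \<in> A. x < z}"
  have B: "finite ?B" "?B \<noteq> {}" using assms by auto
  have "nxt A x \<in> ?B" unfolding nxt_def using B by (rule Min_in)
  moreover have le: "nxt A x \<le> z" if "z \<in> A" "x < z" for z
    unfolding nxt_def using B that by (intro Min_le) auto
  ultimately show "consecutive A x (nxt A x)" "x < nxt A x" "nxt A x \<le> y"
    using assms by (force simp: consecutive_def)+
qed

lemma consecutive_prv:
  assumes "finite A" "x \<in> A" "y \<in> A" "y < x"
  shows "consecutive A x (prv A x)" "prv A x < x" "y \<le> prv A x"
proof -
  let ?B = "{z \<in> A. z < x}"
  have B: "finite ?B" "?B \<noteq> {}" using assms by auto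
  have "prv A x \<in> ?B" unfolding prv_def using B by (rule Max_in)
  moreover have le: "z \<le> prv A x" if "z \<in> A" "z < x" for z
    unfolding prv_def using B that by (intro Max_ge) auto
  ultimately show "consecutive A x (prv A x)" "prv A x < x" "y \<le> prv A x"
    using assms by (force simp: consecutive_def)+
qed

lemma consecutive_unique_up: "consecutive A x y \<Longrightarrow> consecutive A x z \<Longrightarrow> x < y \<Longrightarrow> x < z \<Longrightarrow> y = z"
  by (force simp: consecutive_def)

lemma consecutive_unique_down: "consecutive A x y \<Longrightarrow> consecutive A x z \<Longrightarrow> y < x \<Longrightarrow> z < x \<Longrightarrow> y = z"
  by (force simp: consecutive_def)

lemma between_consecutive:
  assumes "finite A" "x \<in> A" "y \<in> A" "x < y" "x \<le> z" "z \<le> y"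
  obtains u v where "consecutive A u v" "u < v" "x \<le> u" "v \<le> y" "u \<le> z" "z \<le> v"
proof (cases "z = x")
  case True
  then show ?thesis using consecutive_nxt[OF assms(1-4)] that[of x "nxt A x"] by auto
next
  case False
  define v where "v = Min {t \<in> A. z \<le> t}"
  have B: "finite {t \<in> A. z \<le> t}" "{t \<in> A. z \<le> t} \<noteq> {}" using assms by auto
  have v: "v \<in> A" "z \<le> v" using Min_in[OF B] by (auto simp: v_def)
  have le: "v \<le> t" if "t \<in> A" "z \<le> t" for t
    unfolding v_def using B that by (intro Min_le) auto
  have "x < v" using False assms v by auto
  note p = consecutive_prv[OF assms(1) v(1) assms(2) this]
  have "prv A v \<le> z" using p(1,2) le[of "prv A v"] by (force simp: consecutive_def)
  then show ?thesis using p v le[of y] assms that[of "prv A v" v] consecutive_sym[of A v] by auto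
qed

text \<open>\<open>U\<close> and \<open>V\<close> act as outgoing slopes to the right and to the
  left, and the sign of their sum expresses convexity. Only inequalities are demanded of them, since
  the lemma is applied both to true slopes and to rounded ones.\<close>

lemma discrete_convex_up:
  fixes g :: "real \<Rightarrow> real" and U V :: "real \<Rightarrow> int"
  assumes A: "finite A" "x \<in> A" "y \<in> A" "x < y"
    and UV: "\<And>a b. consecutive A a b \<Longrightarrow> x \<le> a \<Longrightarrow> a < b \<Longrightarrow> b \<le> y \<Longrightarrow>
      of_int (U a) * (b - a) \<le> g b - g a \<and> of_int (V b) * (b - a) \<le> g a - g b"
    and pos: "\<And>z. z \<in> A \<Longrightarrow> x < z \<Longrightarrow> z < y \<Longrightarrow> 0 \<le> U z + V z"
  shows "of_int (U x) * (y - x) \<le> g y - g x"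
proof -
  \<comment> \<open>The second conjunct, that slopes do not fall below the first one, is what
    carries the claim past a break point; the least bad point has a good predecessor.\<close>
  define P where "P z \<longleftrightarrow> of_int (U x) * (z - x) \<le> g z - g x \<and> (z < y \<longrightarrow> U x \<le> U z)" for z
  define Bad where "Bad = {z \<in> A. x < z \<and> z \<le> y \<and> \<not> P z}"
  have "Bad = {}"
  proof (rule ccontr)
    assume ne: "Bad \<noteq> {}"
    have fin: "finite Bad" using A by (auto simp: Bad_def)
    define z where "z = Min Bad"
    have "z \<in> Bad" unfolding z_def using fin ne by (rule Min_in)
    then have z: "z \<in> A" "x < z" "z \<le> y" "\<not> P z" by (auto simp: Bad_def)
    define w where "w = prv A z"
    note p = consecutive_prv[OF A(1) z(1) A(2) z(2), folded w_def]
    have w: "w \<in> A" "consecutive A w z" using p(1) consecutive_sym by (auto simp: consecutive_def)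
    have "w \<notin> Bad" using Min_le[OF fin, of w] p(2) by (auto simp: z_def)
    then have Pw: "w = x \<or> P w" using w p z by (auto simp: Bad_def)
    then have Uw: "U x \<le> U w" using p z by (auto simp: P_def)
    have gw: "of_int (U x) * (w - x) \<le> g w - g x" using Pw by (auto simp: P_def)
    note uv = UV[OF w(2) p(3) p(2) z(3)]
    have "of_int (U x) * (z - w) \<le> of_int (U w) * (z - w)"
      using Uw p(2) by (intro mult_right_mono) auto
    then have step: "of_int (U x) * (z - w) \<le> g z - g w" using uv by linarith
    then have 1: "of_int (U x) * (z - x) \<le> g z - g x" using gw by (simp add: algebra_simps)
    have "U x \<le> U z" if "z < y"
    proof -
      have "of_int (V z) * (z - w) \<le> of_int (- U x) * (z - w)" using step uv by simp
      then have "V z \<le> - U x" using p(2) by (subst (asm) mult_le_cancel_right_pos) (simp_all del: of_int_minus)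
      then show ?thesis using pos[OF z(1,2) that] by linarith
    qed
    with 1 z(4) show False by (auto simp: P_def)
  qed
  then have "P y" using A by (auto simp: Bad_def)
  then show ?thesis by (simp add: P_def)
qed

lemma discrete_convex_down:
  fixes g :: "real \<Rightarrow> real" and U V :: "real \<Rightarrow> int"
  assumes A: "finite A" "x \<in> A" "y \<in> A" "x < y"
    and UV: "\<And>a b. consecutive A a b \<Longrightarrow> x \<le> a \<Longrightarrow> a < b \<Longrightarrow> b \<le> y \<Longrightarrow>
      of_int (U a) * (b - a) \<le> g b - g a \<and> of_int (V b) * (b - a) \<le> g a - g b"
    and pos: "\<And>z. z \<in> A \<Longrightarrow> x < z \<Longrightarrow> z < y \<Longrightarrow> 0 \<le> U z + V z"
  shows "of_int (V y) * (y - x) \<le> g x - g y"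
proof -
  have cons: "consecutive (uminus ` A) a b \<longleftrightarrow> consecutive A (- b) (- a)" for a b
  proof -
    have 1: "t \<in> uminus ` A \<longleftrightarrow> - t \<in> A" for t by force
    show ?thesis unfolding consecutive_def by (auto simp: 1 min_def max_def)
  qed
  \<comment> \<open>The reflection \<open>z \<mapsto> - z\<close> exchanges the two directions and
    with them \<open>U\<close> and \<open>V\<close>.\<close>
  have "of_int ((\<lambda>z. V (- z)) (- y)) * (- x - - y) \<le> (\<lambda>z. g (- z)) (- x) - (\<lambda>z. g (- z)) (- y)"
  proof (rule discrete_convex_up[where V = "\<lambda>z. U (- z)" and A = "uminus ` A"])
    fix a b assume "consecutive (uminus ` A) a b" "- y \<le> a" "a < b" "b \<le> - x"
    then show "of_int (V (- a)) * (b - a) \<le> g (- b) - g (- a) \<and> of_int (U (- b)) * (b - a) \<le> g (- a) - g (- b)"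
      using UV[of "- b" "- a"] by (auto simp: cons algebra_simps)
  next
    fix z assume "z \<in> uminus ` A" "- y < z" "z < - x"
    then show "0 \<le> V (- z) + U (- z)" using pos[of "- z"] by (auto simp: add.commute)
  qed (use A in auto)
  then show ?thesis by simp
qed

section \<open>Affine pieces and one-sided slopes\<close>

definition affine_int :: "(real \<Rightarrow> real) \<Rightarrow> real \<Rightarrow> real \<Rightarrow> bool" where
  "affine_int g x y \<longleftrightarrow> (\<exists>m::int. \<forall>z\<in>{x..y}. g z = g x + of_int m * (z - x))"

lemma affine_int_subset:
  assumes "affine_int g x y" "x \<le> u" "u \<le> v" "v \<le> y"
  shows "affine_int g u v"
proof -
  obtain m :: int where m: "\<And>z. z \<in> {x..y} \<Longrightarrow> g z = g x + of_int m * (z - x)"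
    using assms(1) unfolding affine_int_def by blast
  have "g z = g u + of_int m * (z - u)" if "z \<in> {u..v}" for z
  proof -
    have gz: "g z = g x + of_int m * (z - x)" and gu: "g u = g x + of_int m * (u - x)"
      by (rule m; use that assms in auto)+
    show ?thesis unfolding gz gu by (simp add: algebra_simps)
  qed
  then show ?thesis unfolding affine_int_def by blast
qed

lemma slope_up_eq:
  assumes "x < y" "\<And>z. z \<in> {x..y} \<Longrightarrow> g z = g x + of_int m * (z - x)"
  shows "slope_up g x = m"
  unfolding slope_up_def
proof (rule the_equality)
  have ev: "\<forall>\<^sub>F z in at_right x. z \<in> {x<..<y}"
    using assms(1) by (auto simp: eventually_at_right)
  show "\<forall>\<^sub>F z in at_right x. g z = g x + of_int m * (z - x)"
    by (rule eventually_mono[OF ev], rule assms(2)) auto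
  fix k :: int assume k: "\<forall>\<^sub>F z in at_right x. g z = g x + of_int k * (z - x)"
  have "\<forall>\<^sub>F z in at_right x. k = m"
    using eventually_conj[OF ev k]
  proof (rule eventually_mono)
    fix z assume z: "z \<in> {x<..<y} \<and> g z = g x + of_int k * (z - x)"
    moreover have "g z = g x + of_int m * (z - x)" by (rule assms(2)) (use z in auto)
    ultimately have "of_int k * (z - x) = of_int m * (z - x)" by linarith
    then show "k = m" using z by auto
  qed
  then show "k = m" by (simp add: eventually_const_iff trivial_limit_at_right_real)
qed

lemma slope_down_eq:
  assumes "x < y" "\<And>z. z \<in> {x..y} \<Longrightarrow> g z = g y + of_int m * (y - z)"
  shows "slope_down g y = m"
  unfolding slope_down_def
proof (rule the_equality)
  have ev: "\<forall>\<^sub>F z in at_left y. z \<in> {x<..<y}"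
    using assms(1) by (auto simp: eventually_at_left)
  show "\<forall>\<^sub>F z in at_left y. g z = g y + of_int m * (y - z)"
    by (rule eventually_mono[OF ev], rule assms(2)) auto
  fix k :: int assume k: "\<forall>\<^sub>F z in at_left y. g z = g y + of_int k * (y - z)"
  have "\<forall>\<^sub>F z in at_left y. k = m"
    using eventually_conj[OF ev k]
  proof (rule eventually_mono)
    fix z assume z: "z \<in> {x<..<y} \<and> g z = g y + of_int k * (y - z)"
    moreover have "g z = g y + of_int m * (y - z)" by (rule assms(2)) (use z in auto)
    ultimately have "of_int k * (y - z) = of_int m * (y - z)" by linarith
    then show "k = m" using z by auto
  qed
  then show "k = m" by (simp add: eventually_const_iff trivial_limit_at_left_real)
qed

lemma affine_int_slopes:
  assumes "affine_int g x y" "x < y"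
  shows "g y - g x = of_int (slope_up g x) * (y - x)" "g x - g y = of_int (slope_down g y) * (y - x)"
    and "slope_down g y = - slope_up g x"
proof -
  obtain m :: int where m: "\<And>z. z \<in> {x..y} \<Longrightarrow> g z = g x + of_int m * (z - x)"
    using assms(1) unfolding affine_int_def by blast
  have m': "g z = g y + of_int (- m) * (y - z)" if "z \<in> {x..y}" for z
  proof -
    have gy: "g y = g x + of_int m * (y - x)" by (rule m) (use assms in auto)
    show ?thesis unfolding m[OF that] gy by (simp add: algebra_simps)
  qed
  have up: "slope_up g x = m" by (rule slope_up_eq[OF assms(2) m])
  have down: "slope_down g y = - m" by (rule slope_down_eq[OF assms(2) m'])
  show "slope_down g y = - slope_up g x" using up down by simp
  show "g y - g x = of_int (slope_up g x) * (y - x)"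
    using m[of y] assms(2) unfolding up by (metis add_diff_cancel_left' atLeastAtMost_iff less_imp_le order_refl)
  show "g x - g y = of_int (slope_down g y) * (y - x)"
    using m'[of x] assms(2) unfolding down by (metis add_diff_cancel_left' atLeastAtMost_iff less_imp_le order_refl)
qed

lemma affine_int_slopes_interior:
  assumes "affine_int g x y" "x < z" "z < y"
  shows "slope_up g z + slope_down g z = 0"
proof -
  have "affine_int g x z" "affine_int g z y" "affine_int g x y"
    using assms affine_int_subset[OF assms(1)] by auto
  note s = affine_int_slopes[OF this(1) assms(2)] affine_int_slopes[OF this(2) assms(3)]
  obtain m :: int where m: "\<And>z. z \<in> {x..y} \<Longrightarrow> g z = g x + of_int m * (z - x)"
    using assms(1) unfolding affine_int_def by blast
  have "slope_up g z = m"
  proof (rule slope_up_eq[OF assms(3)])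
    fix t assume t: "t \<in> {z..y}"
    have gt: "g t = g x + of_int m * (t - x)" and gz: "g z = g x + of_int m * (z - x)"
      by (rule m; use t assms in auto)+
    show "g t = g z + of_int m * (t - z)" unfolding gt gz by (simp add: algebra_simps)
  qed
  moreover have "slope_up g x = m"
    by (rule slope_up_eq[OF _ m]) (use assms in auto)
  ultimately show ?thesis using s by simp
qed

definition affine_pieces :: "(real \<Rightarrow> real) \<Rightarrow> real set \<Rightarrow> bool" where
  "affine_pieces g A \<longleftrightarrow> (\<forall>x y. consecutive A x y \<longrightarrow> x < y \<longrightarrow> affine_int g x y)"

lemma affine_pieces_refine:
  assumes "affine_pieces g A" "A \<subseteq> B" "finite A" "l \<in> A" "u \<in> A" "B \<subseteq> {l..u}"
  shows "affine_pieces g B"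
  unfolding affine_pieces_def
proof (intro allI impI)
  fix x y assume xy: "consecutive B x y" "x < y"
  then have "x \<in> {l..u}" "y \<in> {l..u}" using assms(6) by (auto simp: consecutive_def)
  then have "l \<le> x" "x < u" using xy by auto
  let ?v = "Min {t \<in> A. x < t}"
  have B: "finite {t \<in> A. x < t}" "{t \<in> A. x < t} \<noteq> {}" using assms \<open>x < u\<close> by auto
  define v where "v = ?v"
  have v: "v \<in> A" "x < v" using Min_in[OF B] by (auto simp: v_def)
  have vle: "v \<le> t" if "t \<in> A" "x < t" for t unfolding v_def using B that by (intro Min_le) auto
  have yv: "y \<le> v" using xy v assms(2) by (force simp: consecutive_def)
  have "l < v" using \<open>l \<le> x\<close> v by simp
  note p = consecutive_prv[OF assms(3) v(1) assms(4) this]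
  have "prv A v \<le> x" using p(1,2) vle[of "prv A v"] by (force simp: consecutive_def)
  moreover have "affine_int g (prv A v) v"
    using assms(1) p consecutive_sym[of A v] by (auto simp: affine_pieces_def)
  ultimately show "affine_int g x y" using affine_int_subset yv xy by (meson less_imp_le)
qed

text \<open>Break points as a finite set instead of an increasing sequence: a common refinement is
  then just a union.\<close>

lemma piecewise_linear_int_iff:
  assumes "0 < l"
  shows "piecewise_linear_int l g \<longleftrightarrow> (\<exists>A. finite A \<and> {0, l} \<subseteq> A \<and> A \<subseteq> {0..l} \<and> affine_pieces g A)"
proof
  assume "piecewise_linear_int l g"
  then obtain n :: nat and t where t: "t 0 = 0" "t n = l" "\<And>i. i < n \<Longrightarrow> t i < t (Suc i)"
    "\<And>i. i < n \<Longrightarrow> \<exists>m::int. \<forall>x\<in>{t i..t (Suc i)}. g x = g (t i) + of_int m * (x - t i)"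
    unfolding piecewise_linear_int_def by blast
  have mono: "t i < t j" if "i < j" "j \<le> n" for i j
    using that
  proof (induction j)
    case (Suc j)
    then show ?case using t(3)[of j] by (cases "i = j") (auto intro: less_trans)
  qed simp
  have mono_le: "t i \<le> t j" if "i \<le> j" "j \<le> n" for i j
    using mono[of i j] that by (cases "i = j") auto
  let ?A = "t ` {..n}"
  have "affine_pieces g ?A"
    unfolding affine_pieces_def
  proof (intro allI impI)
    fix x y assume xy: "consecutive ?A x y" "x < y"
    then obtain i j where ij: "x = t i" "y = t j" "i \<le> n" "j \<le> n" by (auto simp: consecutive_def)
    have "i < j" using xy ij mono_le[of j i] by (cases "i < j") auto
    have "j = Suc i"
    proof (rule ccontr)
      assume "j \<noteq> Suc i"
      then have "Suc i < j" using \<open>i < j\<close> by simp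
      then have "t i < t (Suc i)" "t (Suc i) < t j" "t (Suc i) \<in> ?A" using mono ij by auto
      then show False using xy ij by (force simp: consecutive_def)
    qed
    then show "affine_int g x y" using t(4)[of i] ij unfolding affine_int_def by simp
  qed
  moreover have "?A \<subseteq> {0..l}" using mono_le[of 0] mono_le[of _ n] unfolding t(1,2) by auto
  moreover have "{0, l} \<subseteq> ?A" using t(1,2) by (auto simp: image_iff intro: bexI[of _ 0] bexI[of _ n])
  ultimately show "\<exists>A. finite A \<and> {0, l} \<subseteq> A \<and> A \<subseteq> {0..l} \<and> affine_pieces g A"
    by (intro exI[of _ ?A]) auto
next
  assume "\<exists>A. finite A \<and> {0, l} \<subseteq> A \<and> A \<subseteq> {0..l} \<and> affine_pieces g A"
  then obtain A where A: "finite A" "0 \<in> A" "l \<in> A" "A \<subseteq> {0..l}" "affine_pieces g A" by auto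
  let ?xs = "sorted_list_of_set A"
  have xs: "sorted_wrt (<) ?xs" "set ?xs = A" using A(1) by auto
  define n where "n = length ?xs - 1"
  have len: "length ?xs = Suc n" using A(1,2) card_gt_0_iff[of A] by (auto simp: n_def)
  have less: "?xs ! i < ?xs ! j" if "i < j" "j \<le> n" for i j
    using sorted_wrt_nth_less[OF xs(1), of i j] that len by simp
  have idx: "\<exists>i\<le>n. z = ?xs ! i" if "z \<in> A" for z
    using that xs(2) len by (metis in_set_conv_nth less_Suc_eq_le)
  have mem: "?xs ! i \<in> A" if "i \<le> n" for i using that len xs(2) nth_mem[of i ?xs] by auto
  have "?xs ! 0 = 0"
  proof -
    obtain i where i: "i \<le> n" "0 = ?xs ! i" using idx[OF A(2)] by blast
    have "0 \<le> ?xs ! 0" using mem[of 0] A(4) by auto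
    then show ?thesis using less[of 0 i] i by (cases "i = 0") auto
  qed
  moreover have "?xs ! n = l"
  proof -
    obtain i where i: "i \<le> n" "l = ?xs ! i" using idx[OF A(3)] by blast
    have "?xs ! n \<le> l" using mem[of n] A(4) by auto
    then show ?thesis using less[of i n] i by (cases "i = n") auto
  qed
  moreover have "affine_int g (?xs ! i) (?xs ! Suc i)" if "i < n" for i
  proof -
    have "consecutive A (?xs ! i) (?xs ! Suc i)"
      unfolding consecutive_def
    proof (intro conjI ballI)
      fix z assume "z \<in> A"
      then obtain k where k: "k \<le> n" "z = ?xs ! k" using idx by blast
      show "z \<le> min (?xs ! i) (?xs ! Suc i) \<or> max (?xs ! i) (?xs ! Suc i) \<le> z"
        using less[of i "Suc i"] less[of k i] less[of "Suc i" k] k that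
        by (cases "k < i"; cases "k = i"; cases "k = Suc i") auto
    qed (use mem[of i] mem[of "Suc i"] less[of i "Suc i"] that in auto)
    then show ?thesis using A(5) less[of i "Suc i"] that by (auto simp: affine_pieces_def)
  qed
  ultimately show "piecewise_linear_int l g"
    unfolding piecewise_linear_int_def affine_int_def
    by (intro exI[of _ n] exI[of _ "\<lambda>i. ?xs ! i"]) (use less in auto)
qed

section \<open>Subdivisions of a metric graph\<close>

abbreviation "lookup \<equiv> Poly_Mapping.lookup"
abbreviation "keys \<equiv> Poly_Mapping.keys"

text \<open>The pieces form a finite cover by closed intervals, on each of which the function is
  affine, so the pasting lemma applies.\<close>

lemma affine_pieces_continuous:
  assumes "finite A" "{l, u} \<subseteq> A" "A \<subseteq> {l..u}" "l < u" "affine_pieces g A"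
  shows "continuous_on {l..u} g"
proof -
  define I where "I = {p \<in> A \<times> A. consecutive A (fst p) (snd p) \<and> fst p < snd p}"
  have "finite I" unfolding I_def using assms(1) by auto
  then have "continuous_on (\<Union>p\<in>I. {fst p..snd p}) g"
  proof (rule continuous_on_closed_Union)
    fix p assume "p \<in> I"
    then have "affine_int g (fst p) (snd p)" using assms(5) by (auto simp: I_def affine_pieces_def)
    then obtain m :: int where m: "\<And>z. z \<in> {fst p..snd p} \<Longrightarrow> g z = g (fst p) + of_int m * (z - fst p)"
      unfolding affine_int_def by blast
    have "continuous_on {fst p..snd p} (\<lambda>z. g (fst p) + of_int m * (z - fst p))"
      by (intro continuous_intros)
    then show "continuous_on {fst p..snd p} g" by (rule continuous_on_eq) (rule m[symmetric])
  qed auto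
  moreover have "{l..u} \<subseteq> (\<Union>p\<in>I. {fst p..snd p})"
  proof
    fix z assume "z \<in> {l..u}"
    then have "l \<le> z" "z \<le> u" "l \<in> A" "u \<in> A" using assms(2) by auto
    then obtain a b where "consecutive A a b" "a < b" "a \<le> z" "z \<le> b"
      using between_consecutive[OF assms(1) _ _ assms(4)] by metis
    then show "z \<in> (\<Union>p\<in>I. {fst p..snd p})"
      by (intro UN_I[of "(a, b)"]) (auto simp: I_def consecutive_def)
  qed
  ultimately show ?thesis by (rule continuous_on_subset)
qed

section \<open>Points, topology and subdivisions of a metric graph\<close>

locale metric =
  fixes G :: multigraph
  assumes metric_graph: "metric_graph G"
begin

abbreviation pt :: "nat \<Rightarrow> real \<Rightarrow> location" where
  "pt e x \<equiv> point_at G (OnEdge e x)"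

lemma edge_facts:
  assumes "e < num_edges G"
  shows "esrc G e < num_vertices G" "etgt G e < num_vertices G" "0 < elen G e"
  using metric_graph assms by (auto simp: metric_graph_def)

lemma pt_eq_OnEdge: "pt e x = OnEdge e' z \<longleftrightarrow> e = e' \<and> x = z \<and> x \<noteq> 0 \<and> x \<noteq> elen G e"
  by auto

lemma points_eq:
  "points G = {Vertex v | v. v < num_vertices G} \<union> {OnEdge e x | e x. e < num_edges G \<and> 0 < x \<and> x < elen G e}"
  (is "_ = ?R")
proof
  show "points G \<subseteq> ?R"
  proof
    fix p assume "p \<in> points G"
    then consider v where "p = Vertex v" "v < num_vertices G"
      | e x where "p = pt e x" "e < num_edges G" "0 \<le> x" "x \<le> elen G e"
      by (auto simp: points_def locations_def simp del: point_at.simps(2))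
    then show "p \<in> ?R"
      by cases (use edge_facts in auto)
  qed
  show "?R \<subseteq> points G"
  proof
    fix p assume "p \<in> ?R"
    then have "p \<in> locations G" "point_at G p = p" by (auto simp: locations_def)
    then show "p \<in> points G" unfolding points_def by (metis image_eqI)
  qed
qed

lemma pt_in_points: "e < num_edges G \<Longrightarrow> 0 \<le> x \<Longrightarrow> x \<le> elen G e \<Longrightarrow> pt e x \<in> points G"
  unfolding points_def locations_def by blast

lemma topspace_graph_topology: "topspace (graph_topology G) = points G"
  and openin_graph_topology: "openin (graph_topology G) U \<longleftrightarrow> U \<subseteq> points G \<and>
     (\<forall>e<num_edges G. openin (top_of_set {0..elen G e}) {x \<in> {0..elen G e}. pt e x \<in> U})"
proof -
  show o: "openin (graph_topology G) U \<longleftrightarrow> U \<subseteq> points G \<and>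
     (\<forall>e<num_edges G. openin (top_of_set {0..elen G e}) {x \<in> {0..elen G e}. pt e x \<in> U})" for U
    unfolding graph_topology_def by (simp only: topology_inverse'[OF istopology_graph_topology])
  have "{x \<in> {0..elen G e}. pt e x \<in> points G} = {0..elen G e}" if "e < num_edges G" for e
    using pt_in_points[OF that] by (auto simp del: point_at.simps)
  then have "openin (graph_topology G) (points G)"
    unfolding o by (metis openin_subtopology_self subset_refl)
  moreover have "topspace (graph_topology G) \<subseteq> points G"
    using o openin_topspace by blast
  ultimately show "topspace (graph_topology G) = points G"
    using openin_subset by blast
qed

definition subdivision :: "(nat \<Rightarrow> real set) \<Rightarrow> bool" where
  "subdivision X \<longleftrightarrow> (\<forall>e<num_edges G. finite (X e) \<and> {0, elen G e} \<subseteq> X e \<and> X e \<subseteq> {0..elen G e})"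

text \<open>The vertices of the graph are listed separately because a graph with a single vertex may
  have no edges.\<close>

definition verts :: "(nat \<Rightarrow> real set) \<Rightarrow> location set" where
  "verts X = {Vertex v | v. v < num_vertices G} \<union> {pt e x | e x. e < num_edges G \<and> x \<in> X e}"

definition darts :: "(nat \<Rightarrow> real set) \<Rightarrow> (nat \<times> real \<times> real) set" where
  "darts X = {(e, x, y) | e x y. e < num_edges G \<and> consecutive (X e) x y}"

definition dsrc :: "nat \<times> real \<times> real \<Rightarrow> location" where
  "dsrc d = pt (fst d) (fst (snd d))"

definition dtgt :: "nat \<times> real \<times> real \<Rightarrow> location" where
  "dtgt d = pt (fst d) (snd (snd d))"

definition drev :: "nat \<times> real \<times> real \<Rightarrow> nat \<times> real \<times> real" where
  "drev d = (fst d, snd (snd d), fst (snd d))"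

definition dlen :: "nat \<times> real \<times> real \<Rightarrow> real" where
  "dlen d = \<bar>snd (snd d) - fst (snd d)\<bar>"

definition dslope :: "(location \<Rightarrow> real) \<Rightarrow> nat \<times> real \<times> real \<Rightarrow> int" where
  "dslope f d = (if fst (snd d) < snd (snd d) then slope_up (along_edge G f (fst d)) (fst (snd d))
     else slope_down (along_edge G f (fst d)) (fst (snd d)))"

definition affine_on :: "(nat \<Rightarrow> real set) \<Rightarrow> (location \<Rightarrow> real) \<Rightarrow> bool" where
  "affine_on X f \<longleftrightarrow> (\<forall>e<num_edges G. affine_pieces (along_edge G f e) (X e))"

lemma subdivisionD:
  assumes "subdivision X" "e < num_edges G"
  shows "finite (X e)" "0 \<in> X e" "elen G e \<in> X e" "x \<in> X e \<Longrightarrow> 0 \<le> x" "x \<in> X e \<Longrightarrow> x \<le> elen G e"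
  using assms unfolding subdivision_def by (blast, blast, blast, fastforce, fastforce)

lemma affine_on_refine:
  assumes "subdivision X" "subdivision Y" "\<And>e. e < num_edges G \<Longrightarrow> X e \<subseteq> Y e" "affine_on X f"
  shows "affine_on Y f"
  unfolding affine_on_def
proof (intro allI impI)
  fix e assume e: "e < num_edges G"
  show "affine_pieces (along_edge G f e) (Y e)"
    by (rule affine_pieces_refine[of _ "X e" _ 0 "elen G e"]) (use assms e in \<open>auto simp: affine_on_def subdivision_def\<close>)
qed

text \<open>This reduces rational functions to a finite set of break points on every edge. For the
  converse, continuity is checked on each closed edge interval, as the quotient topology
  prescribes.\<close>

lemma rational_function_iff: "rational_function G f \<longleftrightarrow> (\<exists>X. subdivision X \<and> affine_on X f)"
proof
  assume f: "rational_function G f"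
  have "\<exists>A. finite A \<and> {0, elen G e} \<subseteq> A \<and> A \<subseteq> {0..elen G e} \<and> affine_pieces (along_edge G f e) A"
    if "e < num_edges G" for e
    using f that unfolding rational_function_def piecewise_linear_int_iff[OF edge_facts(3)[OF that], symmetric] by simp
  then obtain X where "\<And>e. e < num_edges G \<Longrightarrow> finite (X e) \<and> {0, elen G e} \<subseteq> X e \<and> X e \<subseteq> {0..elen G e}
      \<and> affine_pieces (along_edge G f e) (X e)"
    by metis
  then show "\<exists>X. subdivision X \<and> affine_on X f" unfolding subdivision_def affine_on_def by blast
next
  assume "\<exists>X. subdivision X \<and> affine_on X f"
  then obtain X where X: "subdivision X" "affine_on X f" by auto
  have pl: "piecewise_linear_int (elen G e) (along_edge G f e)" if "e < num_edges G" for e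
    unfolding piecewise_linear_int_iff[OF edge_facts(3)[OF that]]
    using X that by (intro exI[of _ "X e"]) (simp add: subdivision_def affine_on_def)
  have cont: "continuous_on {0..elen G e} (along_edge G f e)" if "e < num_edges G" for e
    by (rule affine_pieces_continuous[of "X e"]) (use X that edge_facts(3)[OF that] in \<open>auto simp: subdivision_def affine_on_def\<close>)
  have "continuous_map (graph_topology G) euclideanreal f"
    unfolding continuous_map_def topspace_graph_topology openin_graph_topology
  proof (intro conjI allI impI)
    fix U :: "real set" and e assume "openin euclideanreal U" and e: "e < num_edges G"
    then have "open U" by simp
    have "{x \<in> {0..elen G e}. pt e x \<in> {p \<in> points G. f p \<in> U}} = {0..elen G e} \<inter> along_edge G f e -` U"
      using pt_in_points[OF e] by (auto simp: along_edge_def simp del: point_at.simps)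
    then show "openin (top_of_set {0..elen G e}) {x \<in> {0..elen G e}. pt e x \<in> {p \<in> points G. f p \<in> U}}"
      using continuous_openin_preimage_gen[OF cont[OF e] \<open>open U\<close>] by simp
  qed auto
  then show "rational_function G f" using pl by (auto simp: rational_function_def)
qed

end

section \<open>The network of a subdivision\<close>

locale subdivided = metric +
  fixes X :: "nat \<Rightarrow> real set"
  assumes subdivision: "subdivision X"
begin

lemmas X_facts = subdivisionD[OF subdivision]

sublocale network "verts X" "darts X" dsrc dtgt drev dlen
proof
  have "verts X = (Vertex ` {..<num_vertices G}) \<union> (\<Union>e<num_edges G. pt e ` X e)"
    by (auto simp: verts_def simp del: point_at.simps)
  then show "finite (verts X)" using X_facts(1) by auto
  have "darts X \<subseteq> (SIGMA e : {..<num_edges G}. X e \<times> X e)"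
    by (auto simp: darts_def consecutive_def)
  then show "finite (darts X)" by (rule finite_subset) (use X_facts(1) in auto)
qed (auto simp: darts_def dsrc_def dtgt_def drev_def dlen_def verts_def consecutive_sym consecutive_def
    simp del: point_at.simps)

lemma verts_subset: "verts X \<subseteq> points G"
proof -
  have "pt e x \<in> points G" if "e < num_edges G" "x \<in> X e" for e x
    using X_facts(4,5)[OF that(1,2)] that(1) by (intro pt_in_points)
  then show ?thesis by (auto simp: verts_def points_eq simp del: point_at.simps)
qed

lemma OnEdge_in_verts: "OnEdge e z \<in> verts X \<longleftrightarrow> e < num_edges G \<and> z \<in> X e \<and> 0 < z \<and> z < elen G e"
proof -
  have "OnEdge e z \<in> verts X \<longleftrightarrow> e < num_edges G \<and> z \<in> X e \<and> z \<noteq> 0 \<and> z \<noteq> elen G e"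
    unfolding verts_def using pt_eq_OnEdge by (auto simp del: point_at.simps) metis+
  then show ?thesis using X_facts(4,5) by force
qed

lemma darts_at_OnEdge:
  assumes "e < num_edges G" "z \<in> X e" "0 < z" "z < elen G e"
  shows "{d. d \<in> darts X \<and> dsrc d = OnEdge e z} = {(e, z, nxt (X e) z), (e, z, prv (X e) z)}"
    and "prv (X e) z < z" "z < nxt (X e) z"
proof -
  note n = consecutive_nxt[OF X_facts(1)[OF assms(1)] assms(2) X_facts(3)[OF assms(1)] assms(4)]
  note p = consecutive_prv[OF X_facts(1)[OF assms(1)] assms(2) X_facts(2)[OF assms(1)] assms(3)]
  show "prv (X e) z < z" "z < nxt (X e) z" using n p by auto
  show "{d. d \<in> darts X \<and> dsrc d = OnEdge e z} = {(e, z, nxt (X e) z), (e, z, prv (X e) z)}"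
  proof (intro equalityI subsetI)
    fix d assume "d \<in> {d. d \<in> darts X \<and> dsrc d = OnEdge e z}"
    then obtain y where y: "d = (e, z, y)" "consecutive (X e) z y"
      by (auto simp: darts_def dsrc_def pt_eq_OnEdge simp del: point_at.simps)
    show "d \<in> {(e, z, nxt (X e) z), (e, z, prv (X e) z)}"
      using y consecutive_unique_up[OF y(2) n(1) _ n(2)] consecutive_unique_down[OF y(2) p(1) _ p(2)]
      by (auto simp: consecutive_def)
  next
    fix d assume "d \<in> {(e, z, nxt (X e) z), (e, z, prv (X e) z)}"
    then show "d \<in> {d. d \<in> darts X \<and> dsrc d = OnEdge e z}"
      using assms n(1) p(1) by (auto simp: darts_def dsrc_def)
  qed
qed

lemma sum_darts_at_OnEdge:
  assumes "e < num_edges G" "z \<in> X e" "0 < z" "z < elen G e"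
  shows "(\<Sum>d | d \<in> darts X \<and> dsrc d = OnEdge e z. h d) = h (e, z, nxt (X e) z) + h (e, z, prv (X e) z)"
  using darts_at_OnEdge[OF assms] by simp

text \<open>A loop at \<open>v\<close> appears in both sets, once for each end, in accordance with
  the two sums in \<open>ord_at\<close>.\<close>

lemma darts_at_Vertex:
  "{d. d \<in> darts X \<and> dsrc d = Vertex v} =
    (\<lambda>e. (e, 0, nxt (X e) 0)) ` {e. e < num_edges G \<and> esrc G e = v} \<union>
    (\<lambda>e. (e, elen G e, prv (X e) (elen G e))) ` {e. e < num_edges G \<and> etgt G e = v}" (is "?L = ?R")
proof (intro equalityI subsetI)
  fix d assume "d \<in> ?L"
  then obtain e x y where d: "d = (e, x, y)" "e < num_edges G" "consecutive (X e) x y" "pt e x = Vertex v"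
    by (auto simp: darts_def dsrc_def simp del: point_at.simps)
  have x: "x \<in> X e" "y \<in> X e" "x \<noteq> y" using d by (auto simp: consecutive_def)
  note E = edge_facts[OF d(2)]
  consider "x = 0" "esrc G e = v" | "x = elen G e" "x \<noteq> 0" "etgt G e = v" using d(4) by (auto split: if_splits)
  then show "d \<in> ?R"
  proof cases
    case 1
    note n = consecutive_nxt[OF X_facts(1,2,3)[OF d(2)] E(3)]
    have "0 < y" using X_facts(4)[OF d(2) x(2)] x 1 by simp
    then have "y = nxt (X e) 0" using consecutive_unique_up[of "X e" 0 y, OF _ n(1) _ n(2)] d 1 by simp
    then show ?thesis using d 1 by auto
  next
    case 2
    note n = consecutive_prv[OF X_facts(1)[OF d(2)] X_facts(3)[OF d(2)] X_facts(2)[OF d(2)] E(3)]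
    have "y < x" using X_facts(5)[OF d(2) x(2)] x 2 by simp
    then have "y = prv (X e) x" using consecutive_unique_down[of "X e" x y, OF _ _ _ ] n d 2 by simp
    then show ?thesis using d 2 by auto
  qed
next
  fix d assume "d \<in> ?R"
  then consider e where "e < num_edges G" "esrc G e = v" "d = (e, 0, nxt (X e) 0)"
    | e where "e < num_edges G" "etgt G e = v" "d = (e, elen G e, prv (X e) (elen G e))" by auto
  then show "d \<in> ?L"
  proof cases
    case (1 e)
    then show ?thesis using consecutive_nxt[OF X_facts(1,2,3)[OF 1(1)] edge_facts(3)[OF 1(1)]]
      by (auto simp: darts_def dsrc_def)
  next
    case (2 e)
    then show ?thesis using edge_facts(3)[OF 2(1)] consecutive_prv[OF X_facts(1)[OF 2(1)] X_facts(3)[OF 2(1)] X_facts(2)[OF 2(1)]]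
      by (auto simp: darts_def dsrc_def)
  qed
qed

lemma ord_at_eq:
  assumes "w \<in> verts X"
  shows "ord_at G f w = (\<Sum>d | d \<in> darts X \<and> dsrc d = w. dslope f d)"
proof (cases w)
  case (OnEdge e z)
  then have z: "e < num_edges G" "z \<in> X e" "0 < z" "z < elen G e" using assms OnEdge_in_verts by auto
  then show ?thesis unfolding OnEdge sum_darts_at_OnEdge[OF z] using darts_at_OnEdge(2,3)[OF z]
    by (simp add: dslope_def)
next
  case (Vertex v)
  let ?A = "{e. e < num_edges G \<and> esrc G e = v}" and ?B = "{e. e < num_edges G \<and> etgt G e = v}"
  let ?a = "\<lambda>e. (e, 0 :: real, nxt (X e) 0)" and ?b = "\<lambda>e. (e, elen G e, prv (X e) (elen G e))"
  have "(\<Sum>d\<in>?a ` ?A \<union> ?b ` ?B. dslope f d) = (\<Sum>d\<in>?a ` ?A. dslope f d) + (\<Sum>d\<in>?b ` ?B. dslope f d)"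
    by (rule sum.union_disjoint) (use edge_facts(3) in force)+
  also have "(\<Sum>d\<in>?a ` ?A. dslope f d) = (\<Sum>e\<in>?A. dslope f (?a e))"
    by (subst sum.reindex) (auto intro: inj_onI)
  also have "\<dots> = (\<Sum>e\<in>?A. slope_up (along_edge G f e) 0)"
    using consecutive_nxt(2)[OF X_facts(1,2,3) edge_facts(3)] by (intro sum.cong) (auto simp: dslope_def)
  also have "(\<Sum>d\<in>?b ` ?B. dslope f d) = (\<Sum>e\<in>?B. dslope f (?b e))"
    by (subst sum.reindex) (auto intro: inj_onI)
  also have "\<dots> = (\<Sum>e\<in>?B. slope_down (along_edge G f e) (elen G e))"
  proof (rule sum.cong)
    fix e assume "e \<in> ?B"
    then have e: "e < num_edges G" by simp
    have "prv (X e) (elen G e) < elen G e"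
      by (rule consecutive_prv(2)[OF X_facts(1)[OF e] X_facts(3)[OF e] X_facts(2)[OF e] edge_facts(3)[OF e]])
    then show "dslope f (?b e) = slope_down (along_edge G f e) (elen G e)" by (simp add: dslope_def)
  qed simp
  finally show ?thesis by (simp add: Vertex darts_at_Vertex)
qed

text \<open>On a segment where \<open>f\<close> is affine its mean slope is already an integer, so
  rounding loses nothing.\<close>

lemma fl_eq_dslope:
  assumes "affine_on X f" "d \<in> darts X"
  shows "f (dtgt d) - f (dsrc d) = of_int (dslope f d) * dlen d" "fl f d = dslope f d"
proof -
  obtain e x y where d: "d = (e, x, y)" "e < num_edges G" "consecutive (X e) x y" using assms by (auto simp: darts_def)
  have "f (dtgt d) - f (dsrc d) = of_int (dslope f d) * dlen d"
  proof (cases "x < y")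
    case True
    then have "affine_int (along_edge G f e) x y" using assms d by (auto simp: affine_on_def affine_pieces_def)
    from affine_int_slopes(1)[OF this True] show ?thesis using d True
      by (simp add: dtgt_def dsrc_def dslope_def dlen_def along_edge_def del: point_at.simps)
  next
    case False
    then have "y < x" using d by (auto simp: consecutive_def)
    then have "affine_int (along_edge G f e) y x" using assms d consecutive_sym by (auto simp: affine_on_def affine_pieces_def)
    from affine_int_slopes(2)[OF this \<open>y < x\<close>] show ?thesis using d \<open>y < x\<close>
      by (simp add: dtgt_def dsrc_def dslope_def dlen_def along_edge_def del: point_at.simps)
  qed
  then show "f (dtgt d) - f (dsrc d) = of_int (dslope f d) * dlen d" "fl f d = dslope f d"
    using len_pos[OF assms(2)] by (auto simp: fl_def)
qed

lemma ord_at_gain: "affine_on X f \<Longrightarrow> w \<in> verts X \<Longrightarrow> ord_at G f w = gain f w"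
  unfolding gain_def by (simp add: ord_at_eq) (intro sum.cong, auto simp: fl_eq_dslope)

lemma ord_at_outside:
  assumes "affine_on X f" "p \<in> points G" "p \<notin> verts X"
  shows "ord_at G f p = 0"
proof -
  obtain e z where p: "p = OnEdge e z" "e < num_edges G" "0 < z" "z < elen G e"
    using assms(2,3) by (auto simp: points_eq verts_def)
  then have "z \<notin> X e" using assms(3) OnEdge_in_verts by auto
  obtain x y where xy: "consecutive (X e) x y" "x < y" "x \<le> z" "z \<le> y"
    by (rule between_consecutive[OF X_facts(1,2,3)[OF p(2)] edge_facts(3)[OF p(2)], of z]) (use p in auto)
  have "affine_int (along_edge G f e) x y" using assms(1) xy p by (auto simp: affine_on_def affine_pieces_def)
  moreover have "x \<noteq> z" "z \<noteq> y" using \<open>z \<notin> X e\<close> xy by (auto simp: consecutive_def)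
  ultimately show ?thesis using affine_int_slopes_interior[of _ x y z] xy p by simp
qed

end

section \<open>Principal divisors and linear systems\<close>

context metric
begin

text \<open>Over an infinite set the sum in \<open>principal_divisor\<close> would be 0 by
  convention; finiteness makes it the intended divisor.\<close>

lemma finite_ord_support:
  assumes "rational_function G f"
  shows "finite {p. p \<in> points G \<and> ord_at G f p \<noteq> 0}"
proof -
  obtain X where X: "subdivision X" "affine_on X f" using assms rational_function_iff by auto
  interpret subdivided G X by unfold_locales (rule X)
  have "{p. p \<in> points G \<and> ord_at G f p \<noteq> 0} \<subseteq> verts X" using ord_at_outside[OF X(2)] by blast
  then show ?thesis using finite_W finite_subset by blast
qed

lemma lookup_principal_divisor:
  assumes "rational_function G f"
  shows "lookup (principal_divisor G f) p = (if p \<in> points G then ord_at G f p else 0)"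
proof -
  let ?S = "{p. p \<in> points G \<and> ord_at G f p \<noteq> 0}"
  have "lookup (principal_divisor G f) p = (\<Sum>q\<in>?S. if p = q then ord_at G f q else 0)"
    unfolding principal_divisor_def lookup_sum by (intro sum.cong) auto
  also have "\<dots> = (if p \<in> ?S then ord_at G f p else 0)" using finite_ord_support[OF assms] by (simp add: sum.delta')
  finally show ?thesis by auto
qed

lemma linear_system_iff:
  assumes "D \<in> Div G"
  shows "linear_system G D \<noteq> {} \<longleftrightarrow>
    (\<exists>f. rational_function G f \<and> (\<forall>p\<in>points G. 0 \<le> lookup D p + ord_at G f p))"
proof
  assume "linear_system G D \<noteq> {}"
  then obtain E f where Ef: "effective E" "rational_function G f" "E = D + principal_divisor G f"
    by (auto simp: linear_system_def equivalent_def)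
  have "0 \<le> lookup D p + ord_at G f p" if "p \<in> points G" for p
    using Ef(1) that unfolding effective_def Ef(3) lookup_add lookup_principal_divisor[OF Ef(2)] by (metis (full_types))
  then show "\<exists>f. rational_function G f \<and> (\<forall>p\<in>points G. 0 \<le> lookup D p + ord_at G f p)"
    using Ef(2) by blast
next
  assume "\<exists>f. rational_function G f \<and> (\<forall>p\<in>points G. 0 \<le> lookup D p + ord_at G f p)"
  then obtain f where f: "rational_function G f" "\<And>p. p \<in> points G \<Longrightarrow> 0 \<le> lookup D p + ord_at G f p"
    by blast
  let ?E = "D + principal_divisor G f"
  have D0: "lookup D p = 0" if "p \<notin> points G" for p
    using assms that by (metis Div_def in_keys_iff mem_Collect_eq subsetD)
  have E: "lookup ?E p = (if p \<in> points G then lookup D p + ord_at G f p else 0)" for p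
    using D0 by (simp add: lookup_add lookup_principal_divisor[OF f(1)])
  have "effective ?E" using f(2) by (simp add: effective_def E)
  moreover have "?E \<in> Div G" unfolding Div_def using E by (auto simp: in_keys_iff split: if_splits)
  moreover have "equivalent G ?E D" using f(1) by (auto simp: equivalent_def)
  ultimately show "linear_system G D \<noteq> {}" by (auto simp: linear_system_def)
qed

end

declare point_at.simps(2) [simp del]

section \<open>Rational functions versus solutions on the network\<close>

context subdivided
begin

text \<open>Non-negative orders make \<open>f\<close> convex on the segment, so its initial slope is
  at most its mean slope and, being an integer, at most the floor of it.\<close>

lemma dslope_le_fl:
  assumes f: "rational_function G f" and d: "(e, x, y) \<in> darts X"
    and pos: "\<And>z. min x y < z \<Longrightarrow> z < max x y \<Longrightarrow> 0 \<le> ord_at G f (OnEdge e z)"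
  shows "dslope f (e, x, y) \<le> fl f (e, x, y)"
proof -
  obtain Y0 where Y0: "subdivision Y0" "affine_on Y0 f" using f rational_function_iff by auto
  \<comment> \<open>A common refinement, containing the ends of the dart as well as the break points
    of \<open>f\<close>.\<close>
  define Y where "Y = (\<lambda>e. X e \<union> Y0 e)"
  have Y: "subdivision Y" using Y0(1) subdivision unfolding subdivision_def Y_def by auto
  have "affine_on Y f" by (rule affine_on_refine[OF Y0(1) Y _ Y0(2)]) (auto simp: Y_def)
  have e: "e < num_edges G" and c: "consecutive (X e) x y" using d by (auto simp: darts_def)
  let ?g = "along_edge G f e"
  have xy: "x \<in> Y e" "y \<in> Y e" "x \<noteq> y" using c by (auto simp: consecutive_def Y_def)
  have UV: "of_int (slope_up ?g a) * (b - a) \<le> ?g b - ?g a \<and> of_int (slope_down ?g b) * (b - a) \<le> ?g a - ?g b"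
    if "consecutive (Y e) a b" "a < b" for a b
  proof -
    have "affine_int ?g a b" using \<open>affine_on Y f\<close> that e by (auto simp: affine_on_def affine_pieces_def)
    from affine_int_slopes(1,2)[OF this that(2)] show ?thesis by simp
  qed
  show ?thesis
  proof (cases "x < y")
    case True
    have "of_int (slope_up ?g x) * (y - x) \<le> ?g y - ?g x"
      by (rule discrete_convex_up[OF subdivisionD(1)[OF Y e] xy(1,2) True, where V = "slope_down ?g"])
         (use UV pos True in auto)
    then show ?thesis using True
      unfolding fl_ge_iff[OF d] by (simp add: dslope_def dlen_def dtgt_def dsrc_def along_edge_def)
  next
    case False
    then have "y < x" using xy by auto
    have "of_int (slope_down ?g x) * (x - y) \<le> ?g y - ?g x"
      by (rule discrete_convex_down[OF subdivisionD(1)[OF Y e] xy(2,1) \<open>y < x\<close>, where U = "slope_up ?g"])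
         (use UV pos \<open>y < x\<close> in auto)
    then show ?thesis using \<open>y < x\<close>
      unfolding fl_ge_iff[OF d] by (simp add: dslope_def dlen_def dtgt_def dsrc_def along_edge_def)
  qed
qed

text \<open>Between the vertices \<open>D\<close> vanishes, so \<open>f\<close> has no negative
  order there; by \<open>dslope_le_fl\<close> the rounded slopes give every vertex at least as many
  chips as \<open>f\<close> does.\<close>

lemma rational_function_sol:
  assumes f: "rational_function G f" and pos: "\<And>p. p \<in> points G \<Longrightarrow> 0 \<le> D p + ord_at G f p"
    and D: "\<And>p. p \<notin> verts X \<Longrightarrow> D p = 0"
  shows "sol D f"
  unfolding sol_def
proof
  fix w assume w: "w \<in> verts X"
  have "dslope f d \<le> fl f d" if "d \<in> darts X" for d
  proof -
    from that obtain e x y where d: "d = (e, x, y)" "e < num_edges G" "consecutive (X e) x y"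
      by (auto simp: darts_def)
    show ?thesis unfolding d(1)
    proof (rule dslope_le_fl[OF f])
      show "(e, x, y) \<in> darts X" using that d by simp
      fix z assume z: "min x y < z" "z < max x y"
      have "0 \<le> min x y" "max x y \<le> elen G e" "z \<notin> X e"
        using z X_facts(4,5)[OF d(2)] d(3) by (auto simp: consecutive_def)
      then have "OnEdge e z \<in> points G" "OnEdge e z \<notin> verts X"
        using z d(2) by (auto simp: points_eq OnEdge_in_verts)
      then show "0 \<le> ord_at G f (OnEdge e z)" using pos D by fastforce
    qed
  qed
  then have "ord_at G f w \<le> gain f w" unfolding ord_at_eq[OF w] gain_def by (intro sum_mono) auto
  then show "0 \<le> D w + gain f w" using pos[of w] w verts_subset by force
qed

text \<open>Between neighbouring vertices the convex interpolation with the steepest integral slopes that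
  the values permit.\<close>

definition interpolation :: "(location \<Rightarrow> real) \<Rightarrow> location \<Rightarrow> real" where
  "interpolation f p = (case p of Vertex v \<Rightarrow> f p | OnEdge e z \<Rightarrow> if z \<in> X e then f p else
     (let x = prv (X e) z; y = nxt (X e) z in
       max (f (pt e x) + of_int (fl f (e, x, y)) * (z - x)) (f (pt e y) + of_int (fl f (e, y, x)) * (y - z))))"

lemma fl_dart_up:
  assumes "(e, x, y) \<in> darts X" "x < y"
  shows "of_int (fl f (e, x, y)) * (y - x) \<le> f (pt e y) - f (pt e x)"
    and "of_int (fl f (e, y, x)) * (y - x) \<le> f (pt e x) - f (pt e y)"
proof -
  have "(e, y, x) \<in> darts X" using assms(1) consecutive_sym by (auto simp: darts_def)
  then show "of_int (fl f (e, x, y)) * (y - x) \<le> f (pt e y) - f (pt e x)"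
    "of_int (fl f (e, y, x)) * (y - x) \<le> f (pt e x) - f (pt e y)"
    using fl_ge_iff[OF assms(1), of "fl f (e, x, y)" f] fl_ge_iff[of "(e, y, x)" "fl f (e, y, x)" f] assms(2)
    by (auto simp: dlen_def dsrc_def dtgt_def)
qed

lemma interpolation_vertex: "w \<in> verts X \<Longrightarrow> interpolation f w = f w"
  by (auto simp: interpolation_def OnEdge_in_verts split: location.splits)

text \<open>At an end of the segment the line drawn from the other end lies below, by
  \<open>fl_dart_up\<close>. Hence the formula holds on the closed segment, and both segments
  meeting at a vertex can use it.\<close>

lemma interpolation_dart:
  assumes d: "(e, x, y) \<in> darts X" "x < y" and z: "x \<le> z" "z \<le> y"
  shows "interpolation f (pt e z) =
    max (f (pt e x) + of_int (fl f (e, x, y)) * (z - x)) (f (pt e y) + of_int (fl f (e, y, x)) * (y - z))"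
proof -
  have e: "e < num_edges G" and c: "consecutive (X e) x y" using d by (auto simp: darts_def)
  have X: "x \<in> X e" "y \<in> X e" using c by (auto simp: consecutive_def)
  then have v: "pt e x \<in> verts X" "pt e y \<in> verts X" using e unfolding verts_def by blast+
  note F = fl_dart_up[OF d, of f]
  consider "z = x" | "z = y" | "x < z" "z < y" using z by linarith
  then show ?thesis
  proof cases
    case 1
    then show ?thesis using interpolation_vertex[OF v(1)] F(2) by simp
  next
    case 2
    then show ?thesis using interpolation_vertex[OF v(2)] F(1) by simp
  next
    case 3
    have p: "prv (X e) z = x" unfolding prv_def
      by (rule Max_eqI) (use X_facts(1)[OF e] 3 c in \<open>auto simp: consecutive_def\<close>)
    have n: "nxt (X e) z = y" unfolding nxt_def
      by (rule Min_eqI) (use X_facts(1)[OF e] 3 c in \<open>auto simp: consecutive_def\<close>)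
    have "z \<notin> X e" "z \<noteq> 0" "z \<noteq> elen G e" using 3 c X_facts(4)[OF e X(1)] X_facts(5)[OF e X(2)]
      by (auto simp: consecutive_def)
    then show ?thesis using p n by (simp add: interpolation_def Let_def point_at.simps)
  qed
qed

lemma interpolation_affine:
  obtains Y where "subdivision Y" "\<And>e. X e \<subseteq> Y e" "affine_on Y (interpolation f)"
proof -
  define m where "m e x y = fl f (e, x, y)" for e x y
  \<comment> \<open>The crossing point of the two lines. If \<open>m e x y + m e y x = 0\<close>,
    their slopes agree and the lines coincide, so \<open>x\<close> can be taken instead.\<close>
  define \<xi> where "\<xi> e x y = (if m e x y + m e y x = 0 then x else
    (f (pt e y) - f (pt e x) + of_int (m e y x) * y + of_int (m e x y) * x) / of_int (m e x y + m e y x))" for e x y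
  define Y where "Y e = X e \<union> {\<xi> e x y | x y. consecutive (X e) x y \<and> x < y}" for e
  have cross: "x \<le> \<xi> e x y \<and> \<xi> e x y \<le> y \<and>
      (\<forall>z. x \<le> z \<longrightarrow> z \<le> \<xi> e x y \<longrightarrow> f (pt e y) + of_int (m e y x) * (y - z) \<le> f (pt e x) + of_int (m e x y) * (z - x)) \<and>
      (\<forall>z. \<xi> e x y \<le> z \<longrightarrow> z \<le> y \<longrightarrow> f (pt e x) + of_int (m e x y) * (z - x) \<le> f (pt e y) + of_int (m e y x) * (y - z))"
    if "(e, x, y) \<in> darts X" "x < y" for e x y
  proof -
    define a b k l where "a = f (pt e x)" and "b = f (pt e y)" and "k = real_of_int (m e x y)" and "l = real_of_int (m e y x)"
    have F: "k * (y - x) \<le> b - a" "l * (y - x) \<le> a - b"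
      using fl_dart_up[OF that, of f] unfolding a_def b_def k_def l_def m_def by auto
    then have "(k + l) * (y - x) \<le> 0" by (simp add: algebra_simps)
    then have kl: "k + l \<le> 0" using that(2) by (simp add: mult_le_0_iff)
    show ?thesis
      unfolding a_def[symmetric] b_def[symmetric] k_def[symmetric] l_def[symmetric]
    proof (cases "k + l = 0")
      case True
      then have "l = - k" by simp
      then have eq: "a + k * (z - x) = b + l * (y - z)" for z using F by (simp add: algebra_simps)
      have "m e x y + m e y x = 0" using True unfolding k_def l_def by linarith
      then have "\<xi> e x y = x" by (simp add: \<xi>_def)
      show "x \<le> \<xi> e x y \<and> \<xi> e x y \<le> y \<and>
          (\<forall>z. x \<le> z \<longrightarrow> z \<le> \<xi> e x y \<longrightarrow> b + l * (y - z) \<le> a + k * (z - x)) \<and>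
          (\<forall>z. \<xi> e x y \<le> z \<longrightarrow> z \<le> y \<longrightarrow> a + k * (z - x) \<le> b + l * (y - z))"
        unfolding eq using that(2) \<open>\<xi> e x y = x\<close> by auto
    next
      case False
      then have neg: "k + l < 0" using kl by simp
      have "m e x y + m e y x \<noteq> 0" using False unfolding k_def l_def by linarith
      then have \<xi>: "\<xi> e x y = (b - a + l * y + k * x) / (k + l)"
        by (simp add: \<xi>_def a_def b_def k_def l_def)
      then have root: "(k + l) * \<xi> e x y = b - a + l * y + k * x" using neg by simp
      have 1: "b + l * (y - z) \<le> a + k * (z - x) \<longleftrightarrow> z \<le> \<xi> e x y" for z
      proof -
        have "b + l * (y - z) \<le> a + k * (z - x) \<longleftrightarrow> (k + l) * \<xi> e x y \<le> (k + l) * z"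
          unfolding root by (simp add: algebra_simps)
        then show ?thesis using neg by (simp add: mult_le_cancel_left)
      qed
      have 2: "a + k * (z - x) \<le> b + l * (y - z) \<longleftrightarrow> \<xi> e x y \<le> z" for z
      proof -
        have "a + k * (z - x) \<le> b + l * (y - z) \<longleftrightarrow> (k + l) * z \<le> (k + l) * \<xi> e x y"
          unfolding root by (simp add: algebra_simps)
        then show ?thesis using neg by (simp add: mult_le_cancel_left)
      qed
      have "x \<le> \<xi> e x y" "\<xi> e x y \<le> y" using 1[of x] 2[of y] F by auto
      then show "x \<le> \<xi> e x y \<and> \<xi> e x y \<le> y \<and>
          (\<forall>z. x \<le> z \<longrightarrow> z \<le> \<xi> e x y \<longrightarrow> b + l * (y - z) \<le> a + k * (z - x)) \<and>
          (\<forall>z. \<xi> e x y \<le> z \<longrightarrow> z \<le> y \<longrightarrow> a + k * (z - x) \<le> b + l * (y - z))"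
        using 1 2 by blast
    qed
  qed
  have fin: "finite (Y e)" if "e < num_edges G" for e
  proof -
    have "{\<xi> e x y | x y. consecutive (X e) x y \<and> x < y} \<subseteq> (\<lambda>p. \<xi> e (fst p) (snd p)) ` (X e \<times> X e)"
      by (force simp: consecutive_def)
    then show ?thesis unfolding Y_def using X_facts(1)[OF that] by (meson finite_SigmaI finite_UnI finite_imageI finite_subset)
  qed
  have \<xi>_range: "0 \<le> \<xi> e x y \<and> \<xi> e x y \<le> elen G e" if "e < num_edges G" "consecutive (X e) x y" "x < y" for e x y
  proof -
    have d: "(e, x, y) \<in> darts X" "x \<in> X e" "y \<in> X e" using that by (auto simp: darts_def consecutive_def)
    have "x \<le> \<xi> e x y" "\<xi> e x y \<le> y" using cross[OF d(1) that(3)] by blast+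
    then show ?thesis using X_facts(4)[OF that(1) d(2)] X_facts(5)[OF that(1) d(3)] by linarith
  qed
  have Y: "subdivision Y"
    unfolding subdivision_def
  proof (intro allI impI conjI)
    fix e assume e: "e < num_edges G"
    show "finite (Y e)" using fin e .
    show "{0, elen G e} \<subseteq> Y e" using X_facts(2,3)[OF e] by (auto simp: Y_def)
    show "Y e \<subseteq> {0..elen G e}" using X_facts(4,5)[OF e] \<xi>_range[OF e] by (auto simp: Y_def)
  qed
  have "affine_on Y (interpolation f)"
    unfolding affine_on_def affine_pieces_def
  proof (intro allI impI)
    fix e u v assume e: "e < num_edges G" and c: "consecutive (Y e) u v" and "u < v"
    have uv: "u \<in> Y e" "v \<in> Y e" using c by (auto simp: consecutive_def)
    \<comment> \<open>The midpoint of a piece of \<open>Y\<close> selects a segment of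
      \<open>X\<close>. Its ends and its crossing point belong to \<open>Y\<close>, so the whole
      piece lies in the segment and on one side of the crossing, where a single line attains the
      maximum.\<close>
    have "0 \<le> (u + v) / 2" "(u + v) / 2 \<le> elen G e"
      using subdivisionD(4,5)[OF Y e uv(1)] subdivisionD(4,5)[OF Y e uv(2)] by auto
    then obtain x y where xy: "consecutive (X e) x y" "x < y" "x \<le> (u + v) / 2" "(u + v) / 2 \<le> y"
      using between_consecutive[OF X_facts(1,2,3)[OF e] edge_facts(3)[OF e]] by metis
    have d: "(e, x, y) \<in> darts X" using xy e by (auto simp: darts_def)
    have mem: "x \<in> Y e" "y \<in> Y e" using xy by (auto simp: Y_def consecutive_def)
    have mem\<xi>: "\<xi> e x y \<in> Y e" unfolding Y_def using xy(1,2) by blast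
    have gap: "t \<le> u \<or> v \<le> t" if "t \<in> Y e" for t
      using c \<open>u < v\<close> that by (force simp: consecutive_def)
    have xu: "x \<le> u" "v \<le> y" using gap[OF mem(1)] gap[OF mem(2)] xy \<open>u < v\<close> by auto
    let ?g = "along_edge G (interpolation f) e"
    have g: "?g z = max (f (pt e x) + of_int (m e x y) * (z - x)) (f (pt e y) + of_int (m e y x) * (y - z))"
      if "u \<le> z" "z \<le> v" for z
      using interpolation_dart[OF d xy(2), of z f] that xu by (simp add: along_edge_def m_def)
    show "affine_int ?g u v"
    proof (cases "v \<le> \<xi> e x y")
      case True
      have "?g z = f (pt e x) + of_int (m e x y) * (z - x)" if "u \<le> z" "z \<le> v" for z
        unfolding g[OF that] by (rule max_absorb1) (use cross[OF d xy(2)] that True xu in \<open>meson order_trans\<close>)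
      note gz = this
      show ?thesis unfolding affine_int_def
      proof (intro exI[of _ "m e x y"] ballI)
        fix z assume "z \<in> {u..v}"
        then have "u \<le> z" "z \<le> v" by auto
        show "?g z = ?g u + of_int (m e x y) * (z - u)"
          unfolding gz[OF \<open>u \<le> z\<close> \<open>z \<le> v\<close>] gz[OF order_refl less_imp_le[OF \<open>u < v\<close>]] by (simp add: algebra_simps)
      qed
    next
      case False
      then have "\<xi> e x y \<le> u" using gap[OF mem\<xi>] by auto
      have "?g z = f (pt e y) + of_int (m e y x) * (y - z)" if "u \<le> z" "z \<le> v" for z
        unfolding g[OF that] by (rule max_absorb2) (use cross[OF d xy(2)] that \<open>\<xi> e x y \<le> u\<close> xu in \<open>meson order_trans\<close>)
      note gz = this
      show ?thesis unfolding affine_int_def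
      proof (intro exI[of _ "- m e y x"] ballI)
        fix z assume "z \<in> {u..v}"
        then have "u \<le> z" "z \<le> v" by auto
        show "?g z = ?g u + of_int (- m e y x) * (z - u)"
          unfolding gz[OF \<open>u \<le> z\<close> \<open>z \<le> v\<close>] gz[OF order_refl less_imp_le[OF \<open>u < v\<close>]] by (simp add: algebra_simps)
      qed
    qed
  qed
  with Y show ?thesis using that by (auto simp: Y_def)
qed

lemma slope_up_ge:
  assumes "subdivision Y" "affine_on Y h" "e < num_edges G" "z \<in> Y e" "y \<in> Y e" "z < y"
    and "\<And>t. z \<le> t \<Longrightarrow> t \<le> y \<Longrightarrow> h (pt e z) + of_int m * (t - z) \<le> h (pt e t)"
  shows "m \<le> slope_up (along_edge G h e) z"
proof -
  note n = consecutive_nxt[OF subdivisionD(1)[OF assms(1,3)] assms(4-6)]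
  let ?v = "nxt (Y e) z"
  have "affine_int (along_edge G h e) z ?v" using assms(2,3) n by (auto simp: affine_on_def affine_pieces_def)
  from affine_int_slopes(1)[OF this n(2)]
  have "h (pt e ?v) - h (pt e z) = of_int (slope_up (along_edge G h e) z) * (?v - z)"
    by (simp add: along_edge_def)
  moreover have "h (pt e z) + of_int m * (?v - z) \<le> h (pt e ?v)" using assms(7)[of ?v] n by simp
  ultimately have "of_int m * (?v - z) \<le> of_int (slope_up (along_edge G h e) z) * (?v - z)" by linarith
  then show ?thesis using n(2) by (simp add: mult_le_cancel_right)
qed

lemma slope_down_ge:
  assumes "subdivision Y" "affine_on Y h" "e < num_edges G" "z \<in> Y e" "y \<in> Y e" "y < z"
    and "\<And>t. y \<le> t \<Longrightarrow> t \<le> z \<Longrightarrow> h (pt e z) + of_int m * (z - t) \<le> h (pt e t)"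
  shows "m \<le> slope_down (along_edge G h e) z"
proof -
  note n = consecutive_prv[OF subdivisionD(1)[OF assms(1,3)] assms(4-6)]
  let ?v = "prv (Y e) z"
  have "affine_int (along_edge G h e) ?v z" using assms(2,3) n consecutive_sym by (auto simp: affine_on_def affine_pieces_def)
  from affine_int_slopes(2)[OF this n(2)]
  have "h (pt e ?v) - h (pt e z) = of_int (slope_down (along_edge G h e) z) * (z - ?v)"
    by (simp add: along_edge_def)
  moreover have "h (pt e z) + of_int m * (z - ?v) \<le> h (pt e ?v)" using assms(7)[of ?v] n by simp
  ultimately have "of_int m * (z - ?v) \<le> of_int (slope_down (along_edge G h e) z) * (z - ?v)" by linarith
  then show ?thesis using n(2) by (simp add: mult_le_cancel_right)
qed

lemma interpolation_exists:
  "\<exists>h. rational_function G h \<and> (\<forall>w\<in>verts X. gain f w \<le> ord_at G h w) \<and>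
    (\<forall>p\<in>points G - verts X. 0 \<le> ord_at G h p)"
proof -
  let ?h = "interpolation f"
  obtain Y where Y: "subdivision Y" "\<And>e. X e \<subseteq> Y e" "affine_on Y ?h"
    using interpolation_affine[of f] by blast
  interpret Y: subdivided G Y by unfold_locales (rule Y(1))
  have rat: "rational_function G ?h" using Y rational_function_iff by blast
  have up: "fl f (e, x, y) \<le> dslope ?h (e, x, y)" if d: "(e, x, y) \<in> darts X" for e x y
  proof -
    have e: "e < num_edges G" and c: "consecutive (X e) x y" using d by (auto simp: darts_def)
    then have mem: "x \<in> Y e" "y \<in> Y e" "pt e x \<in> verts X" using Y(2) unfolding consecutive_def verts_def by blast+
    note hx = interpolation_vertex[OF mem(3), of f]
    show ?thesis
    proof (cases "x < y")
      case True
      have "fl f (e, x, y) \<le> slope_up (along_edge G ?h e) x"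
        by (rule slope_up_ge[OF Y(1,3) e mem(1,2) True]) (use interpolation_dart[OF d True, of _ f] hx in simp)
      then show ?thesis using True by (simp add: dslope_def)
    next
      case False
      then have "y < x" using c by (auto simp: consecutive_def)
      have d': "(e, y, x) \<in> darts X" using e c consecutive_sym by (auto simp: darts_def)
      have "fl f (e, x, y) \<le> slope_down (along_edge G ?h e) x"
        by (rule slope_down_ge[OF Y(1,3) e mem(1,2) \<open>y < x\<close>]) (use interpolation_dart[OF d' \<open>y < x\<close>, of _ f] hx in simp)
      then show ?thesis using False by (simp add: dslope_def)
    qed
  qed
  have 1: "gain f w \<le> ord_at G ?h w" if "w \<in> verts X" for w
    unfolding ord_at_eq[OF that] gain_def by (intro sum_mono) (use up in \<open>auto simp: darts_def\<close>)
  have 2: "0 \<le> ord_at G ?h p" if p: "p \<in> points G" "p \<notin> verts X" for p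
  proof (cases "p \<in> verts Y")
    case False
    then show ?thesis using Y.ord_at_outside[OF Y(3) p(1)] by simp
  next
    case True
    obtain e z where pz: "p = OnEdge e z" "e < num_edges G" "0 < z" "z < elen G e"
      using p by (auto simp: points_eq verts_def)
    then have z: "z \<notin> X e" "z \<in> Y e" using p True OnEdge_in_verts Y.OnEdge_in_verts by auto
    obtain x y where xy: "consecutive (X e) x y" "x < y" "x \<le> z" "z \<le> y"
      by (rule between_consecutive[OF X_facts(1,2,3)[OF pz(2)] edge_facts(3)[OF pz(2)], of z]) (use pz in auto)
    have d: "(e, x, y) \<in> darts X" using xy pz by (auto simp: darts_def)
    have mem: "x \<in> Y e" "y \<in> Y e" "x < z" "z < y"
      using xy Y(2) z by (auto simp: consecutive_def less_le)
    note D = interpolation_dart[OF d xy(2), of _ f]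
    consider "?h (pt e z) = f (pt e x) + of_int (fl f (e, x, y)) * (z - x)"
      | "?h (pt e z) = f (pt e y) + of_int (fl f (e, y, x)) * (y - z)"
      using D[OF xy(3,4)] by (metis max_def)
    \<comment> \<open>The line attaining the maximum at \<open>z\<close> supports the interpolation
      on the whole segment. Its slope \<open>m\<close> bounds the outgoing slopes below by
      \<open>m\<close> and \<open>- m\<close>, which cancel in the order.\<close>
    then have "\<exists>m. (\<forall>t. x \<le> t \<longrightarrow> t \<le> y \<longrightarrow> ?h (pt e z) + of_int m * (t - z) \<le> ?h (pt e t))"
    proof cases
      case 1
      have "?h (pt e z) + of_int (fl f (e, x, y)) * (t - z) \<le> ?h (pt e t)" if "x \<le> t" "t \<le> y" for t
        unfolding 1 D[OF that] by (rule max.coboundedI1) (simp add: algebra_simps)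
      then show ?thesis by blast
    next
      case 2
      have "?h (pt e z) + of_int (- fl f (e, y, x)) * (t - z) \<le> ?h (pt e t)" if "x \<le> t" "t \<le> y" for t
        unfolding 2 D[OF that] by (rule max.coboundedI2) (simp add: algebra_simps)
      then show ?thesis by blast
    qed
    then obtain m where m: "\<And>t. x \<le> t \<Longrightarrow> t \<le> y \<Longrightarrow> ?h (pt e z) + of_int m * (t - z) \<le> ?h (pt e t)" by blast
    have "m \<le> slope_up (along_edge G ?h e) z"
      by (rule slope_up_ge[OF Y(1,3) pz(2) z(2) mem(2,4)]) (use m mem in simp)
    moreover have "- m \<le> slope_down (along_edge G ?h e) z"
    proof (rule slope_down_ge[OF Y(1,3) pz(2) z(2) mem(1,3)])
      fix t assume "x \<le> t" "t \<le> z"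
      then show "?h (pt e z) + of_int (- m) * (z - t) \<le> ?h (pt e t)"
        using m[of t] mem by (simp add: algebra_simps)
    qed
    ultimately show ?thesis by (simp add: pz)
  qed
  show ?thesis using rat 1 2 by blast
qed

text \<open>Any subdivision that carries the support of \<open>D\<close> will do. The algorithm uses
  the one read off from the input; proofs may pass to finer ones that contain the break points of a
  given function.\<close>

theorem linear_system_iff_sol:
  assumes "keys D \<subseteq> verts X"
  shows "linear_system G D \<noteq> {} \<longleftrightarrow> (\<exists>f. sol (lookup D) f)"
proof -
  have D0: "lookup D p = 0" if "p \<notin> verts X" for p
    using assms that by (metis in_keys_iff subsetD)
  have Div: "D \<in> Div G" using assms verts_subset by (auto simp: Div_def)
  show ?thesis unfolding linear_system_iff[OF Div]
  proof
    assume "\<exists>f. rational_function G f \<and> (\<forall>p\<in>points G. 0 \<le> lookup D p + ord_at G f p)"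
    then show "\<exists>f. sol (lookup D) f" using rational_function_sol[of _ "lookup D"] D0 by blast
  next
    assume "\<exists>f. sol (lookup D) f"
    then obtain f where f: "sol (lookup D) f" by blast
    obtain h where h: "rational_function G h" "\<And>w. w \<in> verts X \<Longrightarrow> gain f w \<le> ord_at G h w"
      "\<And>p. p \<in> points G \<Longrightarrow> p \<notin> verts X \<Longrightarrow> 0 \<le> ord_at G h p"
      using interpolation_exists[of f] by auto
    have "0 \<le> lookup D p + ord_at G h p" if "p \<in> points G" for p
    proof (cases "p \<in> verts X")
      case True
      then show ?thesis using f h(2)[OF True] unfolding sol_def by force
    next
      case False
      then show ?thesis using h(3)[OF that False] D0 by simp
    qed
    then show "\<exists>f. rational_function G f \<and> (\<forall>p\<in>points G. 0 \<le> lookup D p + ord_at G f p)"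
      using h(1) by blast
  qed
qed

text \<open>An edge is walked from position 0 through its break points, which joins its two ends;
  adjacency in \<open>G\<close> does the rest.\<close>

lemma connected:
  assumes "v \<in> verts X" "w \<in> verts X"
  shows "(v, w) \<in> {(dsrc d, dtgt d) | d. d \<in> darts X}\<^sup>*"
proof -
  let ?R = "{(dsrc d, dtgt d) | d. d \<in> darts X}"
  have "sym ?R"
  proof (rule symI)
    fix a b assume "(a, b) \<in> ?R"
    then obtain d where "d \<in> darts X" "a = dsrc d" "b = dtgt d" by auto
    then have "drev d \<in> darts X" "b = dsrc (drev d)" "a = dtgt (drev d)" using rev_in src_rev tgt_rev by auto
    then show "(b, a) \<in> ?R" by blast
  qed
  then have sym: "sym (?R\<^sup>*)" by (rule sym_rtrancl)
  have along: "(pt e 0, pt e x) \<in> ?R\<^sup>*" if e: "e < num_edges G" and "x \<in> X e" for e x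
  proof (rule ccontr)
    assume bad: "(pt e 0, pt e x) \<notin> ?R\<^sup>*"
    define B where "B = {x \<in> X e. (pt e 0, pt e x) \<notin> ?R\<^sup>*}"
    have "x \<in> B" using bad \<open>x \<in> X e\<close> unfolding B_def by blast
    then have "B \<noteq> {}" by blast
    have "finite B" unfolding B_def using X_facts(1)[OF e] by (rule rev_finite_subset) blast
    note B = \<open>finite B\<close> \<open>B \<noteq> {}\<close>
    define z where "z = Min B"
    have "z \<in> B" unfolding z_def using B by (rule Min_in)
    then have z: "z \<in> X e" "(pt e 0, pt e z) \<notin> ?R\<^sup>*" unfolding B_def by blast+
    then have "z \<noteq> 0" by (metis rtrancl.rtrancl_refl)
    then have "0 < z" using X_facts(4)[OF e z(1)] by simp
    note p = consecutive_prv[OF X_facts(1)[OF e] z(1) X_facts(2)[OF e] this]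
    have "prv (X e) z \<notin> B" using Min_le[OF B(1), of "prv (X e) z"] p(2) by (auto simp: z_def)
    then have "(pt e 0, pt e (prv (X e) z)) \<in> ?R\<^sup>*" using p(1) unfolding B_def consecutive_def by blast
    moreover have "(pt e (prv (X e) z), pt e z) \<in> ?R"
    proof -
      have "(e, prv (X e) z, z) \<in> darts X" using p(1) e consecutive_sym by (auto simp: darts_def)
      then show ?thesis by (force simp: dsrc_def dtgt_def)
    qed
    ultimately show False using z(2) by (meson rtrancl.rtrancl_into_rtrancl)
  qed
  have ends: "(Vertex (esrc G e), Vertex (etgt G e)) \<in> ?R\<^sup>*" if "e < num_edges G" for e
    using along[OF that X_facts(3)[OF that]] edge_facts(3)[OF that] by (simp add: point_at.simps)
  have adj: "(Vertex a, Vertex b) \<in> ?R\<^sup>*" if "(a, b) \<in> (adjacency G)\<^sup>*" for a b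
    using that
  proof (induction rule: rtrancl_induct)
    case (step b c)
    then obtain e where e: "e < num_edges G" "{b, c} = {esrc G e, etgt G e}" by (auto simp: adjacency_def)
    then have "(Vertex b, Vertex c) \<in> ?R\<^sup>*"
      using ends[OF e(1)] symD[OF sym ends[OF e(1)]] by (auto simp: doubleton_eq_iff)
    with step.IH show ?case by (rule rtrancl_trans)
  qed simp
  have base: "(Vertex 0, u) \<in> ?R\<^sup>*" if "u \<in> verts X" for u
  proof -
    have V: "(Vertex 0, Vertex a) \<in> ?R\<^sup>*" if "a < num_vertices G" for a
      by (rule adj) (use metric_graph that in \<open>auto simp: metric_graph_def\<close>)
    from that consider a where "u = Vertex a" "a < num_vertices G"
      | e x where "u = pt e x" "e < num_edges G" "x \<in> X e" unfolding verts_def by blast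
    then show ?thesis
    proof cases
      case (2 e x)
      have "(Vertex 0, pt e 0) \<in> ?R\<^sup>*" using V[OF edge_facts(1)[OF 2(2)]] by (simp add: point_at.simps)
      from rtrancl_trans[OF this along[OF 2(2,3)]] show ?thesis unfolding 2(1) .
    qed (use V in auto)
  qed
  show ?thesis using symD[OF sym base[OF assms(1)]] base[OF assms(2)] by (rule rtrancl_trans)
qed

end

section \<open>A finite rank-determining set\<close>

context subdivided
begin

text \<open>Firing the segment \<open>[x, y]\<close> moves chips from its ends towards \<open>c\<close> until one of them arrives; \<open>Q\<close> is the
  function outside the segment, \<open>m\<close> its slope at \<open>x\<close>.\<close>

lemma tent_sol:
  fixes m :: int and D :: "location \<Rightarrow> int"
  assumes e: "e < num_edges G" and mem: "x \<in> X e" "y \<in> X e" "c \<in> X e" and c: "x < c" "c < y"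
    and m: "m \<le> -1" and k: "k \<le> Q (pt e x)" "Q (pt e x) + of_int m * (c - x) \<le> k" "Q (pt e y) = k"
    and inner: "\<And>z. z \<in> X e \<Longrightarrow> x < z \<Longrightarrow> z < y \<Longrightarrow> 0 \<le> D (OnEdge e z)"
    and outer: "\<And>w. w \<in> verts X \<Longrightarrow> (\<And>z. w = OnEdge e z \<Longrightarrow> z \<le> x \<or> y \<le> z) \<Longrightarrow>
      0 \<le> D w + (\<Sum>d | d \<in> darts X \<and> dsrc d = w.
        if d = (e, x, nxt (X e) x) then m else if d = (e, y, prv (X e) y) then -1 else fl Q d)"
  shows "\<exists>h. sol (\<lambda>w. D w - (if w = OnEdge e c then 1 else 0)) h"
proof -
  define L where "L z = Q (pt e x) + of_int m * (z - x)" for z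
  \<comment> \<open>The plateau \<open>k - s\<close> has the larger of the heights
    \<open>L c\<close> and \<open>k - (y - c)\<close> that the lines from \<open>x\<close> and
    \<open>y\<close> have at \<open>c\<close>. So \<open>c\<close> is where the plateau meets one of
    the lines: the place of the first chip when it arrives.\<close>
  define s where "s = min (k - L c) (y - c)"
  define T where "T z = max (L z) (max (k - (y - z)) (k - s))" for z
  define h where "h w = (case w of Vertex v \<Rightarrow> Q w | OnEdge e' z \<Rightarrow> if e' = e \<and> x < z \<and> z < y then T z else Q w)" for w
  have s0: "0 \<le> s" using k(2) c by (simp add: s_def L_def)
  have xy: "x < y" using c by simp
  have range: "0 \<le> x" "y \<le> elen G e" using X_facts(4)[OF e mem(1)] X_facts(5)[OF e mem(2)] .
  have T1: "T z + of_int m * (t - z) \<le> T t" if "T z = L z" for z t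
    using that by (simp add: T_def L_def algebra_simps)
  have T2: "T z + of_int 1 * (t - z) \<le> T t" if "T z = k - (y - z)" for z t
    unfolding that by (simp add: T_def algebra_simps)
  have T3: "T z + of_int 0 * (t - z) \<le> T t" if "T z = k - s" for z t
    unfolding that by (simp add: T_def)
  have Tx: "T x = L x" using k(1) s0 xy by (simp add: T_def L_def)
  have Ly: "L y \<le> k"
  proof -
    have "of_int m * (y - c) \<le> 0" using m c by (simp add: mult_le_0_iff)
    then show ?thesis using k(2) by (simp add: L_def algebra_simps)
  qed
  have Ty: "T y = k - (y - y)" using Ly s0 by (simp add: T_def)
  have hT: "h (pt e z) = T z" if "x \<le> z" "z \<le> y" for z
  proof -
    from that consider "z = x" | "z = y" | "x < z" "z < y" by linarith
    then show ?thesis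
    proof cases
      case 1
      have "h (pt e x) = Q (pt e x)" by (auto simp: h_def point_at.simps)
      then show ?thesis using 1 Tx by (simp add: L_def)
    next
      case 2
      have "h (pt e y) = Q (pt e y)" by (auto simp: h_def point_at.simps)
      then show ?thesis using 2 Ty k(3) by simp
    next
      case 3
      then have "pt e z = OnEdge e z" using range by (simp add: point_at.simps)
      then show ?thesis using 3 by (simp add: h_def)
    qed
  qed
  have up: "i \<le> fl h (e, z, t)" if "(e, z, t) \<in> darts X" "x \<le> z" "z < t" "t \<le> y" "T z + of_int i * (t - z) \<le> T t" for i z t
    using that hT[of z] hT[of t] unfolding fl_ge_iff[OF that(1)]
    by (simp add: dtgt_def dsrc_def dlen_def)
  have down: "i \<le> fl h (e, z, t)" if "(e, z, t) \<in> darts X" "x \<le> t" "t < z" "z \<le> y" "T z + of_int i * (z - t) \<le> T t" for i z t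
    using that hT[of z] hT[of t] unfolding fl_ge_iff[OF that(1)]
    by (simp add: dtgt_def dsrc_def dlen_def)
  \<comment> \<open>Two supporting lines at \<open>z\<close> are used, one of slope \<open>i\<close>
    to the right and one of slope \<open>- j\<close> to the left.\<close>
  have gain_inner: "i + j \<le> gain h (OnEdge e z)"
    if z: "z \<in> X e" "x < z" "z < y" and ij: "\<And>t. T z + of_int i * (t - z) \<le> T t" "\<And>t. T z + of_int (- j) * (t - z) \<le> T t"
    for z i j
  proof -
    note n = consecutive_nxt[OF X_facts(1)[OF e] z(1) mem(2) z(3)]
    note p = consecutive_prv[OF X_facts(1)[OF e] z(1) mem(1) z(2)]
    have "i \<le> fl h (e, z, nxt (X e) z)"
      by (rule up) (use n z e ij(1) in \<open>auto simp: darts_def\<close>)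
    moreover have "j \<le> fl h (e, z, prv (X e) z)"
      by (rule down) (use p z e ij(2)[of "prv (X e) z"] in \<open>auto simp: darts_def algebra_simps\<close>)
    moreover have "gain h (OnEdge e z) = fl h (e, z, nxt (X e) z) + fl h (e, z, prv (X e) z)"
      unfolding gain_def by (rule sum_darts_at_OnEdge) (use e z range in auto)
    ultimately show ?thesis by linarith
  qed
  have "0 \<le> D w - (if w = OnEdge e c then 1 else 0) + gain h w" if w: "w \<in> verts X" for w
  proof (cases "\<exists>z. w = OnEdge e z \<and> x < z \<and> z < y")
    case True
    then obtain z where z: "w = OnEdge e z" "x < z" "z < y" by auto
    then have zX: "z \<in> X e" using w OnEdge_in_verts by auto
    show ?thesis
    proof (cases "z = c")
      case True
      have Tc: "T c = k - s" by (auto simp: T_def s_def)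
      \<comment> \<open>At \<open>c\<close> the plateau of slope 0 meets a line of slope
        \<open>m\<close> coming from the left or of slope 1 going to the right; either kink brings
        at least one chip.\<close>
      have "1 \<le> gain h (OnEdge e c)"
      proof (cases "k - L c \<le> y - c")
        case True
        then have Lc: "T c = L c" using Tc by (simp add: s_def)
        have "0 + (- m) \<le> gain h (OnEdge e c)"
          by (rule gain_inner[OF mem(3) c]) (use T1[OF Lc] T3[OF Tc] in auto)
        then show ?thesis using m by simp
      next
        case False
        then have Lc: "T c = k - (y - c)" using Tc by (simp add: s_def)
        have "1 + 0 \<le> gain h (OnEdge e c)"
          by (rule gain_inner[OF mem(3) c]) (use T2[OF Lc] T3[OF Tc] in auto)
        then show ?thesis by simp
      qed
      then show ?thesis using inner[OF zX z(2,3)] z True by simp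
    next
      case False
      have "\<exists>i::int. \<forall>t. T z + of_int i * (t - z) \<le> T t"
      proof -
        consider "T z = L z" | "T z = k - (y - z)" | "T z = k - s" unfolding T_def by (metis max_def)
        then show ?thesis using T1 T2 T3 by cases metis+
      qed
      then obtain i :: int where "\<And>t. T z + of_int i * (t - z) \<le> T t" by blast
      then have "i + (- i) \<le> gain h (OnEdge e z)"
        by (intro gain_inner[OF zX z(2,3)]) auto
      then show ?thesis using inner[OF zX z(2,3)] z False by simp
    qed
  next
    case False
    then have out: "z \<le> x \<or> y \<le> z" if "w = OnEdge e z" for z using that by force
    let ?\<phi> = "\<lambda>d. if d = (e, x, nxt (X e) x) then m else if d = (e, y, prv (X e) y) then -1 else fl Q d"
    have "?\<phi> d \<le> fl h d" if d: "d \<in> darts X" "dsrc d = w" for d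
    proof -
      note nx = consecutive_nxt[OF X_facts(1)[OF e] mem(1,2) xy]
      note py = consecutive_prv[OF X_facts(1)[OF e] mem(2,1) xy]
      consider "d = (e, x, nxt (X e) x)" | "d = (e, y, prv (X e) y)" "d \<noteq> (e, x, nxt (X e) x)"
        | "d \<noteq> (e, x, nxt (X e) x)" "d \<noteq> (e, y, prv (X e) y)" by blast
      then show ?thesis
      proof cases
        case 1
        have "m \<le> fl h (e, x, nxt (X e) x)"
          by (rule up) (use d nx T1[OF Tx] 1 in auto)
        then show ?thesis using 1 by simp
      next
        case 2
        have "- 1 \<le> fl h (e, y, prv (X e) y)"
          by (rule down) (use d py T2[OF Ty, of "prv (X e) y"] 2 in \<open>auto simp: algebra_simps\<close>)
        then show ?thesis using 2 xy by simp
      next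
        case 3
        obtain e' u v where uv: "d = (e', u, v)" "e' < num_edges G" "consecutive (X e') u v" "w = pt e' u"
          using d by (auto simp: darts_def dsrc_def)
        have src: "h (dsrc d) = Q (dsrc d)"
          using out d(2) unfolding h_def by (auto split: location.splits)
        \<comment> \<open>A dart that enters the open segment from outside is one of the two darts
          singled out. All others see \<open>Q\<close> at both ends.\<close>
        have "\<not> (x < z \<and> z < y)" if z: "dtgt d = OnEdge e z" for z
        proof
          assume zz: "x < z \<and> z < y"
          have ev: "e' = e" "v = z" using z uv(1) unfolding dtgt_def by (auto simp: pt_eq_OnEdge)
          have con: "consecutive (X e) u z" using uv(3) ev by simp
          have uX: "u \<in> X e" "u \<noteq> z" using con by (auto simp: consecutive_def)
          have nin: "\<not> (x < u \<and> u < y)"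
          proof
            assume u: "x < u \<and> u < y"
            then have "w = OnEdge e u" using uv(4) ev range by (auto simp: point_at.simps)
            then show False using out u by force
          qed
          show False
          proof (cases "u < z")
            case True
            then have "x \<le> u" using con mem(1) zz by (force simp: consecutive_def)
            then have "u = x" using nin True zz by auto
            then have "z = nxt (X e) x" using consecutive_unique_up[of "X e" x z, OF _ nx(1) _ nx(2)] con zz by simp
            then show False using 3(1) uv(1) ev \<open>u = x\<close> by simp
          next
            case False
            then have "z < u" using uX by simp
            then have "u \<le> y" using con mem(2) zz by (force simp: consecutive_def)
            then have "u = y" using nin \<open>z < u\<close> zz by auto
            then have "z = prv (X e) y" using consecutive_unique_down[of "X e" y z, OF _ py(1) _ py(2)] con zz by simp
            then show False using 3(2) uv(1) ev \<open>u = y\<close> by simp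
          qed
        qed
        then have "h (dtgt d) = Q (dtgt d)" unfolding h_def by (auto split: location.splits)
        then have "fl h d = fl Q d" using src by (simp add: fl_def)
        then show ?thesis using 3 by simp
      qed
    qed
    then have "(\<Sum>d | d \<in> darts X \<and> dsrc d = w. ?\<phi> d) \<le> gain h w"
      unfolding gain_def by (intro sum_mono) auto
    moreover have "w \<noteq> OnEdge e c" using False c by auto
    ultimately show ?thesis using outer[OF w out] by simp
  qed
  then show ?thesis unfolding sol_def by blast
qed

lemma gain_const: "gain (\<lambda>_. r) w = 0"
  by (simp add: gain_def fl_def)

lemma finite_darts_at: "finite {d. d \<in> darts X \<and> dsrc d = w}"
  using finite_S by simp

text \<open>The situation is normalised: \<open>D\<close> is effective with a chip at
  \<open>a\<close>, and \<open>g\<close> brings one to \<open>b\<close>. Chips of \<open>D\<close>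
  on \<open>[c, b]\<close> can be used directly. If there are none, \<open>g\<close> is convex on
  \<open>[c, b]\<close>, and the comparison of its values at \<open>c\<close> and \<open>b\<close>
  tells whether \<open>g\<close> itself can deliver a chip to \<open>c\<close>.\<close>

lemma sol_between:
  fixes D :: "location \<Rightarrow> int"
  assumes e: "e < num_edges G" and mem: "a \<in> X e" "b \<in> X e" "c \<in> X e" and c: "a < c" "c < b"
    and ne: "pt e a \<noteq> pt e b"
    and D0: "\<And>w. w \<in> verts X \<Longrightarrow> 0 \<le> D w" and Da: "1 \<le> D (pt e a)"
    and g: "sol (\<lambda>w. D w - (if w = pt e b then 1 else 0)) g"
  shows "\<exists>h. sol (\<lambda>w. D w - (if w = OnEdge e c then 1 else 0)) h"
proof -
  have vert: "pt e z \<in> verts X" if "z \<in> X e" for z using that e unfolding verts_def by blast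
  have range: "0 \<le> a" "b \<le> elen G e" using X_facts(4)[OF e mem(1)] X_facts(5)[OF e mem(2)] .
  have OE: "pt e z = OnEdge e z" if "a < z" "z < b" for z using that range by (simp add: point_at.simps)
  have fin: "finite (X e)" by (rule X_facts(1)[OF e])
  have gw: "0 \<le> D w - (if w = pt e b then 1 else 0) + gain g w" if "w \<in> verts X" for w
    using g that unfolding sol_def by blast
  have solc: "sol D (\<lambda>_. r)" for r using D0 by (simp add: sol_def gain_const)
  have solg: "sol D g" unfolding sol_def using gw by (smt (verit))
  consider (A) "1 \<le> D (pt e c)" | (B) y where "y \<in> X e" "c < y" "y \<le> b" "1 \<le> D (pt e y)"
    | (C) "\<And>z. z \<in> X e \<Longrightarrow> c \<le> z \<Longrightarrow> z \<le> b \<Longrightarrow> D (pt e z) < 1"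
    using mem(3) c by (metis linorder_not_less order_le_less)
  then show ?thesis
  proof cases
    case A
    then have "sol (\<lambda>w. D w - (if w = OnEdge e c then 1 else 0)) (\<lambda>_. 0)"
      using D0 OE[OF c] by (simp add: sol_def gain_const)
    then show ?thesis by blast
  next
    case (B y)
    have ne': "pt e a \<noteq> pt e y"
    proof (cases "y = b")
      case False
      then have "pt e y = OnEdge e y" using B c OE[of y] by auto
      then show ?thesis using B(2) c pt_eq_OnEdge[of e a e y] by auto
    qed (use ne in simp)
    \<comment> \<open>Starting from a constant function, the chips at \<open>a\<close> and
      \<open>y\<close> approach \<open>c\<close> at equal speed.\<close>
    show ?thesis
    proof (rule tent_sol[OF e mem(1) B(1) mem(3) c(1) B(2), where m = "-1" and k = 0 and Q = "\<lambda>_. 0"])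
      show "0 + real_of_int (- 1) * (c - a) \<le> 0" using c by simp
      show "0 \<le> D (OnEdge e z)" if "z \<in> X e" "a < z" "z < y" for z
        using D0[OF vert[OF that(1)]] OE[of z] that B by simp
      fix w assume w: "w \<in> verts X"
      let ?Dw = "{d. d \<in> darts X \<and> dsrc d = w}"
      let ?d1 = "(e, a, nxt (X e) a)" and ?d2 = "(e, y, prv (X e) y)"
      have "(\<Sum>d\<in>?Dw. if d = ?d1 then - 1 else if d = ?d2 then - 1 else fl (\<lambda>_. 0) d)
        = (\<Sum>d\<in>?Dw. (if d = ?d1 then - 1 else 0) + (if d = ?d2 then - 1 else 0 :: int))"
        using B c by (intro sum.cong) (auto simp: fl_def)
      also have "\<dots> = (if ?d1 \<in> ?Dw then - 1 else 0) + (if ?d2 \<in> ?Dw then - 1 else 0)"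
        unfolding sum.distrib using finite_darts_at by (simp add: sum.delta')
      also have "\<dots> \<ge> (if w = pt e a then - 1 else 0) + (if w = pt e y then - 1 else 0)"
        by (auto simp: dsrc_def)
      finally have "(if w = pt e a then - 1 else 0) + (if w = pt e y then - 1 else 0) \<le>
        (\<Sum>d\<in>?Dw. if d = ?d1 then - 1 else if d = ?d2 then - 1 else fl (\<lambda>_. 0) d)" .
      moreover have "(if w = pt e a then 1 else 0) + (if w = pt e y then 1 else 0) \<le> D w"
        using ne' Da B(4) D0[OF w] by (auto)
      ultimately show "0 \<le> D w + (\<Sum>d\<in>?Dw. if d = ?d1 then - 1 else if d = ?d2 then - 1 else fl (\<lambda>_. 0) d)"
        by (simp split: if_splits)
    qed auto
  next
    case C
    then have Dz: "D (pt e z) = 0" if "z \<in> X e" "c \<le> z" "z \<le> b" for z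
      using that D0[OF vert[OF that(1)]] by fastforce
    define U where "U z = fl g (e, z, nxt (X e) z)" for z
    define V where "V z = fl g (e, z, prv (X e) z)" for z
    define p where "p = pt e c"
    define k where "k = g (pt e b)"
    have p: "p = OnEdge e c" using OE[OF c] by (simp add: p_def)
    have gain_UV: "gain g (OnEdge e z) = U z + V z" if "z \<in> X e" "a < z" "z < b" for z
      unfolding gain_def U_def V_def by (rule sum_darts_at_OnEdge) (use e that range in auto)
    have pos: "0 \<le> U z + V z" if "z \<in> X e" "c \<le> z" "z < b" for z
    proof -
      have "pt e z = OnEdge e z" using OE[of z] that c by simp
      then show ?thesis using gw[OF vert[OF that(1)]] Dz[of z] gain_UV[of z] that c by (simp split: if_splits)
    qed
    have UV: "of_int (U u) * (v - u) \<le> g (pt e v) - g (pt e u) \<and> of_int (V v) * (v - u) \<le> g (pt e u) - g (pt e v)"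
      if uv: "consecutive (X e) u v" "u < v" for u v
    proof -
      have m: "u \<in> X e" "v \<in> X e" and s: "consecutive (X e) v u" using uv consecutive_sym by (auto simp: consecutive_def)
      have "nxt (X e) u = v" using consecutive_nxt[OF fin m uv(2)] uv consecutive_unique_up by metis
      moreover have "prv (X e) v = u" using consecutive_prv[OF fin m(2,1) uv(2)] s uv consecutive_unique_down by metis
      moreover have "(e, u, v) \<in> darts X" using uv e by (auto simp: darts_def)
      ultimately show ?thesis using fl_dart_up[of e u v g] uv(2) unfolding U_def V_def by metis
    qed
    have up: "of_int (U c) * (b - c) \<le> g (pt e b) - g (pt e c)"
      by (rule discrete_convex_up[OF fin mem(3,2) c(2), where V = V]) (use UV pos in auto)
    have down: "of_int (V b) * (b - c) \<le> g (pt e c) - g (pt e b)"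
      by (rule discrete_convex_down[OF fin mem(3,2) c(2), where U = U]) (use UV pos in auto)
    show ?thesis
    proof (cases "g p > k")
      case True
      then have "of_int (U c) * (b - c) < 0" using up by (simp add: p_def k_def)
      then have "U c < 0" using c by (simp add: mult_less_0_iff)
      then have "1 \<le> V c" using pos[OF mem(3)] c by simp
      \<comment> \<open>By convexity \<open>g\<close> descends immediately to the right of
        \<open>c\<close>, so it must rise with slope at least 1 to the left. Cutting
        \<open>g\<close> off below \<open>g p\<close> removes the descent but keeps the rise, and a
        chip arrives at \<open>c\<close>.\<close>
      define h where "h w = max (g w) (g p)" for w
      have sol: "sol D h" unfolding h_def by (rule sol_max[OF solg solc])
      have "c < elen G e" "0 < c" using c range by auto
      have dc: "(e, c, nxt (X e) c) \<in> darts X" "(e, c, prv (X e) c) \<in> darts X"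
        using darts_at_OnEdge(1)[OF e mem(3) \<open>0 < c\<close> \<open>c < elen G e\<close>] by blast+
      have src: "dsrc (e, c, t) = p" for t by (simp add: dsrc_def p_def)
      have "0 \<le> fl h (e, c, nxt (X e) c)"
        unfolding fl_ge_iff[OF dc(1)] src by (simp add: h_def)
      moreover have "V c \<le> fl h (e, c, prv (X e) c)"
        unfolding V_def by (rule fl_mono[OF dc(2)]) (simp add: src h_def)
      moreover have "gain h (OnEdge e c) = fl h (e, c, nxt (X e) c) + fl h (e, c, prv (X e) c)"
        unfolding gain_def by (rule sum_darts_at_OnEdge[OF e mem(3) \<open>0 < c\<close> \<open>c < elen G e\<close>])
      ultimately have "1 \<le> gain h (OnEdge e c)" using \<open>1 \<le> V c\<close> by linarith
      then have "sol (\<lambda>w. D w - (if w = OnEdge e c then 1 else 0)) h"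
        using sol D0 unfolding sol_def by (smt (verit))
      then show ?thesis by blast
    next
      case False
      then have gp: "g p \<le> k" by simp
      then have "of_int (V b) * (b - c) \<le> 0" using down by (simp add: p_def k_def)
      then have Vb: "V b \<le> 0" using c by (simp add: mult_le_0_iff)
      \<comment> \<open>As \<open>V b \<le> 0\<close>, the chip that \<open>g\<close> brings to
        \<open>b\<close> does not come along \<open>[c, b]\<close>; it remains available at
        \<open>b\<close> after cutting \<open>g\<close> off below the level of \<open>b\<close>, and
        can be sent towards \<open>c\<close>.\<close>
      define Q where "Q w = max (g w) k" for w
      have solQ: "sol D Q" unfolding Q_def by (rule sol_max[OF solg solc])
      \<comment> \<open>The partner on the left of \<open>c\<close> is the last position where
        \<open>g\<close> exceeds \<open>k\<close>, from which \<open>g\<close> itself sends chips to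
        the right; if there is no such position, it is \<open>a\<close> with the chip of
        \<open>D\<close>. In both cases a line of slope \<open>m\<close> from there is down to
        \<open>k\<close> at \<open>c\<close>.\<close>
      have "\<exists>x m. x \<in> X e \<and> a \<le> x \<and> x < c \<and> m \<le> (-1 :: int) \<and> Q (pt e x) + of_int m * (c - x) \<le> k \<and>
         (x = a \<and> m = -1 \<and> g (pt e a) \<le> k \<or> k < g (pt e x) \<and> m = fl g (e, x, nxt (X e) x))"
      proof (cases "\<exists>z\<in>X e. a \<le> z \<and> z < c \<and> k < g (pt e z)")
        case False
        then have "g (pt e a) \<le> k" using mem(1) c by force
        then show ?thesis using mem(1) c
          by (intro exI[of _ a] exI[of _ "-1"]) (auto simp: Q_def max_def)
      next
        case True
        define S where "S = {z \<in> X e. a \<le> z \<and> z < c \<and> k < g (pt e z)}"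
        have S: "finite S" "S \<noteq> {}"
        proof -
          show "S \<noteq> {}" using True unfolding S_def by blast
          show "finite S" unfolding S_def using fin by (rule rev_finite_subset) blast
        qed
        define x where "x = Max S"
        have "x \<in> S" unfolding x_def using S by (rule Max_in)
        then have x: "x \<in> X e" "a \<le> x" "x < c" "k < g (pt e x)" unfolding S_def by blast+
        note n = consecutive_nxt[OF fin x(1) mem(3) x(3)]
        define v where "v = nxt (X e) x"
        have v: "consecutive (X e) x v" "x < v" "v \<le> c" "v \<in> X e" using n by (auto simp: v_def consecutive_def)
        have gv: "g (pt e v) \<le> k"
        proof (rule ccontr)
          assume *: "\<not> ?thesis"
          then have "v \<noteq> c" using gp by (auto simp: p_def)
          then have "v \<in> S" using * v x(2) unfolding S_def by auto
          then have "v \<le> x" unfolding x_def using S by simp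
          then show False using v(2) by simp
        qed
        have Uv: "of_int (U x) * (v - x) \<le> g (pt e v) - g (pt e x)" using UV[OF v(1,2)] by blast
        then have "of_int (U x) * (v - x) < 0" using gv x(4) by linarith
        then have "U x < 0" using v(2) by (simp add: mult_less_0_iff)
        then have "of_int (U x) * (c - x) \<le> of_int (U x) * (v - x)" using v(3) by (simp add: mult_left_mono_neg)
        then have "Q (pt e x) + of_int (U x) * (c - x) \<le> k" using Uv gv x(4) by (simp add: Q_def)
        then show ?thesis using x \<open>U x < 0\<close>
          by (intro exI[of _ x] exI[of _ "U x"]) (auto simp: U_def)
      qed
      then obtain x and m :: int where x: "x \<in> X e" "a \<le> x" "x < c" and m: "m \<le> -1" "Q (pt e x) + of_int m * (c - x) \<le> k"
        and cases: "x = a \<and> m = -1 \<and> g (pt e a) \<le> k \<or> k < g (pt e x) \<and> m = fl g (e, x, nxt (X e) x)" by blast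
      have ne': "pt e x \<noteq> pt e b"
      proof (cases "x = a")
        case False
        then have "pt e x = OnEdge e x" using x c OE[of x] by auto
        then show ?thesis using x c pt_eq_OnEdge[of e b e x] by auto
      qed (use ne in simp)
      show ?thesis
      proof (rule tent_sol[where Q = Q and k = k, OF e x(1) mem(2,3) x(3) c(2) m(1) _ m(2)])
        show "k \<le> Q (pt e x)" "Q (pt e b) = k" by (auto simp: Q_def k_def)
        show "0 \<le> D (OnEdge e z)" if "z \<in> X e" "x < z" "z < b" for z
          using D0[OF vert[OF that(1)]] OE[of z] that x by simp
        fix w assume w: "w \<in> verts X"
        define Dw where "Dw = {d. d \<in> darts X \<and> dsrc d = w}"
        have Dw: "d \<in> darts X" "dsrc d = w" if "d \<in> Dw" for d using that by (auto simp: Dw_def)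
        have gain_Dw: "gain f w = (\<Sum>d\<in>Dw. fl f d)" for f unfolding gain_def Dw_def ..
        let ?d1 = "(e, x, nxt (X e) x)" and ?d2 = "(e, b, prv (X e) b)"
        let ?\<phi> = "\<lambda>d. if d = ?d1 then m else if d = ?d2 then - 1 else fl Q d"
        have d1: "?d1 \<in> Dw \<longleftrightarrow> w = pt e x"
          using consecutive_nxt(1)[OF fin x(1) mem(3) x(3)] e by (auto simp: Dw_def darts_def dsrc_def)
        have d2: "?d2 \<in> Dw \<longleftrightarrow> w = pt e b"
          using consecutive_prv(1)[OF fin mem(2) mem(3) c(2)] e by (auto simp: Dw_def darts_def dsrc_def)
        have finD: "finite Dw" unfolding Dw_def by (rule finite_darts_at)
        consider "w = pt e x" | "w = pt e b" | "w \<noteq> pt e x" "w \<noteq> pt e b" by blast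
        then have "0 \<le> D w + (\<Sum>d\<in>Dw. ?\<phi> d)"
        proof cases
          case 1
          have nd2: "d \<noteq> ?d2" if "d \<in> Dw" for d
          proof
            assume "d = ?d2"
            with that d2 have "w = pt e b" by metis
            then show False using 1 ne' by metis
          qed
          from cases show ?thesis
          proof
            assume i: "x = a \<and> m = -1 \<and> g (pt e a) \<le> k"
            show ?thesis
            proof -
              have "(\<Sum>d\<in>Dw. ?\<phi> d) = ?\<phi> ?d1 + (\<Sum>d\<in>Dw - {?d1}. ?\<phi> d)"
                by (rule sum.remove[OF finD]) (use d1 1 in blast)
              moreover have "0 \<le> (\<Sum>d\<in>Dw - {?d1}. ?\<phi> d)"
              proof (rule sum_nonneg)
                fix d assume d: "d \<in> Dw - {?d1}"
                then have dD: "d \<in> Dw" "d \<noteq> ?d1" by auto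
                have "Q (dsrc d) = k" unfolding Dw(2)[OF dD(1)] 1 using i by (simp add: Q_def)
                then have "0 \<le> fl Q d" unfolding fl_ge_iff[OF Dw(1)[OF dD(1)]] by (simp add: Q_def)
                then show "0 \<le> ?\<phi> d" using dD nd2[OF dD(1)] by simp
              qed
              ultimately show ?thesis using Da 1 i by simp
            qed
          next
            assume ii: "k < g (pt e x) \<and> m = fl g ?d1"
            have "fl g d \<le> ?\<phi> d" if d: "d \<in> Dw" for d
            proof (cases "d = ?d1")
              case False
              have "Q (dsrc d) = g (dsrc d)" unfolding Dw(2)[OF d] 1 using ii by (simp add: Q_def)
              then have "fl g d \<le> fl Q d" by (intro fl_mono Dw(1)[OF d]) (simp add: Q_def)
              then show ?thesis using False nd2[OF d] by simp
            qed (use ii in simp)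
            then have "gain g w \<le> (\<Sum>d\<in>Dw. ?\<phi> d)" unfolding gain_Dw by (rule sum_mono)
            then show ?thesis using gw[OF w] 1 ne' by simp
          qed
        next
          case 2
          \<comment> \<open>The dart towards \<open>c\<close> contributes at most 0 to the gain of
            \<open>g\<close> at \<open>b\<close>, so the other darts contribute at least 1; this
            pays for the new slope -1.\<close>
          have "(\<Sum>d\<in>Dw. ?\<phi> d) = ?\<phi> ?d2 + (\<Sum>d\<in>Dw - {?d2}. ?\<phi> d)"
            by (rule sum.remove[OF finD]) (use d2 2 in blast)
          moreover have "?\<phi> ?d2 = -1" using x c by simp
          moreover have "gain g w = fl g ?d2 + (\<Sum>d\<in>Dw - {?d2}. fl g d)"
            unfolding gain_Dw by (rule sum.remove[OF finD]) (use d2 2 in blast)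
          moreover have "(\<Sum>d\<in>Dw - {?d2}. fl g d) \<le> (\<Sum>d\<in>Dw - {?d2}. ?\<phi> d)"
          proof (rule sum_mono)
            fix d assume d: "d \<in> Dw - {?d2}"
            then have dD: "d \<in> Dw" by simp
            have "Q (dsrc d) = g (dsrc d)" unfolding Dw(2)[OF dD] 2 by (simp add: Q_def k_def)
            then have "fl g d \<le> fl Q d" by (intro fl_mono Dw(1)[OF dD]) (simp add: Q_def)
            moreover have "d \<noteq> ?d1"
            proof
              assume "d = ?d1"
              with dD d1 have "w = pt e x" by metis
              then show False using 2 ne' by metis
            qed
            ultimately show "fl g d \<le> ?\<phi> d" using d by simp
          qed
          moreover have "D w = 0" using Dz[OF mem(2)] c 2 by simp
          ultimately show ?thesis using gw[OF w] 2 Vb unfolding V_def by simp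
        next
          case 3
          have "(\<Sum>d\<in>Dw. ?\<phi> d) = gain Q w"
            unfolding gain_Dw
          proof (rule sum.cong)
            fix d assume "d \<in> Dw"
            then have "d \<noteq> ?d1" "d \<noteq> ?d2" using d1 d2 3 by metis+
            then show "?\<phi> d = fl Q d" by simp
          qed simp
          then show ?thesis using solQ w unfolding sol_def by simp
        qed
        then show "0 \<le> D w + (\<Sum>d | d \<in> darts X \<and> dsrc d = w. ?\<phi> d)" unfolding Dw_def .
      qed
    qed
  qed
qed

end

section \<open>From segments of an edge to all points\<close>

context metric
begin

lemma subdivision_containing:
  assumes "subdivision Y" "finite K" "K \<subseteq> points G"
  obtains X where "subdivision X" "\<And>e. Y e \<subseteq> X e" "K \<subseteq> verts X"
proof -
  define X where "X e = Y e \<union> {z. OnEdge e z \<in> K}" for e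
  have "finite {z. OnEdge e z \<in> K}" for e
    using finite_vimageI[OF assms(2), of "OnEdge e"] by (auto simp: vimage_def inj_on_def)
  moreover have "{z. OnEdge e z \<in> K} \<subseteq> {0..elen G e}" for e
    using assms(3) by (auto simp: points_eq)
  ultimately have X: "subdivision X" using assms(1) unfolding subdivision_def X_def by auto
  interpret subdivided G X by unfold_locales (rule X)
  have "p \<in> verts X" if "p \<in> K" for p
  proof (cases p)
    case (Vertex v)
    then show ?thesis using that assms(3) by (auto simp: verts_def points_eq)
  next
    case (OnEdge e z)
    then have "OnEdge e z \<in> points G" "z \<in> X e" using that assms(3) by (auto simp: X_def)
    then show ?thesis unfolding OnEdge OnEdge_in_verts by (auto simp: points_eq)
  qed
  then have "K \<subseteq> verts X" by blast
  then show ?thesis by (rule that[OF X, rotated]) (auto simp: X_def)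
qed

lemma finer_subdivision:
  assumes "subdivision Y" "D \<in> Div G"
  obtains X where "subdivision X" "\<And>e. Y e \<subseteq> X e" "keys D \<subseteq> verts X"
  using subdivision_containing[OF assms(1), of "keys D"] assms(2) by (auto simp: Div_def)

lemma subdivision_endpoints: "subdivision (\<lambda>e. {0, elen G e})"
  using edge_facts(3) by (auto simp: subdivision_def less_imp_le)

lemma Div_frag_of: "p \<in> points G \<Longrightarrow> frag_of p \<in> Div G"
  by (simp add: Div_def)

lemma Div_add: "D \<in> Div G \<Longrightarrow> E \<in> Div G \<Longrightarrow> D + E \<in> Div G"
  unfolding Div_def using keys_add[of D E] by blast

lemma Div_diff: "D \<in> Div G \<Longrightarrow> E \<in> Div G \<Longrightarrow> D - E \<in> Div G"
  unfolding Div_def using keys_diff[of D E] by blast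

text \<open>With a witness \<open>f\<close> for \<open>a\<close>, the divisor is replaced by the
  equivalent \<open>D + div(f)\<close>, which is effective with a chip at \<open>a\<close>, as
  \<open>sol_between\<close> wants it. A witness for \<open>b\<close> is corrected by subtracting
  \<open>f\<close>, and the resulting solution for \<open>c\<close> by adding
  \<open>f\<close>.\<close>

lemma linear_system_between:
  assumes D: "D \<in> Div G" and e: "e < num_edges G" and abc: "0 \<le> a" "a < c" "c < b" "b \<le> elen G e"
    and ne: "pt e a \<noteq> pt e b"
    and lin: "linear_system G (D - frag_of (pt e a)) \<noteq> {}" "linear_system G (D - frag_of (pt e b)) \<noteq> {}"
  shows "linear_system G (D - frag_of (OnEdge e c)) \<noteq> {}"
proof -
  have pts: "pt e a \<in> points G" "pt e b \<in> points G" "OnEdge e c \<in> points G"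
    using abc e pt_in_points[OF e, of a] pt_in_points[OF e, of b] by (auto simp: points_eq)
  have Divs: "D - frag_of (pt e a) \<in> Div G" "D - frag_of (pt e b) \<in> Div G" "D - frag_of (OnEdge e c) \<in> Div G"
    using D pts Div_diff Div_frag_of by blast+
  obtain f where f: "rational_function G f"
    "\<And>p. p \<in> points G \<Longrightarrow> 0 \<le> lookup (D - frag_of (pt e a)) p + ord_at G f p"
    using lin(1) linear_system_iff[OF Divs(1)] by auto
  obtain Y where Y: "subdivision Y" "affine_on Y f" using f(1) rational_function_iff by auto
  define Z where "Z e' = (if e' = e then Y e' \<union> {a, b, c} else Y e')" for e'
  have "subdivision Z" using Y(1) abc unfolding subdivision_def Z_def by auto
  then obtain X where X: "subdivision X" "\<And>e. Z e \<subseteq> X e" "keys D \<subseteq> verts X"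
    using finer_subdivision[OF _ D] by metis
  interpret subdivided G X by unfold_locales (rule X)
  have abcX: "a \<in> X e" "b \<in> X e" "c \<in> X e" using X(2)[of e] by (auto simp: Z_def)
  have aff: "affine_on X f"
  proof (rule affine_on_refine[OF Y(1) X(1) _ Y(2)])
    show "Y e' \<subseteq> X e'" for e' using X(2)[of e'] by (auto simp: Z_def split: if_splits)
  qed
  have pv: "pt e a \<in> verts X" "pt e b \<in> verts X" using abcX e unfolding verts_def by blast+
  have cv: "OnEdge e c \<in> verts X" using abcX abc e by (simp add: OnEdge_in_verts)
  have keys: "keys (D - frag_of q) \<subseteq> verts X" if "q \<in> verts X" for q
    using keys_diff[of D "frag_of q"] X(3) that by auto
  obtain f2 where f2: "sol (lookup (D - frag_of (pt e b))) f2"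
    using lin(2) linear_system_iff_sol[OF keys[OF pv(2)]] by blast
  define D' where "D' w = lookup D w + gain f w" for w
  define g where "g w = f2 w - f w" for w
  have lookup: "lookup (D - frag_of q) w = lookup D w - (if w = q then 1 else 0)" for q w
    by (simp add: lookup_minus)
  \<comment> \<open>Adding integer multiples of \<open>f\<close> commutes with rounding because
    \<open>f\<close> is affine with an integer slope on every segment of \<open>X\<close>.\<close>
  have fl_diff: "fl (\<lambda>w. f1 w + i * f w) d = fl f1 d + j * fl f d"
    if "d \<in> darts X" "i = of_int j" for f1 d i j
  proof -
    have eq: "f (dtgt d) - f (dsrc d) = of_int (fl f d) * dlen d"
      using fl_eq_dslope[OF aff that(1)] by simp
    have "(f1 (dtgt d) + i * f (dtgt d) - (f1 (dsrc d) + i * f (dsrc d))) / dlen d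
      = (f1 (dtgt d) - f1 (dsrc d) + of_int j * (f (dtgt d) - f (dsrc d))) / dlen d"
      by (simp add: that(2) algebra_simps)
    also have "\<dots> = (f1 (dtgt d) - f1 (dsrc d)) / dlen d + of_int (j * fl f d)"
      unfolding eq using len_pos[OF that(1)] by (simp add: field_simps)
    finally show ?thesis unfolding fl_def[of "\<lambda>w. f1 w + i * f w"] fl_def[of f1] by linarith
  qed
  have gain_diff: "gain (\<lambda>w. f1 w + i * f w) v = gain f1 v + j * gain f v" if "i = of_int j" for f1 v i j
    unfolding gain_def sum_distrib_left sum.distrib[symmetric] by (rule sum.cong) (use fl_diff that in auto)
  have D'a: "0 \<le> D' w - (if w = pt e a then 1 else 0)" if "w \<in> verts X" for w
    using f(2)[of w] that verts_subset ord_at_gain[OF aff that] unfolding lookup D'_def by force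
  have "sol (\<lambda>w. D' w - (if w = pt e b then 1 else 0)) g"
    using f2 gain_diff[of "-1" "-1" f2] unfolding sol_def lookup D'_def g_def
    by (simp add: algebra_simps)
  moreover have "0 \<le> D' w" if "w \<in> verts X" for w using D'a[OF that] by (auto split: if_splits)
  moreover have "1 \<le> D' (pt e a)" using D'a[OF pv(1)] by simp
  ultimately obtain h where h: "sol (\<lambda>w. D' w - (if w = OnEdge e c then 1 else 0)) h"
    using sol_between[OF e abcX abc(2,3) ne, of D' g] by blast
  have "sol (lookup (D - frag_of (OnEdge e c))) (\<lambda>w. h w + 1 * f w)"
    using h gain_diff[of 1 1 h] unfolding sol_def lookup D'_def by (simp add: algebra_simps)
  then show ?thesis using linear_system_iff_sol[OF keys[OF cv]] by blast
qed

text \<open>The two halves of an edge have different ends even if the edge is a loop, which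
  \<open>linear_system_between\<close> requires of \<open>a\<close> and \<open>b\<close>.\<close>

definition rank_determining_set :: "location set" where
  "rank_determining_set = {Vertex v | v. v < num_vertices G} \<union> {OnEdge e (elen G e / 2) | e. e < num_edges G}"

lemma rank_determining_set_subset: "rank_determining_set \<subseteq> points G"
proof -
  have "0 < elen G e / 2 \<and> elen G e / 2 < elen G e" if "e < num_edges G" for e
    using edge_facts(3)[OF that] by simp
  then show ?thesis unfolding rank_determining_set_def points_eq by blast
qed

lemma linear_system_rank_determining:
  assumes D: "D \<in> Div G" and p: "p \<in> points G"
    and lin: "\<And>a. a \<in> rank_determining_set \<Longrightarrow> linear_system G (D - frag_of a) \<noteq> {}"
  shows "linear_system G (D - frag_of p) \<noteq> {}"
proof (cases "p \<in> rank_determining_set")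
  case False
  then obtain e z where z: "p = OnEdge e z" "e < num_edges G" "0 < z" "z < elen G e" "z \<noteq> elen G e / 2"
    using p by (auto simp: points_eq rank_determining_set_def)
  define l where "l = elen G e"
  have l: "0 < l" using edge_facts(3)[OF z(2)] by (simp add: l_def)
  have half: "pt e (l / 2) = OnEdge e (l / 2)" using l by (simp add: l_def point_at.simps)
  have ends: "pt e 0 = Vertex (esrc G e)" "pt e l = Vertex (etgt G e)" using l by (auto simp: l_def point_at.simps)
  have mem: "pt e 0 \<in> rank_determining_set" "pt e l \<in> rank_determining_set" "pt e (l / 2) \<in> rank_determining_set"
    unfolding ends half rank_determining_set_def using z(2) edge_facts[OF z(2)] by (auto simp: l_def)
  show ?thesis
  proof (cases "z < l / 2")
    case True
    show ?thesis unfolding z(1)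
      by (rule linear_system_between[OF D z(2) order_refl z(3) True _ _ lin[OF mem(1)] lin[OF mem(3)]])
         (use l half ends in \<open>auto simp: l_def\<close>)
  next
    case False
    then have "l / 2 < z" "z < l" using z by (auto simp: l_def)
    show ?thesis unfolding z(1)
      by (rule linear_system_between[OF D z(2) _ \<open>l / 2 < z\<close> \<open>z < l\<close> _ _ lin[OF mem(3)] lin[OF mem(2)]])
         (use l half ends in \<open>auto simp: l_def\<close>)
  qed
qed (use lin in auto)

end

text \<open>Effective divisors as lists with repetition: the degree is the length, and those on a
  finite set are enumerated by \<open>List.n_lists\<close>.\<close>

definition points_divisor :: "location list \<Rightarrow> (location \<Rightarrow>\<^sub>0 int)" where
  "points_divisor ps = (\<Sum>p\<leftarrow>ps. frag_of p)"

lemma points_divisor_simps [simp]: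
  "points_divisor [] = 0" "points_divisor (p # ps) = frag_of p + points_divisor ps"
  by (auto simp: points_divisor_def)

lemma lookup_points_divisor: "lookup (points_divisor ps) p = int (count_list ps p)"
  by (induction ps) (auto simp: lookup_add)

lemma effective_points_divisor: "effective (points_divisor ps)"
  by (simp add: effective_def lookup_points_divisor)

lemma deg_eq_sum:
  assumes "finite S" "keys D \<subseteq> S"
  shows "deg D = (\<Sum>p\<in>S. lookup D p)"
  unfolding deg_def by (rule sum.mono_neutral_left) (use assms in \<open>auto simp: in_keys_iff\<close>)

lemma deg_add: "deg (D + E) = deg D + deg E"
proof -
  let ?S = "keys D \<union> keys E"
  have "deg (D + E) = (\<Sum>p\<in>?S. lookup (D + E) p)"
    by (rule deg_eq_sum) (use keys_add[of D E] in auto)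
  also have "\<dots> = (\<Sum>p\<in>?S. lookup D p) + (\<Sum>p\<in>?S. lookup E p)"
    by (simp add: lookup_add sum.distrib)
  also have "\<dots> = deg D + deg E"
    by (simp add: deg_eq_sum[of ?S D] deg_eq_sum[of ?S E])
  finally show ?thesis .
qed

lemma deg_frag_of: "deg (frag_of p) = 1"
  by (simp add: deg_def)

lemma deg_points_divisor: "deg (points_divisor ps) = int (length ps)"
  by (induction ps) (auto simp: deg_add deg_frag_of, simp add: deg_def)

lemma effective_eq_points_divisor:
  assumes "effective E" "keys E \<subseteq> S"
  obtains ps where "set ps \<subseteq> S" "E = points_divisor ps"
proof -
  have "\<exists>ps. set ps \<subseteq> S \<and> E = points_divisor ps"
    using assms
  proof (induction "nat (deg E)" arbitrary: E)
    case 0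
    have "deg E \<le> 0" using 0 by simp
    have "0 \<le> lookup E p" for p using 0 by (simp add: effective_def)
    moreover have "(\<Sum>p\<in>keys E. lookup E p) = 0"
      using \<open>deg E \<le> 0\<close> calculation sum_nonneg[of "keys E" "lookup E"] by (simp add: deg_def)
    ultimately have "\<forall>p\<in>keys E. lookup E p = 0" by (subst (asm) sum_nonneg_eq_0_iff) auto
    then have "E = 0" by (metis in_keys_iff keys_eq_empty equals0I)
    then show ?case by (intro exI[of _ "[]"]) simp
  next
    case (Suc n)
    then have "E \<noteq> 0" by (auto simp: deg_def)
    then obtain p where p: "p \<in> keys E" by (metis keys_eq_empty equals0I)
    let ?F = "E - frag_of p"
    have pos: "0 < lookup E p" using p Suc.prems(1) by (auto simp: effective_def in_keys_iff order.not_eq_order_implies_strict)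
    have E: "E = frag_of p + ?F" by simp
    have "deg E = 1 + deg ?F" by (subst E) (simp only: deg_add deg_frag_of)
    then have "n = nat (deg ?F)" using Suc.hyps(2) by simp
    moreover have "effective ?F" using Suc.prems(1) pos by (auto simp: effective_def lookup_minus)
    moreover have "keys ?F \<subseteq> S" using keys_diff[of E "frag_of p"] p Suc.prems(2) by auto
    ultimately obtain ps where "set ps \<subseteq> S" "?F = points_divisor ps" using Suc.hyps(1) by blast
    then show ?case using p Suc.prems(2) E by (intro exI[of _ "p # ps"]) auto
  qed
  then show ?thesis using that by blast
qed

section \<open>Reduction of the rank to the finite set\<close>

context metric
begin

lemma Div_points_divisor: "set ps \<subseteq> points G \<Longrightarrow> points_divisor ps \<in> Div G"
  by (induction ps) (auto intro: Div_add Div_frag_of, simp add: Div_def)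

text \<open>The points are exchanged one at a time. The induction is over all \<open>D\<close>,
  because the points already exchanged and those still waiting are both subtracted from it.\<close>

lemma linear_system_points_divisor:
  assumes "D \<in> Div G" "set ps \<subseteq> points G"
    and "\<And>as. set as \<subseteq> rank_determining_set \<Longrightarrow> length as = length ps \<Longrightarrow> linear_system G (D - points_divisor as) \<noteq> {}"
  shows "linear_system G (D - points_divisor ps) \<noteq> {}"
  using assms
proof (induction ps arbitrary: D)
  case Nil
  then show ?case using Nil.prems(3)[of "[]"] by simp
next
  case (Cons p ps)
  have ps: "points_divisor ps \<in> Div G" using Cons.prems(2) by (intro Div_points_divisor) auto
  have "linear_system G (D - points_divisor ps - frag_of p) \<noteq> {}"
  proof (rule linear_system_rank_determining)
    show "D - points_divisor ps \<in> Div G" using Cons.prems(1) ps by (rule Div_diff)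
    show "p \<in> points G" using Cons.prems(2) by simp
    fix a assume a: "a \<in> rank_determining_set"
    have "linear_system G (D - frag_of a - points_divisor ps) \<noteq> {}"
    proof (rule Cons.IH)
      show "D - frag_of a \<in> Div G"
        using Cons.prems(1) a rank_determining_set_subset by (intro Div_diff Div_frag_of) auto
      fix as assume "set as \<subseteq> rank_determining_set" "length as = length ps"
      then show "linear_system G (D - frag_of a - points_divisor as) \<noteq> {}"
        using Cons.prems(3)[of "a # as"] a by (simp add: diff_diff_eq)
    qed (use Cons.prems(2) in auto)
    then show "linear_system G (D - points_divisor ps - frag_of a) \<noteq> {}"
      by (simp add: diff_diff_eq add.commute)
  qed
  then show ?case by (simp add: diff_diff_eq add.commute)
qed

text \<open>Rounded slopes sum to at most 0. This bounds the search: removing more than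
  \<open>deg D\<close> points leaves nothing effective.\<close>

lemma linear_system_deg:
  assumes "D \<in> Div G" "linear_system G D \<noteq> {}"
  shows "0 \<le> deg D"
proof -
  obtain X where X: "subdivision X" "keys D \<subseteq> verts X"
    using finer_subdivision[OF subdivision_endpoints assms(1)] by metis
  interpret subdivided G X by unfold_locales (rule X)
  obtain f where "sol (lookup D) f" using assms(2) linear_system_iff_sol[OF X(2)] by blast
  then show ?thesis using sol_sum_nonneg deg_eq_sum[OF finite_W X(2)] by metis
qed

theorem divisor_rank_eq:
  assumes D: "D \<in> Div G"
  defines "Q \<equiv> \<lambda>k. \<exists>as. set as \<subseteq> rank_determining_set \<and> length as = k \<and> linear_system G (D - points_divisor as) = {}"
  shows "\<exists>k. Q k" "divisor_rank G D = int (LEAST k. Q k) - 1"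
proof -
  \<comment> \<open>One point more than the degree; for negative degree \<open>nat\<close> yields
    the empty list, which already serves.\<close>
  define as where "as = replicate (nat (deg D + 1)) (Vertex 0)"
  have as: "set as \<subseteq> rank_determining_set" using metric_graph
    by (auto simp: as_def rank_determining_set_def metric_graph_def)
  have "D - points_divisor as \<in> Div G"
    using D as rank_determining_set_subset by (intro Div_diff Div_points_divisor) auto
  moreover have "deg (D - points_divisor as) < 0"
  proof -
    have "deg D = deg (D - points_divisor as) + deg (points_divisor as)" by (simp add: deg_add[symmetric])
    moreover have "deg (points_divisor as) \<ge> deg D + 1" by (simp add: deg_points_divisor as_def)
    ultimately show ?thesis by linarith
  qed
  ultimately have "linear_system G (D - points_divisor as) = {}" using linear_system_deg by force
  then show ex: "\<exists>k. Q k" unfolding Q_def using as by blast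
  define k where "k = (LEAST k. Q k)"
  have Qk: "Q k" unfolding k_def using ex by (rule LeastI_ex)
  \<comment> \<open>The integers are not well-ordered, so the minimum is exhibited
    explicitly.\<close>
  have "(LEAST d. \<exists>E\<in>Div G. effective E \<and> linear_system G (D - E) = {} \<and> d = deg E) = int k"
  proof (rule Least_equality)
    obtain as where as: "set as \<subseteq> rank_determining_set" "length as = k" "linear_system G (D - points_divisor as) = {}"
      using Qk unfolding Q_def by blast
    have "points_divisor as \<in> Div G" using as(1) rank_determining_set_subset by (intro Div_points_divisor) auto
    then show "\<exists>E\<in>Div G. effective E \<and> linear_system G (D - E) = {} \<and> int k = deg E"
      using as effective_points_divisor deg_points_divisor by metis
  next
    fix d assume "\<exists>E\<in>Div G. effective E \<and> linear_system G (D - E) = {} \<and> d = deg E"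
    then obtain E where E: "E \<in> Div G" "effective E" "linear_system G (D - E) = {}" "d = deg E" by auto
    obtain ps where ps: "set ps \<subseteq> points G" "E = points_divisor ps"
      using effective_eq_points_divisor[OF E(2)] E(1) unfolding Div_def by blast
    have "Q (length ps)"
      using linear_system_points_divisor[OF D ps(1)] E(3) ps(2) unfolding Q_def by metis
    then have "k \<le> length ps" unfolding k_def by (rule Least_le)
    then show "int k \<le> d" using E(4) ps(2) by (simp add: deg_points_divisor)
  qed
  then show "divisor_rank G D = int (LEAST k. Q k) - 1" unfolding divisor_rank_def k_def by simp
qed

end

section \<open>The algorithm\<close>

type_synonym indexed_edge = "nat \<times> nat \<times> nat \<times> real"
type_synonym dart = "nat \<times> real \<times> real"

text \<open>From here on, functions are composed of folds, maps, filters and case distinctions, so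
  that their computability follows from the closure rules. Here the length of the accumulator serves
  as the index of the next edge.\<close>

definition index_edges :: "(nat \<times> nat \<times> real) list \<Rightarrow> indexed_edge list" where
  "index_edges es = foldl (\<lambda>a d. a @ [(length a, d)]) [] es"

definition undup :: "real list \<Rightarrow> real list" where
  "undup xs = foldl (\<lambda>a y. if \<exists>z\<in>set a. z = y then a else y # a) [] xs"

definition canonical :: "indexed_edge list \<Rightarrow> location \<Rightarrow> location" where
  "canonical es p = (case p of Vertex v \<Rightarrow> Vertex v | OnEdge e x \<Rightarrow>
     foldl (\<lambda>a d. if fst d = e then (if x = 0 then Vertex (fst (snd d))
       else if x = snd (snd (snd d)) then Vertex (fst (snd (snd d))) else OnEdge e x) else a) (OnEdge e x) es)"

definition positions :: "(location \<times> int) list \<Rightarrow> indexed_edge \<Rightarrow> real list" where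
  "positions ds d = undup (0 # snd (snd (snd d)) # concat (map (\<lambda>q.
     case fst q of Vertex v \<Rightarrow> [] | OnEdge e x \<Rightarrow> if e = fst d then [x] else []) ds))"

definition dart_list :: "indexed_edge list \<Rightarrow> (location \<times> int) list \<Rightarrow> dart list" where
  "dart_list es ds = concat (map (\<lambda>d. concat (map (\<lambda>x. map (\<lambda>y. (fst d, (x, y)))
     (filter (\<lambda>y. \<not> x = y \<and> (\<forall>z\<in>set (positions ds d). z \<le> x \<and> z \<le> y \<or> x \<le> z \<and> y \<le> z)) (positions ds d)))
     (positions ds d))) es)"

text \<open>A vertex may be listed several times. Conditions are then merely repeated, and the
  bounds taken from the list become larger.\<close>

definition vertex_list :: "nat \<Rightarrow> indexed_edge list \<Rightarrow> (location \<times> int) list \<Rightarrow> location list" where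
  "vertex_list n es ds = map (\<lambda>v. Vertex v) [0..<n] @
     concat (map (\<lambda>d. map (\<lambda>x. canonical es (OnEdge (fst d) x)) (positions ds d)) es)"

definition coefficient :: "indexed_edge list \<Rightarrow> (location \<times> int) list \<Rightarrow> location \<Rightarrow> int" where
  "coefficient es ds w = sum_list (map (\<lambda>q. if canonical es (fst q) = w then snd q else 0) ds)"

definition dart_length :: "dart \<Rightarrow> real" where
  "dart_length d = (if fst (snd d) < snd (snd d) then snd (snd d) - fst (snd d) else fst (snd d) - snd (snd d))"

text \<open>The factors from \<open>- B\<close> to \<open>B\<close> are split by sign, since
  \<open>i\<close> runs through natural numbers.\<close>

definition candidate_list :: "nat \<Rightarrow> dart list \<Rightarrow> nat \<Rightarrow> real list" where
  "candidate_list B dl n = ((\<lambda>L. L @ concat (map (\<lambda>a. concat (map (\<lambda>i.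
     map (\<lambda>d. a + real i * dart_length d) dl @ map (\<lambda>d. a - real i * dart_length d) dl) [0..<B + 1])) L)) ^^ n) [0]"

definition valuations :: "location list \<Rightarrow> real list \<Rightarrow> (location \<times> real) list list" where
  "valuations vl cs = foldl (\<lambda>A w. concat (map (\<lambda>f. map (\<lambda>r. (w, r) # f) cs) A)) [[]] vl"

definition valuation :: "(location \<times> real) list \<Rightarrow> location \<Rightarrow> real" where
  "valuation f w = foldl (\<lambda>a q. if fst q = w then snd q else a) 0 f"

definition dart_floor :: "indexed_edge list \<Rightarrow> (location \<times> real) list \<Rightarrow> dart \<Rightarrow> int" where
  "dart_floor es f d = \<lfloor>(valuation f (canonical es (OnEdge (fst d) (snd (snd d)))) -
     valuation f (canonical es (OnEdge (fst d) (fst (snd d))))) / dart_length d\<rfloor>"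

definition solves :: "indexed_edge list \<Rightarrow> (location \<times> int) list \<Rightarrow> location list \<Rightarrow> dart list \<Rightarrow>
    (location \<times> real) list \<Rightarrow> bool" where
  "solves es ds vl dl f \<longleftrightarrow> (\<forall>w\<in>set vl. 0 \<le> coefficient es ds w +
     sum_list (map (\<lambda>d. if canonical es (OnEdge (fst d) (fst (snd d))) = w then dart_floor es f d else 0) dl))"

definition slope_bound :: "indexed_edge list \<Rightarrow> (location \<times> int) list \<Rightarrow> location list \<Rightarrow> nat" where
  "slope_bound es ds vl = nat \<bar>sum_list (map (\<lambda>w. \<bar>coefficient es ds w\<bar>) vl)\<bar>"

definition solvable :: "nat \<Rightarrow> indexed_edge list \<Rightarrow> (location \<times> int) list \<Rightarrow> bool" where
  "solvable n es ds \<longleftrightarrow> (\<exists>f\<in>set (valuations (vertex_list n es ds)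
       (candidate_list (slope_bound es ds (vertex_list n es ds)) (dart_list es ds) (length (vertex_list n es ds)))).
     solves es ds (vertex_list n es ds) (dart_list es ds) f)"

text \<open>The number 2 is written as \<open>1 + 1\<close>, and -1 as \<open>0 - 1\<close> below,
  because programs have only the constants 0 and 1.\<close>

definition test_points :: "nat \<Rightarrow> indexed_edge list \<Rightarrow> location list" where
  "test_points n es = map (\<lambda>v. Vertex v) [0..<n] @ map (\<lambda>d. OnEdge (fst d) (snd (snd (snd d)) / (1 + 1))) es"

type_synonym input = "(nat \<times> (nat \<times> nat \<times> real) list) \<times> (location \<times> int) list"

text \<open>Subtracting points from the divisor amounts to appending entries with coefficient -1 to
  its presentation.\<close>

definition unsolvable_test :: "input \<Rightarrow> nat \<Rightarrow> bool" where
  "unsolvable_test x k \<longleftrightarrow> (\<exists>as\<in>set (List.n_lists k (test_points (fst (fst x)) (index_edges (snd (fst x))))).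
     \<not> solvable (fst (fst x)) (index_edges (snd (fst x))) (snd x @ map (\<lambda>a. (a, 0 - 1)) as))"

section \<open>Computability of the components\<close>

lemmas computable_list_intros = computable_intros computable_eq_location computable_append computable_map
  computable_filter computable_concat computable_Bex_set computable_Ball_set computable_sum_list_int
  computable_length computable_upt computable_floor computable_abs_int computable_nat_abs

lemma computable_comp3:
  assumes "computable (\<lambda>p. h (fst p) (fst (snd p)) (snd (snd p)))"
    "computable_on A f1" "computable_on A f2" "computable_on A f3"
  shows "computable_on A (\<lambda>x. h (f1 x) (f2 x) (f3 x))"
  using computable_comp1[OF assms(1) computable_Pair[OF assms(2) computable_Pair[OF assms(3,4)]]] by simp

lemma computable_comp5:
  assumes "computable (\<lambda>p. h (fst p) (fst (snd p)) (fst (snd (snd p))) (fst (snd (snd (snd p)))) (snd (snd (snd (snd p)))))"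
    "computable_on A f1" "computable_on A f2" "computable_on A f3" "computable_on A f4" "computable_on A f5"
  shows "computable_on A (\<lambda>x. h (f1 x) (f2 x) (f3 x) (f4 x) (f5 x))"
  using computable_comp1[OF assms(1) computable_Pair[OF assms(2) computable_Pair[OF assms(3)
      computable_Pair[OF assms(4) computable_Pair[OF assms(5,6)]]]]] by simp

lemma computable_index_edges: "computable_on A f \<Longrightarrow> computable_on A (\<lambda>x. index_edges (f x))"
  by (erule computable_comp1[rotated], unfold index_edges_def) (intro computable_list_intros)

lemma computable_undup: "computable_on A f \<Longrightarrow> computable_on A (\<lambda>x. undup (f x))"
  by (erule computable_comp1[rotated], unfold undup_def) (intro computable_list_intros)

lemma computable_canonical0: "computable (\<lambda>p. canonical (fst p) (snd p))"
  unfolding canonical_def by (intro computable_list_intros)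

lemmas computable_canonical = computable_comp2[OF computable_canonical0]

lemma computable_positions0: "computable (\<lambda>p. positions (fst p) (snd p))"
  unfolding positions_def by (intro computable_list_intros computable_undup)

lemmas computable_positions = computable_comp2[OF computable_positions0]

lemma computable_dart_list0: "computable (\<lambda>p. dart_list (fst p) (snd p))"
  unfolding dart_list_def by (intro computable_list_intros computable_positions)

lemmas computable_dart_list = computable_comp2[OF computable_dart_list0]

lemma computable_vertex_list0: "computable (\<lambda>p. vertex_list (fst p) (fst (snd p)) (snd (snd p)))"
  unfolding vertex_list_def by (intro computable_list_intros computable_positions computable_canonical)

lemmas computable_vertex_list = computable_comp3[OF computable_vertex_list0]

lemma computable_coefficient0: "computable (\<lambda>p. coefficient (fst p) (fst (snd p)) (snd (snd p)))"
  unfolding coefficient_def by (intro computable_list_intros computable_canonical)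

lemmas computable_coefficient = computable_comp3[OF computable_coefficient0]

lemma computable_dart_length: "computable_on A f \<Longrightarrow> computable_on A (\<lambda>x. dart_length (f x))"
  by (erule computable_comp1[rotated], unfold dart_length_def) (intro computable_list_intros)

lemma computable_candidate_list0: "computable (\<lambda>p. candidate_list (fst p) (fst (snd p)) (snd (snd p)))"
  unfolding candidate_list_def by (intro computable_list_intros computable_dart_length)

lemmas computable_candidate_list = computable_comp3[OF computable_candidate_list0]

lemma computable_valuations0: "computable (\<lambda>p. valuations (fst p) (snd p))"
  unfolding valuations_def by (intro computable_list_intros)

lemmas computable_valuations = computable_comp2[OF computable_valuations0]

lemma computable_valuation0: "computable (\<lambda>p. valuation (fst p) (snd p))"
  unfolding valuation_def by (intro computable_list_intros)

lemmas computable_valuation = computable_comp2[OF computable_valuation0]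

lemma computable_dart_floor0: "computable (\<lambda>p. dart_floor (fst p) (fst (snd p)) (snd (snd p)))"
  unfolding dart_floor_def by (intro computable_list_intros computable_valuation computable_canonical computable_dart_length)

lemmas computable_dart_floor = computable_comp3[OF computable_dart_floor0]

lemma computable_solves:
  "computable_on A f1 \<Longrightarrow> computable_on A f2 \<Longrightarrow> computable_on A f3 \<Longrightarrow> computable_on A f4 \<Longrightarrow> computable_on A f5 \<Longrightarrow>
   computable_on A (\<lambda>x. solves (f1 x) (f2 x) (f3 x) (f4 x) (f5 x))"
  by (erule (4) computable_comp5[rotated], unfold solves_def)
     (intro computable_list_intros computable_coefficient computable_canonical computable_dart_floor)

lemma computable_slope_bound0: "computable (\<lambda>p. slope_bound (fst p) (fst (snd p)) (snd (snd p)))"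
  unfolding slope_bound_def by (intro computable_list_intros computable_coefficient)

lemmas computable_slope_bound = computable_comp3[OF computable_slope_bound0]

lemma computable_solvable0: "computable (\<lambda>p. solvable (fst p) (fst (snd p)) (snd (snd p)))"
  unfolding solvable_def by (intro computable_list_intros computable_slope_bound computable_solves computable_valuations
        computable_candidate_list computable_dart_list computable_vertex_list)

lemmas computable_solvable = computable_comp3[OF computable_solvable0]

lemma computable_test_points0: "computable (\<lambda>p. test_points (fst p) (snd p))"
  unfolding test_points_def by (intro computable_list_intros)

lemmas computable_test_points = computable_comp2[OF computable_test_points0]

lemma computable_unsolvable_test: "computable (\<lambda>z. unsolvable_test (fst z) (snd z))"
  unfolding unsolvable_test_def
  by (intro computable_Bex_set computable_n_lists computable_list_intros computable_test_points computable_index_edges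
      computable_solvable)

section \<open>Correctness of the components\<close>

lemma index_edges_eq: "index_edges es = map (\<lambda>i. (i, es ! i)) [0..<length es]"
proof (induction es rule: rev_induct)
  case (snoc d es)
  have "index_edges (es @ [d]) = index_edges es @ [(length (index_edges es), d)]"
    by (simp add: index_edges_def)
  also have "\<dots> = map (\<lambda>i. (i, es ! i)) [0..<length es] @ [(length es, d)]"
    by (simp add: snoc)
  also have "map (\<lambda>i. (i, es ! i)) [0..<length es] = map (\<lambda>i. (i, (es @ [d]) ! i)) [0..<length es]"
    by (simp add: nth_append)
  finally show ?case by simp
qed (simp add: index_edges_def)

lemma undup_props: "set (undup xs) = set xs" "distinct (undup xs)"
proof -
  have "set (undup xs) = set xs \<and> distinct (undup xs)"
  proof (induction xs rule: rev_induct)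
    case (snoc x xs)
    have "undup (xs @ [x]) = (if \<exists>z\<in>set (undup xs). z = x then undup xs else x # undup xs)"
      by (simp add: undup_def)
    then show ?case using snoc by auto
  qed (simp add: undup_def)
  then show "set (undup xs) = set xs" "distinct (undup xs)" by auto
qed

lemma foldl_select:
  "foldl (\<lambda>a d. if fst d = e then F d else a) z (map (\<lambda>i. (i, g i)) [0..<n]) = (if e < n then F (e, g e) else z)"
  by (induction n) auto

lemma distinct_concat_map:
  assumes "distinct xs" "\<And>x. x \<in> set xs \<Longrightarrow> distinct (f x)"
    and "\<And>x y. x \<in> set xs \<Longrightarrow> y \<in> set xs \<Longrightarrow> x \<noteq> y \<Longrightarrow> set (f x) \<inter> set (f y) = {}"
  shows "distinct (concat (map f xs))"
  using assms by (induction xs) fastforce+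

lemma sum_list_filter_distinct:
  fixes g :: "'a \<Rightarrow> int"
  assumes "distinct xs"
  shows "sum_list (map (\<lambda>d. if P d then g d else 0) xs) = (\<Sum>d | d \<in> set xs \<and> P d. g d)"
proof -
  have "sum_list (map (\<lambda>d. if P d then g d else 0) xs) = (\<Sum>d\<in>set xs. if P d then g d else 0)"
    by (rule sum_list_distinct_conv_sum_set[OF assms])
  also have "\<dots> = (\<Sum>d\<in>{d \<in> set xs. P d}. g d)" by (rule sum.inter_filter[symmetric]) simp
  finally show ?thesis by simp
qed

lemma sum_set_le_sum_list:
  fixes g :: "'a \<Rightarrow> int"
  assumes "\<And>x. 0 \<le> g x"
  shows "(\<Sum>x\<in>set xs. g x) \<le> sum_list (map g xs)"
proof (induction xs)
  case (Cons x xs)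
  then show ?case using assms[of x] by (cases "x \<in> set xs") (auto simp: insert_absorb)
qed simp

lemma valuation_map: "w \<in> set ws \<Longrightarrow> valuation (map (\<lambda>w. (w, g w)) ws) w = g w"
proof (induction ws rule: rev_induct)
  case (snoc v ws)
  then show ?case by (cases "w = v") (auto simp: valuation_def)
qed simp

lemma valuations_complete:
  assumes "\<And>w. w \<in> set vl \<Longrightarrow> g w \<in> set cs"
  shows "map (\<lambda>w. (w, g w)) (rev vl) \<in> set (valuations vl cs)"
  using assms
proof (induction vl rule: rev_induct)
  case (snoc v vl)
  have "valuations (vl @ [v]) cs = concat (map (\<lambda>f. map (\<lambda>r. (v, r) # f) cs) (valuations vl cs))"
    by (simp add: valuations_def)
  moreover have "map (\<lambda>w. (w, g w)) (rev vl) \<in> set (valuations vl cs)" "g v \<in> set cs"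
    using snoc by auto
  ultimately show ?case by force
qed (simp add: valuations_def)

context metric
begin

abbreviation ies :: "indexed_edge list" where
  "ies \<equiv> index_edges (edges G)"

lemma set_ies: "set ies = (\<lambda>e. (e, edges G ! e)) ` {..<num_edges G}"
  by (simp add: index_edges_eq atLeast0LessThan)

lemma canonical_eq:
  assumes "p \<in> locations G"
  shows "canonical ies p = point_at G p"
proof (cases p)
  case (OnEdge e x)
  then have "e < num_edges G" using assms by (auto simp: locations_def)
  then show ?thesis unfolding OnEdge canonical_def index_edges_eq location.case foldl_select
    by (simp add: esrc_def etgt_def elen_def point_at.simps)
qed (simp add: canonical_def)

definition marks :: "(location \<times> int) list \<Rightarrow> nat \<Rightarrow> real set" where
  "marks ds e = set (positions ds (e, edges G ! e))"

lemma marks_eq: "marks ds e = {0, elen G e} \<union> {x. OnEdge e x \<in> fst ` set ds}"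
proof -
  have "(\<Union>q\<in>set ds. set (case fst q of Vertex v \<Rightarrow> [] | OnEdge e' x \<Rightarrow> if e' = e then [x] else [])) =
    {x. OnEdge e x \<in> fst ` set ds}"
    by (force split: location.splits if_splits)
  then show ?thesis
    by (simp add: marks_def positions_def undup_props elen_def)
qed

lemma subdivision_input:
  assumes "valid_presentation G ds"
  shows "subdivision (marks ds)"
  unfolding subdivision_def
proof (intro allI impI conjI)
  fix e assume e: "e < num_edges G"
  show "finite (marks ds e)" by (simp add: marks_def)
  show "{0, elen G e} \<subseteq> marks ds e" by (simp add: marks_eq)
  show "marks ds e \<subseteq> {0..elen G e}"
    using assms edge_facts(3)[OF e] unfolding marks_eq valid_presentation_def locations_def by force
qed

lemma set_dart_list: "set (dart_list ies ds) = darts (marks ds)"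
proof -
  have "set (dart_list ies ds) = {(e, x, y) | e x y. e < num_edges G \<and> x \<in> marks ds e \<and> y \<in> marks ds e \<and>
    x \<noteq> y \<and> (\<forall>z\<in>marks ds e. z \<le> x \<and> z \<le> y \<or> x \<le> z \<and> y \<le> z)}"
    unfolding dart_list_def marks_def set_concat set_map set_filter set_ies
    by (simp add: image_image) blast
  then show ?thesis by (auto simp: darts_def consecutive_def)
qed

text \<open>\<open>gain\<close> sums over a set of darts and the program over a list, so each dart
  must be listed once.\<close>

lemma distinct_dart_list: "distinct (dart_list ies ds)"
  unfolding dart_list_def
proof (intro distinct_concat_map)
  show "distinct ies" by (auto simp: index_edges_eq distinct_map intro: inj_onI)
  show "distinct (positions ds d)" for d by (simp add: positions_def undup_props)
  then show "distinct (map (\<lambda>y. (fst d, x, y)) (filter P (positions ds d)))" for d :: indexed_edge and x :: real and P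
    by (auto simp: distinct_map intro: inj_onI)
qed (auto simp: index_edges_eq, (metis prod.inject)+)

lemma dart_endpoints:
  assumes "valid_presentation G ds" "d \<in> darts (marks ds)"
  shows "canonical ies (OnEdge (fst d) (fst (snd d))) = dsrc d" "canonical ies (OnEdge (fst d) (snd (snd d))) = dtgt d"
proof -
  interpret subdivided G "marks ds" by unfold_locales (rule subdivision_input[OF assms(1)])
  obtain e x y where d: "d = (e, x, y)" "e < num_edges G" "x \<in> marks ds e" "y \<in> marks ds e"
    using assms(2) by (auto simp: darts_def consecutive_def)
  then have "OnEdge e x \<in> locations G" "OnEdge e y \<in> locations G"
    using X_facts(4,5)[OF d(2)] by (auto simp: locations_def)
  then show "canonical ies (OnEdge (fst d) (fst (snd d))) = dsrc d" "canonical ies (OnEdge (fst d) (snd (snd d))) = dtgt d"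
    by (auto simp: d(1) dsrc_def dtgt_def canonical_eq)
qed

lemma set_vertex_list:
  assumes "valid_presentation G ds"
  shows "set (vertex_list (num_vertices G) ies ds) = verts (marks ds)"
proof -
  interpret subdivided G "marks ds" by unfold_locales (rule subdivision_input[OF assms])
  have "canonical ies (OnEdge e x) = pt e x" if "e < num_edges G" "x \<in> marks ds e" for e x
    by (rule canonical_eq) (use X_facts(4,5)[OF that(1,2)] that(1) in \<open>auto simp: locations_def\<close>)
  then have "(\<Union>e<num_edges G. (\<lambda>x. canonical ies (OnEdge e x)) ` marks ds e) =
      (\<Union>e<num_edges G. pt e ` marks ds e)"
    by (intro SUP_cong image_cong) auto
  moreover have "set (vertex_list (num_vertices G) ies ds) = Vertex ` {..<num_vertices G} \<union>
      (\<Union>e<num_edges G. (\<lambda>x. canonical ies (OnEdge e x)) ` marks ds e)"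
    unfolding vertex_list_def marks_def by (auto simp: set_ies)
  moreover have "verts (marks ds) = Vertex ` {..<num_vertices G} \<union> (\<Union>e<num_edges G. pt e ` marks ds e)"
    unfolding verts_def by blast
  ultimately show ?thesis by simp
qed

lemma coefficient_eq:
  assumes "valid_presentation G ds"
  shows "coefficient ies ds w = lookup (presented_divisor G ds) w"
  using assms
proof (induction ds)
  case (Cons q ds)
  then have "canonical ies (fst q) = point_at G (fst q)" by (intro canonical_eq) (auto simp: valid_presentation_def)
  then show ?case using Cons
    by (cases q) (auto simp: coefficient_def presented_divisor_def valid_presentation_def lookup_add)
qed (simp add: coefficient_def presented_divisor_def)

lemma keys_presented_divisor:
  assumes "valid_presentation G ds"
  shows "keys (presented_divisor G ds) \<subseteq> verts (marks ds)"
proof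
  fix w assume "w \<in> keys (presented_divisor G ds)"
  then have ne: "coefficient ies ds w \<noteq> 0" using coefficient_eq[OF assms] by (simp add: in_keys_iff)
  have "\<exists>q\<in>set ds. canonical ies (fst q) = w"
  proof (rule ccontr)
    assume no: "\<not> ?thesis"
    have "coefficient ies ds w = sum_list (map (\<lambda>q. 0) ds)"
      unfolding coefficient_def by (intro arg_cong[where f = sum_list] map_cong) (use no in auto)
    then show False using ne by simp
  qed
  then obtain q where q: "q \<in> set ds" "canonical ies (fst q) = w" by blast
  have loc: "fst q \<in> locations G" using q assms by (auto simp: valid_presentation_def)
  then have w: "w = point_at G (fst q)" using q canonical_eq by simp
  show "w \<in> verts (marks ds)"
  proof (cases "fst q")
    case (Vertex v)
    then show ?thesis using loc w by (auto simp: locations_def verts_def)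
  next
    case (OnEdge e x)
    then have "e < num_edges G" "x \<in> marks ds e"
      using loc q(1) by (auto simp: locations_def marks_eq) (metis image_eqI)
    then show ?thesis unfolding verts_def w OnEdge by blast
  qed
qed

text \<open>Soundness is clear, as every listed valuation is tested. For completeness,
  \<open>sol_candidates\<close> provides a solution with values among the candidates, and the list
  contains these even though its bounds were computed with repeated vertices.\<close>

lemma solvable_correct:
  assumes ds: "valid_presentation G ds"
  shows "solvable (num_vertices G) ies ds \<longleftrightarrow> linear_system G (presented_divisor G ds) \<noteq> {}"
proof -
  interpret subdivided G "marks ds" by unfold_locales (rule subdivision_input[OF ds])
  let ?D = "lookup (presented_divisor G ds)"
  let ?vl = "vertex_list (num_vertices G) ies ds" and ?dl = "dart_list ies ds"
  let ?W = "verts (marks ds)" and ?X = "darts (marks ds)"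
  let ?S = "\<Sum>w\<in>?W. \<bar>?D w\<bar>"
  let ?B = "slope_bound ies ds ?vl"
  have len: "dart_length d = dlen d" for d by (auto simp: dart_length_def dlen_def)
  have solves: "solves ies ds ?vl ?dl f \<longleftrightarrow> sol ?D (valuation f)" for f
  proof -
    have "sum_list (map (\<lambda>d. if canonical ies (OnEdge (fst d) (fst (snd d))) = w then dart_floor ies f d else 0) ?dl)
      = gain (valuation f) w" for w
      unfolding sum_list_filter_distinct[OF distinct_dart_list] set_dart_list gain_def
    proof (rule sum.cong)
      show "{d. d \<in> ?X \<and> canonical ies (OnEdge (fst d) (fst (snd d))) = w} =
        {s. s \<in> ?X \<and> dsrc s = w}"
        using dart_endpoints[OF ds] by auto
      fix d assume "d \<in> {s. s \<in> ?X \<and> dsrc s = w}"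
      then have d: "d \<in> ?X" by simp
      show "dart_floor ies f d = fl (valuation f) d"
        unfolding dart_floor_def fl_def dart_endpoints[OF ds d] len ..
    qed
    then show ?thesis unfolding solves_def sol_def set_vertex_list[OF ds] coefficient_eq[OF ds] by simp
  qed
  have cands: "candidates (int B) n \<subseteq> set (candidate_list B ?dl n)" for B n
  proof (induction n)
    case (Suc n)
    show ?case
    proof
      fix r assume "r \<in> candidates (int B) (Suc n)"
      then consider "r \<in> candidates (int B) n"
        | a m d where "r = a + of_int m * dlen d" "a \<in> candidates (int B) n" "\<bar>m\<bar> \<le> int B" "d \<in> ?X"
        by auto
      then show "r \<in> set (candidate_list B ?dl (Suc n))"
      proof cases
        case 1
        then show ?thesis using Suc by (auto simp: candidate_list_def)
      next
        case (2 a m d)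
        define i where "i = nat \<bar>m\<bar>"
        have i: "i \<in> set [0..<B + 1]" using 2 by (auto simp: i_def)
        have r: "r = a + real i * dart_length d \<or> r = a - real i * dart_length d"
          using 2(1) by (cases "0 \<le> m") (auto simp: i_def len)
        have a: "a \<in> set (candidate_list B ?dl n)" using 2 Suc by auto
        have d: "d \<in> set ?dl" using 2 set_dart_list by simp
        have set_Suc: "set (candidate_list B ?dl (Suc n)) = set (candidate_list B ?dl n) \<union>
          (\<Union>a\<in>set (candidate_list B ?dl n). \<Union>i\<in>set [0..<B + 1].
            (\<lambda>d. a + real i * dart_length d) ` set ?dl \<union> (\<lambda>d. a - real i * dart_length d) ` set ?dl)"
          unfolding candidate_list_def funpow.simps comp_apply set_append set_concat set_map image_image ..
        have "r \<in> (\<lambda>d. a + real i * dart_length d) ` set ?dl \<union> (\<lambda>d. a - real i * dart_length d) ` set ?dl"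
          using r d by auto
        then show ?thesis unfolding set_Suc by (rule UnI2[OF UN_I[OF a UN_I[OF i]]])
      qed
    qed
  qed (simp add: candidate_list_def)
  have B: "?S \<le> int ?B"
  proof -
    have "(\<Sum>w\<in>set ?vl. \<bar>?D w\<bar>) \<le> sum_list (map (\<lambda>w. \<bar>?D w\<bar>) ?vl)" by (rule sum_set_le_sum_list) simp
    then show ?thesis unfolding slope_bound_def coefficient_eq[OF ds] set_vertex_list[OF ds] by simp
  qed
  show ?thesis unfolding linear_system_iff_sol[OF keys_presented_divisor[OF ds]]
  proof
    assume "solvable (num_vertices G) ies ds"
    then show "\<exists>f. sol ?D f" unfolding solvable_def solves by blast
  next
    assume "\<exists>f. sol ?D f"
    then obtain f where f: "sol ?D f" by blast
    obtain g where g: "sol ?D g" "\<And>w. w \<in> ?W \<Longrightarrow>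
        g w \<in> candidates ?S (card (?W))"
      using sol_candidates[OF f connected] by blast
    have "card (?W) \<le> length ?vl"
      unfolding set_vertex_list[OF ds, symmetric] by (rule card_length)
    then have "candidates ?S (card (?W))
        \<subseteq> candidates (int ?B) (length ?vl)"
      using candidates_mono_bound[OF B] candidates_mono by blast
    then have gc: "g w \<in> set (candidate_list ?B ?dl (length ?vl))" if "w \<in> set ?vl" for w
      using g(2) that cands unfolding set_vertex_list[OF ds] by blast
    \<comment> \<open>The solution as an association list, reversed because
      \<open>valuations\<close> prepends its entries. Away from the vertices it may differ from
      \<open>g\<close>, but \<open>fl\<close> only reads the ends of darts.\<close>
    let ?f = "map (\<lambda>w. (w, g w)) (rev ?vl)"
    have val: "valuation ?f w = g w" if "w \<in> ?W" for w
      by (rule valuation_map) (use that set_vertex_list[OF ds] in auto)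
    have "fl (valuation ?f) d = fl g d" if "d \<in> ?X" for d
      using val[OF src_in[OF that]] val[OF tgt_in[OF that]] by (simp add: fl_def)
    then have "gain (valuation ?f) w = gain g w" for w unfolding gain_def by (intro sum.cong) auto
    then have "sol ?D (valuation ?f)" using g(1) by (simp add: sol_def)
    then show "solvable (num_vertices G) ies ds"
      unfolding solvable_def solves by (rule bexI) (rule valuations_complete, rule gc)
  qed
qed

lemma set_test_points: "set (test_points (num_vertices G) ies) = rank_determining_set"
  unfolding test_points_def rank_determining_set_def set_append set_map set_ies image_image elen_def
  by (intro arg_cong2[where f = "(\<union>)"]) auto

lemma unsolvable_test_correct:
  assumes ds: "valid_presentation G ds"
  shows "unsolvable_test ((num_vertices G, edges G), ds) k \<longleftrightarrow>
    (\<exists>as. set as \<subseteq> rank_determining_set \<and> length as = k \<and>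
      linear_system G (presented_divisor G ds - points_divisor as) = {})"
proof -
  have "solvable (num_vertices G) ies (ds @ map (\<lambda>a. (a, 0 - 1)) as) \<longleftrightarrow>
      linear_system G (presented_divisor G ds - points_divisor as) \<noteq> {}"
    if as: "set as \<subseteq> rank_determining_set" for as
  proof -
    have loc: "a \<in> locations G \<and> point_at G a = a" if "a \<in> rank_determining_set" for a
    proof -
      have "a \<in> points G" using that rank_determining_set_subset by blast
      then show ?thesis by (auto simp: points_eq locations_def point_at.simps)
    qed
    have "valid_presentation G (ds @ map (\<lambda>a. (a, 0 - 1)) as)"
      using ds as loc by (auto simp: valid_presentation_def)
    moreover have "presented_divisor G (ds @ map (\<lambda>a. (a, 0 - 1)) as) = presented_divisor G ds - points_divisor as"
    proof -
      have "presented_divisor G (map (\<lambda>a. (a, 0 - 1)) as) = - points_divisor as"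
        using as loc by (induction as) (auto simp: presented_divisor_def)
      moreover have "presented_divisor G (ds @ es) = presented_divisor G ds + presented_divisor G es" for es
        by (simp add: presented_divisor_def)
      ultimately show ?thesis by simp
    qed
    ultimately show ?thesis using solvable_correct by metis
  qed
  then show ?thesis unfolding unsolvable_test_def by (auto simp: set_n_lists set_test_points)
qed

end

lemma encode_input_eq: "encode_input G ds = enc ((num_vertices G, edges G), ds)"
proof -
  have 1: "encode_edge = enc" by (rule ext) (auto simp: enc_simps)
  have 2: "encode_entry = enc" by (rule ext) (auto simp: enc_simps)
  show ?thesis by (simp add: encode_input_def encode_graph_def enc_prod_def enc_list_def enc_nat_def 1 2)
qed

theorem theorem4p1:
  shows "\<exists>A :: program. \<forall>(G :: multigraph) (ds :: (location \<times> int) list).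
           metric_graph G \<longrightarrow> valid_presentation G ds \<longrightarrow>
           halts_with A (encode_input G ds) (encode_int (divisor_rank G (presented_divisor G ds)))"
proof -
  \<comment> \<open>The domain consists of the inputs on which the search ends;
    \<open>divisor_rank_eq\<close> places every valid input in it.\<close>
  have "computable_on {x. \<exists>k. unsolvable_test x k} (\<lambda>x. int (LEAST k. unsolvable_test x k) - 1)"
    by (intro computable_arith_int computable_coerce computable_zero_one computable_Least_on computable_unsolvable_test)
  then obtain A n where A: "computes A n {x. \<exists>k. unsolvable_test x k} (\<lambda>x. int (LEAST k. unsolvable_test x k) - 1)"
    by (auto simp: computable_on_def)
  have "halts_with A (encode_input G ds) (encode_int (divisor_rank G (presented_divisor G ds)))"
    if G: "metric_graph G" and ds: "valid_presentation G ds" for G ds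
  proof -
    interpret metric G by unfold_locales (rule G)
    let ?x = "((num_vertices G, edges G), ds)"
    interpret subdivided G "marks ds" by unfold_locales (rule subdivision_input[OF ds])
    have D: "presented_divisor G ds \<in> Div G"
      using keys_presented_divisor[OF ds] verts_subset by (auto simp: Div_def)
    note rank = divisor_rank_eq[OF D, folded unsolvable_test_correct[OF ds]]
    obtain t where "run A ((\<lambda>_. Null)(0 := enc ?x)) t" "t 0 = enc (int (LEAST k. unsolvable_test ?x k) - 1)"
      using computesD[OF A, of ?x "(\<lambda>_. Null)(0 := enc ?x)"] rank(1) by auto
    then show ?thesis unfolding halts_with_def encode_input_eq rank(2) by (auto simp: enc_int_def)
  qed
  then show ?thesis by blast
qed

end
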